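(* Let $A$ and $B$ be real $n\times n$ matrices whose eigenvalues all have positive real parts. Then $(\mathbb R^n, D_A)$ and $(\mathbb R^n, D_B)$ are quasisymmetric (i.e. there exists a quasisymmetric map from $(\mathbb R^n,D_A)$ to $(\mathbb R^n,D_B)$) if and only if there is some $s>0$ such that $A$ and $sB$ have the same real part Jordan form.
   Context: For a real $n\times n$ matrix $A$ whose eigenvalues all have positive real parts, $G_A=\mathbb R^n\rtimes_A\mathbb R$ is the Lie group with group law $(x_1,t_1)\cdot(x_2,t_2)=(x_1+e^{t_1A}x_2,\,t_1+t_2)$. An admissible metric on $G_A$ is a left invariant Riemannian metric for which the $\mathbb R$ direction is perpendicular to the $\mathbb R^n$ factor; the standard metric is the left invariant metric given by the standard inner product at the identity $(0,0)$. Each of $G_A$, $G_B$ is equipped with an arbitrary admissible metric. Parabolic visual quasimetric: let $\|\cdot\|$ be the norm on $\mathbb R^n$ given by the admissible inner product at the identity (the Euclidean norm for the standard metric). The distance induced on $\mathbb R^n\times\{t\}\subset G_A$ is $d_{A,t}((x,t),(y,t))=\|e^{-tA}(x-y)\|$. For $x\ne y$ in $\mathbb R^n$, $D_A(x,y)=e^t$ where $t$ is the smallest real number with $\|e^{-tA}(x-y)\|=1$; $D_A(x,x)=0$. This is a quasimetric on $\mathbb R^n$ (symmetric, nonnegative, zero exactly on the diagonal, and $D_A(x,z)\le M(D_A(x,y)+D_A(y,z))$ for some constant $M\ge1$). $D_B$ is defined likewise from $G_B$. Real part Jordan form of $A$: the matrix obtained from the (complex) Jordan form of $A$ by replacing each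 diagonal entry by its real part and reordering the blocks to make it canonical. A bijection $F:X\to Y$ between quasimetric spaces is $\eta$-quasisymmetric, for a homeomorphism $\eta:[0,\infty)\to[0,\infty)$, if $\frac{\rho(F(x),F(y))}{\rho(F(x),F(z))}\le\eta\left(\frac{\rho(x,y)}{\rho(x,z)}\right)$ for all distinct triples $x,y,z\in X$; it is quasisymmetric if it is $\eta$-quasisymmetric for some $\eta$. *)

theory Defs
  imports "HOL-Analysis.Analysis" "Jordan_Normal_Form.Jordan_Normal_Form"
begin

definition matrix_exp :: "real^'n^'n \<Rightarrow> real^'n^'n" where
  "matrix_exp A = (\<Sum>k. (((**) A) ^^ k) (Finite_Cartesian_Product.mat 1) /\<^sub>R fact k)"

text \<open>The group \<open>G\<^sub>A\<close> has underlying manifold \<open>real^'n \<times> real\<close>, so every tangent space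
  is identified with \<open>real^'n \<times> real\<close>.\<close>

definition G_mult :: "real^'n^'n \<Rightarrow> (real^'n) \<times> real \<Rightarrow> (real^'n) \<times> real \<Rightarrow> (real^'n) \<times> real" where
  "G_mult A p q = (fst p + matrix_exp (snd p *\<^sub>R A) *v fst q, snd p + snd q)"

definition is_inner_product :: "('a::real_vector \<Rightarrow> 'a \<Rightarrow> real) \<Rightarrow> bool" where
  "is_inner_product g \<longleftrightarrow>
     bilinear g \<and> (\<forall>u v. g u v = g v u) \<and> (\<forall>u. u \<noteq> 0 \<longrightarrow> g u u > 0)"

text \<open>\<open>m p u v\<close> is the inner product of the tangent vectors \<open>u\<close>, \<open>v\<close> at the point \<open>p\<close>.
  Smoothness of \<open>m\<close> is not demanded separately since it follows from left invariance.\<close>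

definition left_invariant_metric ::
  "real^'n^'n \<Rightarrow> ((real^'n) \<times> real \<Rightarrow> (real^'n) \<times> real \<Rightarrow> (real^'n) \<times> real \<Rightarrow> real) \<Rightarrow> bool" where
  "left_invariant_metric A m \<longleftrightarrow>
     (\<forall>p. is_inner_product (m p)) \<and>
     (\<forall>p q u v. m (G_mult A p q) (frechet_derivative (G_mult A p) (at q) u)
                               (frechet_derivative (G_mult A p) (at q) v) = m q u v)"

definition admissible_metric ::
  "real^'n^'n \<Rightarrow> ((real^'n) \<times> real \<Rightarrow> (real^'n) \<times> real \<Rightarrow> (real^'n) \<times> real \<Rightarrow> real) \<Rightarrow> bool" where
  "admissible_metric A m \<longleftrightarrow>
     left_invariant_metric A m \<and> (\<forall>p x t. m p (x, 0) (0, t) = 0)"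

definition horizontal_norm ::
  "((real^'n) \<times> real \<Rightarrow> (real^'n) \<times> real \<Rightarrow> (real^'n) \<times> real \<Rightarrow> real) \<Rightarrow> real^'n \<Rightarrow> real" where
  "horizontal_norm m x = sqrt (m (0, 0) (x, 0) (x, 0))"

text \<open>The distance between \<open>(x, t)\<close> and \<open>(y, t)\<close> induced on the slice at height \<open>t\<close>.\<close>

definition slice_dist ::
  "real^'n^'n \<Rightarrow> ((real^'n) \<times> real \<Rightarrow> (real^'n) \<times> real \<Rightarrow> (real^'n) \<times> real \<Rightarrow> real) \<Rightarrow>
   real \<Rightarrow> real^'n \<Rightarrow> real^'n \<Rightarrow> real" where
  "slice_dist A m t x y = horizontal_norm m (matrix_exp ((- t) *\<^sub>R A) *v (x - y))"

definition parabolic_visual ::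
  "real^'n^'n \<Rightarrow> ((real^'n) \<times> real \<Rightarrow> (real^'n) \<times> real \<Rightarrow> (real^'n) \<times> real \<Rightarrow> real) \<Rightarrow>
   real^'n \<Rightarrow> real^'n \<Rightarrow> real" where
  "parabolic_visual A m x y = (if x = y then 0 else exp (LEAST t. slice_dist A m t x y = 1))"

definition eta_quasisymmetric ::
  "(real \<Rightarrow> real) \<Rightarrow> ('a \<Rightarrow> 'a \<Rightarrow> real) \<Rightarrow> ('b \<Rightarrow> 'b \<Rightarrow> real) \<Rightarrow> ('a \<Rightarrow> 'b) \<Rightarrow> bool" where
  "eta_quasisymmetric \<eta> \<rho> \<sigma> F \<longleftrightarrow>
     bij F \<and>
     (\<forall>x y z. x \<noteq> y \<and> y \<noteq> z \<and> x \<noteq> z \<longrightarrow>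
        \<sigma> (F x) (F y) / \<sigma> (F x) (F z) \<le> \<eta> (\<rho> x y / \<rho> x z))"

definition quasisymmetric ::
  "('a \<Rightarrow> 'a \<Rightarrow> real) \<Rightarrow> ('b \<Rightarrow> 'b \<Rightarrow> real) \<Rightarrow> ('a \<Rightarrow> 'b) \<Rightarrow> bool" where
  "quasisymmetric \<rho> \<sigma> F \<longleftrightarrow>
     (\<exists>\<eta> \<theta>. homeomorphism {0..} {0..} \<eta> \<theta> \<and> eta_quasisymmetric \<eta> \<rho> \<sigma> F)"

text \<open>\<open>from_nat_into UNIV\<close> enumerates the index type bijectively by \<open>{..<CARD('n)}\<close>; another
  enumeration would only conjugate the matrix by a permutation matrix.\<close>

definition complex_mat :: "real^'n^'n \<Rightarrow> complex mat" where
  "complex_mat A = Matrix.mat CARD('n) CARD('n)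
     (\<lambda>(i, j). complex_of_real
        (vec_nth (vec_nth A (from_nat_into UNIV i)) (from_nat_into UNIV j)))"

definition positive_real_parts :: "real^'n^'n \<Rightarrow> bool" where
  "positive_real_parts A \<longleftrightarrow> (\<forall>\<mu>. eigenvalue (complex_mat A) \<mu> \<longrightarrow> Re \<mu> > 0)"

text \<open>A Jordan matrix is given by its list of blocks (size, eigenvalue). The complex Jordan form
  is unique only up to the order of the blocks. The canonical order adopted here is by the
  diagonal entry, then by size: \<open>sort_key\<close> is stable, so the two successive sorts give this
  lexicographic order, and the result is independent of the choice made by \<open>SOME\<close>.\<close>

definition real_part_jordan_form :: "real^'n^'n \<Rightarrow> real mat" where
  "real_part_jordan_form A = jordan_matrix (sort_key snd (sort_key fst
     (map (\<lambda>(k, a). (k, Re a)) (SOME n_as. jordan_nf (complex_mat A) n_as))))"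

end

theory Submission
  imports Defs "Jordan_Normal_Form.Jordan_Normal_Form_Existence"
begin

text \<open>
  Only if: fix a gauge \<open>\<psi>\<close> and let \<open>E\<^sub>A\<close> be the space of covectors \<open>\<xi>\<close> with
  \<open>|exp(-tA)\<^sup>T \<xi>| = O(\<psi>(det exp(-tA)))\<close> as \<open>t \<rightarrow> \<infinity>\<close>. A quasi-ball \<open>y + exp(-tA)U\<close> has volume
  comparable to \<open>det exp(-tA)\<close>, so a covector \<open>\<xi> \<in> E\<^sub>B\<close> oscillates on a quasi-ball by at most
  \<open>\<psi>\<close> of its volume. If \<open>F\<close> is quasisymmetric it maps quasi-balls to quasi-balls, and \<open>u = \<xi> \<bullet> F\<close>
  has small variation: summing its oscillation over quasi-balls of the source costs at most the volume
  of a bounded set in the target. If \<open>u\<close> were not constant in the directions orthogonal to \<open>E\<^sub>A\<close>,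
  chains of quasi-balls in a fast direction would force a larger variation. Hence \<open>F\<close> maps cosets of
  the annihilator of \<open>E\<^sub>A\<close> into cosets of the annihilator of \<open>E\<^sub>B\<close>, and invariance of domain, applied to
  \<open>F\<close> and its inverse, gives \<open>dim E\<^sub>A = dim E\<^sub>B\<close>. For the gauges \<open>\<psi>(r) = r\<^sup>\<alpha> (1 + log(1/r))\<^sup>m\<close> these
  dimensions count the Jordan blocks by real part and size.

  If: over the complex numbers \<open>exp(tA)\<close> and \<open>exp(tsB)\<close> are conjugate up to commuting unitary factors, so
  some complex matrix \<open>H\<close> makes \<open>exp(-tsB) H exp(tA)\<close> bounded. So are the real and imaginary parts, a
  real combination of which is invertible and is the required map.
\<close>

text \<open>No differentiability of \<open>F\<close> is available, and the size that a
  quasisymmetric map controls on average is volume. This is why the decay of a covector is measured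
  against a determinant and not against time. That determinant is \<open>exp (a * t)\<close> with
  \<open>a\<close> the trace, so the factor \<open>s\<close> must be \<open>a / b\<close>: after
  rescaling, both flows expand volume at the same rate. A gauge is required to satisfy
  \<open>\<psi> r \<le> C * \<psi> \<rho> * (1 + r / \<rho>)\<close>. The right side is affine in
  the volume \<open>r\<close>, so an average of gauges reduces to an average of volumes. Powers with
  exponent in \<open>(0, 1]\<close> times powers of a logarithm qualify, and this range suffices
  because no real part of an eigenvalue exceeds the trace. The sum over quasi-balls is realised as
  an integral over their centres, with Fubini in the place of a covering argument. The logarithms
  detect block sizes, so the contradiction cannot rely on a gain of a power: a covector outside the
  decay space merely exceeds every constant multiple of the gauge at suitable times, and that
  unbounded factor is what defeats the variation.\<close>

no_notation Matrix.vec_index (infixl "$" 100)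
no_notation Matrix.scalar_prod (infix "\<bullet>" 70)
hide_const (open) Determinant.det Matrix.mat Matrix.row Matrix.orthogonal VectorSpace.subspace

subsection \<open>Volume of linear images\<close>

text \<open>The formula for a sheared box asks for a nonnegative lower bound in coordinate
  \<open>n\<close>. Translation reduces any box to this case, since a linear map sends translates to
  translates.\<close>

lemma measure_shear_image:
  fixes S :: "(real^'n) set"
  assumes mn: "m \<noteq> n" and S: "S \<in> lmeasurable"
  defines "h \<equiv> \<lambda>x::real^'n. \<chi> i. if i = m then x$m + x$n else x$i"
  shows "h ` S \<in> lmeasurable" "measure lebesgue (h ` S) = \<bar>det (matrix h)\<bar> * measure lebesgue S"
proof -
  have lin: "linear h" unfolding h_def
    by (rule linearI) (auto simp: Finite_Cartesian_Product.vec_eq_iff algebra_simps)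
  have box: "measure lebesgue (h ` cbox a b) = 1 * measure lebesgue (cbox a b)" for a b
  proof (cases "cbox a b = {}")
    case False
    \<comment> \<open>Moves the lower bound in coordinate \<open>n\<close> to 0.\<close>
    define w :: "real^'n" where "w = axis n (- (a $ n))"
    have "cbox a b = (+) (- w) ` cbox (w + a) (w + b)"
      using cbox_translation[of "- w" "w + a" "w + b"] by simp
    then have "h ` cbox a b = (+) (- h w) ` h ` cbox (w + a) (w + b)"
      by (simp only: image_image linear_add[OF lin] linear_neg[OF lin])
    then have "measure lebesgue (h ` cbox a b) = measure lebesgue (h ` cbox (w + a) (w + b))"
      by (metis measure_translation)
    also have "\<dots> = measure lebesgue (cbox (w + a) (w + b))" unfolding h_def
    proof (rule measure_shear_interval[OF mn])
      show "cbox (w + a) (w + b) \<noteq> {}" using False by (simp add: cbox_translation)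
      show "0 \<le> (w + a) $ n" by (simp add: w_def)
    qed
    also have "\<dots> = measure lebesgue (cbox a b)"
      by (simp only: cbox_translation measure_translation)
    finally show ?thesis by simp
  qed simp
  have "matrix h = (\<chi> k. if k = m then row m (mat 1) + 1 *s row n (mat 1) else row k (mat 1))"
    by (auto simp: Finite_Cartesian_Product.vec_eq_iff matrix_def h_def Finite_Cartesian_Product.row_def Finite_Cartesian_Product.mat_def axis_def)
  then have "det (matrix h) = 1"
    using det_row_operation[OF mn, of "mat 1" "1::real"] by simp
  then show "h ` S \<in> lmeasurable" "measure lebesgue (h ` S) = \<bar>det (matrix h)\<bar> * measure lebesgue S"
    using measure_linear_sufficient[OF lin S box] by auto
qed

text \<open>The library proves this only for well-ordered index types.\<close>

lemma measure_matrix_image: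
  fixes A :: "real^'n^'n"
  assumes "S \<in> lmeasurable"
  shows "(\<lambda>x. A *v x) ` S \<in> lmeasurable"
    and "measure lebesgue ((\<lambda>x. A *v x) ` S) = \<bar>det A\<bar> * measure lebesgue S"
proof -
  define P where "P f \<longleftrightarrow> (\<forall>S\<in>lmeasurable. f ` S \<in> lmeasurable \<and>
    measure lebesgue (f ` S) = \<bar>det (matrix f)\<bar> * measure lebesgue S)" for f :: "real^'n \<Rightarrow> real^'n"
  define st where "st c = (\<lambda>x::real^'n. \<chi> i. c i * x $ i)" for c :: "'n \<Rightarrow> real"
  define h where "h m n = (\<lambda>x::real^'n. \<chi> i. if i = m then x $ m + x $ n else x $ i)" for m n
  have lin: "linear (st c)" "linear (h m n)" for c m n
    unfolding st_def h_def by (rule linearI; auto simp: Finite_Cartesian_Product.vec_eq_iff algebra_simps)+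
  have comp: "P (f \<circ> g)" if "linear f" "linear g" "P f" "P g" for f g
    unfolding P_def
  proof (intro ballI conjI)
    fix S :: "(real^'n) set" assume S: "S \<in> lmeasurable"
    have eq: "(f \<circ> g) ` S = f ` g ` S" by (simp add: image_comp)
    show "(f \<circ> g) ` S \<in> lmeasurable"
      unfolding eq using that(3,4) S unfolding P_def by blast
    show "measure lebesgue ((f \<circ> g) ` S) = \<bar>det (matrix (f \<circ> g))\<bar> * measure lebesgue S"
      unfolding eq matrix_compose[OF that(2,1)] det_mul abs_mult
      using that(3,4) S unfolding P_def by simp
  qed
  have st: "P (st c)" for c
    unfolding P_def st_def
    by (auto simp: measurable_stretch measure_stretch matrix_def axis_def det_diagonal)
  have h: "P (h m n)" if "m \<noteq> n" for m n
    using measure_shear_image[OF that] unfolding P_def h_def by blast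
  have "P ((*v) A)"
  proof (rule induct_linear_elementary[of "(*v) A" P])
    fix f :: "real^'n \<Rightarrow> real^'n" and i assume f: "linear f" "\<And>x. f x $ i = 0"
    then have "\<not> surj f" by (metis surjE vec_component zero_neq_one)
    then have "\<not> inj f" using f linear_injective_imp_surjective by blast
    then have "negligible (f ` S)" for S
      using f negligible_linear_singular_image by blast
    then show "P f" using f \<open>\<not> inj f\<close> det_nz_iff_inj unfolding P_def
      by (metis abs_zero mult_zero_left negligible_iff_measure)
  next
    fix m n :: 'n assume mn: "m \<noteq> n"
    \<comment> \<open>A swap of coordinates is a product of three shears interleaved with sign
      changes of coordinate \<open>n\<close>, so the stretch and shear cases cover it.\<close>
    define c where "c = (\<lambda>i. if i = n then -1 else 1 :: real)"
    have eq: "(\<lambda>x. \<chi> i. x $ Transposition.transpose m n i) =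
      st c \<circ> (h m n \<circ> (st c \<circ> (h n m \<circ> (st c \<circ> h m n))))"
      using mn by (auto simp: fun_eq_iff Finite_Cartesian_Product.vec_eq_iff st_def h_def c_def Transposition.transpose_def)
    show "P (\<lambda>x. \<chi> i. x $ Transposition.transpose m n i)"
      unfolding eq using mn by (intro comp st h lin linear_compose) auto
  qed (use comp st h in \<open>auto simp: st_def h_def\<close>)
  then show "(\<lambda>x. A *v x) ` S \<in> lmeasurable"
    "measure lebesgue ((\<lambda>x. A *v x) ` S) = \<bar>det A\<bar> * measure lebesgue S"
    using assms by (auto simp: P_def matrix_of_matrix_vector_mul)
qed

subsection \<open>Dilation groups and their parabolic metrics\<close>

lemma matrix_vector_bounded:
  fixes X :: "real^'n^'m"
  obtains B where "B > 0" "\<And>v. norm (X *v v) \<le> B * norm v"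
  using linear_bounded_pos[OF matrix_vector_mul_linear[of X]] by auto

lemma matrix_vector_minus: "X *v (- v) = - (X *v v :: real^'m)"
  using linear_neg[OF matrix_vector_mul_linear, of X v] by simp

lemma emeasure_compact_eq_measure:
  "compact S \<Longrightarrow> emeasure lborel S = ennreal (measure lborel S)"
  using emeasure_compact_finite[of S] by (intro emeasure_eq_ennreal_measure) auto

text \<open>Quasi-concavity up to a constant. The constant leaves room for logarithmic factors,
  which can spoil the exact monotonicity of a power.\<close>

definition gauge_fun :: "(real \<Rightarrow> real) \<Rightarrow> bool" where
  "gauge_fun \<psi> \<longleftrightarrow> (\<forall>r>0. \<psi> r > 0) \<and>
     (\<exists>C>0. \<forall>r s. 0 < r \<and> r \<le> s \<longrightarrow> \<psi> r \<le> C * \<psi> s \<and> \<psi> s / s \<le> C * (\<psi> r / r))"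

lemma gauge_fun_pos: "gauge_fun \<psi> \<Longrightarrow> r > 0 \<Longrightarrow> \<psi> r > 0"
  by (auto simp: gauge_fun_def)

lemma gauge_fun_mono:
  assumes "gauge_fun \<psi>"
  obtains C where "C > 0" "\<And>r s. 0 < r \<Longrightarrow> r \<le> s \<Longrightarrow> \<psi> r \<le> C * \<psi> s"
  using assms unfolding gauge_fun_def by metis

text \<open>For \<open>r \<le> \<rho>\<close> this is the growth condition, for larger
  \<open>r\<close> the decrease of \<open>\<psi> r / r\<close>. Being affine in \<open>r\<close>,
  the bound survives integration over a varying volume \<open>r\<close> with \<open>\<rho>\<close>
  fixed, and so does the work of Jensen's inequality.\<close>

lemma gauge_fun_affine_bound:
  assumes "gauge_fun \<psi>"
  obtains C where "C > 0" "\<And>r \<rho>. 0 < r \<Longrightarrow> 0 < \<rho> \<Longrightarrow> \<psi> r \<le> C * \<psi> \<rho> * (1 + r / \<rho>)"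
proof -
  obtain C where C: "C > 0" and m: "\<And>r s. 0 < r \<Longrightarrow> r \<le> s \<Longrightarrow> \<psi> r \<le> C * \<psi> s \<and> \<psi> s / s \<le> C * (\<psi> r / r)"
    using assms unfolding gauge_fun_def by metis
  have "\<psi> r \<le> C * \<psi> \<rho> * (1 + r / \<rho>)" if r: "0 < r" "0 < \<rho>" for r \<rho>
  proof -
    have p: "\<psi> \<rho> > 0" using assms r by (simp add: gauge_fun_pos)
    show ?thesis
    proof (cases "r \<le> \<rho>")
      case True
      then have "\<psi> r \<le> C * \<psi> \<rho>" using m r by blast
      also have "\<dots> \<le> C * \<psi> \<rho> * (1 + r / \<rho>)" using C p r by simp
      finally show ?thesis .
    next
      case False
      then have "\<psi> r / r \<le> C * (\<psi> \<rho> / \<rho>)" using m[of \<rho> r] r by simp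
      then have "\<psi> r \<le> C * (\<psi> \<rho> / \<rho>) * r" using r by (simp add: pos_divide_le_eq)
      also have "\<dots> = C * \<psi> \<rho> * (r / \<rho>)" by simp
      also have "\<dots> \<le> C * \<psi> \<rho> * (1 + r / \<rho>)" using C p r by (simp add: algebra_simps)
      finally show ?thesis .
    qed
  qed
  with C that show ?thesis by blast
qed

text \<open>What the rigidity argument uses of \<open>exp (t A)\<close> and its visual quasimetric.
  \<open>D_scale\<close> fixes \<open>D\<close> only up to bounded factors, so that all admissible
  inner products fit. The constant in \<open>M_contract\<close> makes up for the initial growth that
  a nontrivial Jordan block may cause.\<close>

locale dilation =
  fixes M :: "real \<Rightarrow> real^'n^'n" and D :: "real^'n \<Rightarrow> real^'n \<Rightarrow> real" and a :: real
  assumes M_0: "M 0 = mat 1"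
    and M_add: "M (s + t) = M s ** M t"
    and M_contract: "\<exists>C>0. \<exists>e>0. \<forall>t\<ge>0. \<forall>x. norm (M (- t) *v x) \<le> C * exp (- e * t) * norm x"
    and M_det: "det (M t) = exp (a * t)"
    and a_pos: "a > 0"
    and D_diag: "D x x = 0"
    and D_scale: "\<exists>c>0. \<exists>c'>0. \<forall>x y. x \<noteq> y \<longrightarrow> D x y > 0 \<and>
      c \<le> norm (M (- ln (D x y)) *v (x - y)) \<and> norm (M (- ln (D x y)) *v (x - y)) \<le> c'"
begin

lemma D_pos: "x \<noteq> y \<Longrightarrow> D x y > 0"
  using D_scale by blast

lemma D_nonneg: "D x y \<ge> 0"
  using D_pos[of x y] D_diag[of x] by (cases "x = y") auto

lemma M_mult_vec: "M s *v (M t *v x) = M (s + t) *v x"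
  by (simp add: M_add matrix_vector_mul_assoc)

lemma M_neg [simp]: "M (- t) *v (M t *v x) = x" "M t *v (M (- t) *v x) = x"
  by (simp_all add: M_mult_vec M_0)

lemma M_contractE:
  obtains C e where "C > 0" "e > 0" "\<And>t x. t \<ge> 0 \<Longrightarrow> norm (M (- t) *v x) \<le> C * exp (- e * t) * norm x"
    "\<And>t x. t \<ge> 0 \<Longrightarrow> norm (M (- t) *v x) \<le> C * norm x"
proof -
  obtain C e where C: "C > 0" "e > 0" and *: "\<And>t x. t \<ge> 0 \<Longrightarrow> norm (M (- t) *v x) \<le> C * exp (- e * t) * norm x"
    using M_contract by blast
  have "norm (M (- t) *v x) \<le> C * norm x" if t: "t \<ge> 0" for t x
  proof -
    have "exp (- e * t) \<le> 1" using C t by simp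
    then have "C * exp (- e * t) * norm x \<le> C * 1 * norm x" using C
      by (intro mult_right_mono mult_left_mono) auto
    with *[OF t, of x] show ?thesis by simp
  qed
  with C * that show ?thesis by blast
qed

lemma M_shrink:
  assumes "\<epsilon> > 0"
  obtains T where "T \<ge> 0" "\<And>x. norm x \<le> R \<Longrightarrow> norm (M (- T) *v x) \<le> \<epsilon>"
proof -
  obtain C e where C: "C > 0" "e > 0" "\<And>t x. t \<ge> 0 \<Longrightarrow> norm (M (- t) *v x) \<le> C * exp (- e * t) * norm x"
    by (metis M_contractE)
  have "((\<lambda>T. exp (- e * T)) \<longlongrightarrow> 0) at_top" using C(2) by real_asymp
  then have "((\<lambda>T. C * exp (- e * T) * R) \<longlongrightarrow> C * 0 * R) at_top" by (intro tendsto_mult tendsto_const)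
  then have "\<forall>\<^sub>F T in at_top. C * exp (- e * T) * R < \<epsilon>" using assms by (intro order_tendstoD(2)) auto
  then have "\<forall>\<^sub>F T in at_top. T \<ge> 0 \<and> C * exp (- e * T) * R < \<epsilon>"
    using eventually_ge_at_top[of 0] by eventually_elim auto
  then obtain T where T: "T \<ge> 0" "C * exp (- e * T) * R < \<epsilon>"
    using eventually_happens' trivial_limit_at_top_linorder by blast
  have "norm (M (- T) *v x) \<le> \<epsilon>" if "norm x \<le> R" for x
  proof -
    have "norm (M (- T) *v x) \<le> C * exp (- e * T) * norm x" by (rule C(3)[OF T(1)])
    also have "\<dots> \<le> C * exp (- e * T) * R" using that C(1) by (intro mult_left_mono) auto
    finally show ?thesis using T(2) by simp
  qed
  with T(1) that show ?thesis by blast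
qed

text \<open>If the scale of the pair exceeded \<open>t\<close>, contracting from \<open>t\<close> to
  that scale would push the difference below the lower bound in \<open>D_scale\<close>. Together
  with \<open>norm_le_of_D_le\<close> this squeezes the balls of \<open>D\<close> between
  ellipsoids.\<close>

lemma D_le_of_norm_le:
  obtains \<kappa> where "\<kappa> > 0" "\<And>x y t. norm (M (- t) *v (x - y)) \<le> \<kappa> \<Longrightarrow> D x y \<le> exp t"
proof -
  obtain C e where C: "C > 0" and *: "\<And>t x. t \<ge> 0 \<Longrightarrow> norm (M (- t) *v x) \<le> C * norm x"
    by (metis M_contractE)
  obtain c c' where c: "c > 0" and c': "\<And>x y. x \<noteq> y \<Longrightarrow> c \<le> norm (M (- ln (D x y)) *v (x - y))"
    using D_scale by metis
  \<comment> \<open>Dividing by \<open>2 * C\<close> leaves the contracted vector strictly below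
    \<open>c\<close>.\<close>
  have "D x y \<le> exp t" if n: "norm (M (- t) *v (x - y)) \<le> c / (2 * C)" for x y t
  proof (cases "x = y")
    case False
    have "ln (D x y) \<le> t"
    proof (rule ccontr)
      assume "\<not> ?thesis"
      then have "norm (M (- (ln (D x y) - t)) *v (M (- t) *v (x - y))) \<le> C * norm (M (- t) *v (x - y))"
        by (intro *) auto
      also have "\<dots> \<le> C * (c / (2 * C))" using n C by (intro mult_left_mono) auto
      also have "\<dots> < c" using C c by simp
      also have "c \<le> norm (M (- ln (D x y)) *v (x - y))" by (rule c'[OF False])
      finally show False by (simp add: M_mult_vec)
    qed
    then show ?thesis using D_pos[OF False] by (metis exp_le_cancel_iff exp_ln)
  qed (simp add: D_diag)
  with c C that[of "c / (2 * C)"] show ?thesis by simp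
qed

lemma norm_le_of_D_le:
  obtains K where "K > 0" "\<And>x y t. D x y \<le> exp t \<Longrightarrow> norm (M (- t) *v (x - y)) \<le> K"
proof -
  obtain C e where C: "C > 0" and *: "\<And>t x. t \<ge> 0 \<Longrightarrow> norm (M (- t) *v x) \<le> C * norm x"
    by (metis M_contractE)
  obtain c where c: "c > 0" and c': "\<And>x y. x \<noteq> y \<Longrightarrow> norm (M (- ln (D x y)) *v (x - y)) \<le> c"
    using D_scale by metis
  have "norm (M (- t) *v (x - y)) \<le> C * c" if n: "D x y \<le> exp t" for x y t
  proof (cases "x = y")
    case False
    then have t: "t \<ge> ln (D x y)" using n D_pos[OF False] by (metis ln_exp ln_mono)
    have "norm (M (- t) *v (x - y)) = norm (M (- (t - ln (D x y))) *v (M (- ln (D x y)) *v (x - y)))"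
      by (simp add: M_mult_vec)
    also have "\<dots> \<le> C * norm (M (- ln (D x y)) *v (x - y))"
      using t by (intro *) auto
    also have "\<dots> \<le> C * c" using c'[OF False] C by (intro mult_left_mono) auto
    finally show ?thesis .
  qed (use C c in auto)
  with c C that[of "C * c"] show ?thesis by simp
qed

lemma D_small:
  assumes "\<epsilon> > 0"
  obtains \<delta> where "\<delta> > 0" "\<And>x y. norm (x - y) \<le> \<delta> \<Longrightarrow> D x y \<le> \<epsilon>"
proof -
  obtain \<kappa> where \<kappa>: "\<kappa> > 0" and *: "\<And>x y t. norm (M (- t) *v (x - y)) \<le> \<kappa> \<Longrightarrow> D x y \<le> exp t"
    using D_le_of_norm_le by blast
  obtain B where B: "B > 0" "\<And>v. norm (M (- ln \<epsilon>) *v v) \<le> B * norm v"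
    using matrix_vector_bounded by blast
  have "D x y \<le> \<epsilon>" if "norm (x - y) \<le> \<kappa> / B" for x y
  proof -
    have "norm (M (- ln \<epsilon>) *v (x - y)) \<le> B * norm (x - y)" by (rule B)
    also have "\<dots> \<le> \<kappa>" using that B by (simp add: field_simps)
    finally show ?thesis using *[of "ln \<epsilon>" x y] assms by simp
  qed
  with \<kappa> B that[of "\<kappa> / B"] show ?thesis by simp
qed

lemma norm_small:
  assumes "\<epsilon> > 0"
  obtains \<delta> where "\<delta> > 0" "\<And>x y. D x y \<le> \<delta> \<Longrightarrow> norm (x - y) \<le> \<epsilon>"
proof -
  obtain K where K: "K > 0" and *: "\<And>x y t. D x y \<le> exp t \<Longrightarrow> norm (M (- t) *v (x - y)) \<le> K"
    using norm_le_of_D_le by blast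
  obtain T where T: "\<And>x. norm x \<le> K \<Longrightarrow> norm (M (- T) *v x) \<le> \<epsilon>"
    using M_shrink[OF assms, of K] by metis
  have "norm (x - y) \<le> \<epsilon>" if "D x y \<le> exp (- T)" for x y
    using T[OF *[OF that]] by simp
  with that[of "exp (- T)"] show ?thesis by simp
qed

lemma D_bounded:
  obtains T where "T \<ge> 0" "\<And>x y. norm (x - y) \<le> R \<Longrightarrow> D x y \<le> exp T"
proof -
  obtain \<kappa> where \<kappa>: "\<kappa> > 0" and *: "\<And>x y t. norm (M (- t) *v (x - y)) \<le> \<kappa> \<Longrightarrow> D x y \<le> exp t"
    using D_le_of_norm_le by blast
  obtain T where T: "T \<ge> 0" "\<And>x. norm x \<le> R \<Longrightarrow> norm (M (- T) *v x) \<le> \<kappa>"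
    using M_shrink[OF \<kappa>, of R] by metis
  with * that show ?thesis by blast
qed

text \<open>The argument of the gauge is the determinant of \<open>M (- t)\<close>, that is, the
  order of the volume of a quasi-ball. One gauge thereby defines comparable spaces for different
  groups.\<close>

definition decay_space :: "(real \<Rightarrow> real) \<Rightarrow> (real^'n) set" where
  "decay_space \<psi> = {\<xi>. \<exists>C. \<forall>t\<ge>0. norm (transpose (M (- t)) *v \<xi>) \<le> C * \<psi> (exp (- (a * t)))}"

lemma subspace_decay_space:
  assumes "gauge_fun \<psi>"
  shows "subspace (decay_space \<psi>)"
  unfolding real_vector.subspace_def
proof (intro conjI ballI allI)
  show "0 \<in> decay_space \<psi>" unfolding decay_space_def by (auto intro!: exI[of _ 0])
next
  fix x y assume "x \<in> decay_space \<psi>" "y \<in> decay_space \<psi>"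
  then obtain C C' where C: "\<And>t. t \<ge> 0 \<Longrightarrow> norm (transpose (M (- t)) *v x) \<le> C * \<psi> (exp (- (a * t)))"
    "\<And>t. t \<ge> 0 \<Longrightarrow> norm (transpose (M (- t)) *v y) \<le> C' * \<psi> (exp (- (a * t)))"
    unfolding decay_space_def by auto
  have "norm (transpose (M (- t)) *v (x + y)) \<le> (C + C') * \<psi> (exp (- (a * t)))" if "t \<ge> 0" for t
    using norm_triangle_le[OF add_mono[OF C(1)[OF that] C(2)[OF that]]]
    by (simp add: matrix_vector_right_distrib ring_distribs)
  then show "x + y \<in> decay_space \<psi>" unfolding decay_space_def by blast
next
  fix c x assume "x \<in> decay_space \<psi>"
  then obtain C where C: "\<And>t. t \<ge> 0 \<Longrightarrow> norm (transpose (M (- t)) *v x) \<le> C * \<psi> (exp (- (a * t)))"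
    unfolding decay_space_def by auto
  have "norm (transpose (M (- t)) *v (c *\<^sub>R x)) \<le> (\<bar>c\<bar> * C) * \<psi> (exp (- (a * t)))" if "t \<ge> 0" for t
    using mult_left_mono[OF C[OF that], of "\<bar>c\<bar>"]
    by (simp add: matrix_vector_mult_scaleR mult.assoc)
  then show "c *\<^sub>R x \<in> decay_space \<psi>" unfolding decay_space_def by blast
qed

text \<open>The definition speaks of small scales. Going up to a fixed scale \<open>T\<close> takes
  a bounded time, which costs a constant by the group law and the growth condition on the
  gauge.\<close>

lemma decay_space_bound:
  assumes g: "gauge_fun \<psi>" and "\<xi> \<in> decay_space \<psi>"
  obtains C where "C > 0" "\<And>t. t \<le> T \<Longrightarrow> norm (transpose (M t) *v \<xi>) \<le> C * \<psi> (exp (a * t))"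
proof -
  define T' where "T' = max T 0"
  obtain C where C: "\<And>t. t \<ge> 0 \<Longrightarrow> norm (transpose (M (- t)) *v \<xi>) \<le> C * \<psi> (exp (- (a * t)))"
    using assms unfolding decay_space_def by auto
  obtain B where B: "B > 0" "\<And>v. norm (transpose (M T') *v v) \<le> B * norm v"
    using matrix_vector_bounded by blast
  obtain G where G: "G > 0" "\<And>r s. 0 < r \<Longrightarrow> r \<le> s \<Longrightarrow> \<psi> r \<le> G * \<psi> s"
    using gauge_fun_mono[OF g] by blast
  have "norm (transpose (M t) *v \<xi>) \<le> (B * \<bar>C\<bar> * G + 1) * \<psi> (exp (a * t))" if t: "t \<le> T" for t
  proof -
    have t': "T' - t \<ge> 0" using t by (simp add: T'_def)
    have pos: "\<psi> r > 0" if "r > 0" for r using g that by (rule gauge_fun_pos)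
    have "M t = M (- (T' - t)) ** M T'" by (simp flip: M_add)
    then have "norm (transpose (M t) *v \<xi>) = norm (transpose (M T') *v (transpose (M (- (T' - t))) *v \<xi>))"
      by (metis matrix_transpose_mul matrix_vector_mul_assoc)
    also have "\<dots> \<le> B * (C * \<psi> (exp (- (a * (T' - t)))))"
      using B(2) C[OF t'] B(1) by (meson order.trans mult_left_mono less_imp_le)
    also have "\<dots> \<le> B * (\<bar>C\<bar> * \<psi> (exp (- (a * (T' - t)))))"
      using B(1) pos[of "exp (- (a * (T' - t)))"] by (intro mult_left_mono mult_right_mono) auto
    also have "\<dots> \<le> B * (\<bar>C\<bar> * (G * \<psi> (exp (a * t))))"
    proof (intro mult_left_mono G)
      have "a * T' \<ge> 0" using a_pos by (simp add: T'_def)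
      then show "exp (- (a * (T' - t))) \<le> exp (a * t)" by (simp add: algebra_simps)
    qed (use B in auto)
    also have "\<dots> \<le> (B * \<bar>C\<bar> * G + 1) * \<psi> (exp (a * t))"
      using pos[of "exp (a * t)"] by (simp add: algebra_simps)
    finally show ?thesis .
  qed
  moreover have "B * \<bar>C\<bar> * G + 1 > 0" using B G by (simp add: add_nonneg_pos)
  ultimately show ?thesis using that by blast
qed

lemma emeasure_ellipsoid:
  "emeasure lborel {y. norm (M (- t) *v (c - y)) \<le> r} = ennreal (exp (a * t) * measure lborel (cball (0::real^'n) r))"
proof -
  have lin: "linear (\<lambda>x. M t *v x)" by simp
  have eq: "{y. norm (M (- t) *v (c - y)) \<le> r} = (+) c ` ((\<lambda>x. M t *v x) ` cball 0 r)"
  proof (intro Set.set_eqI iffI)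
    fix y assume "y \<in> {y. norm (M (- t) *v (c - y)) \<le> r}"
    then have "M t *v (- (M (- t) *v (c - y))) \<in> (\<lambda>x. M t *v x) ` cball 0 r"
      by (intro imageI) (simp add: dist_norm)
    then show "y \<in> (+) c ` ((\<lambda>x. M t *v x) ` cball 0 r)"
      by (rule rev_image_eqI) (simp add: matrix_vector_minus)
  qed (auto simp: dist_norm matrix_vector_minus)
  have cl: "compact ((\<lambda>x. M t *v x) ` cball (0::real^'n) r)"
    by (intro compact_continuous_image linear_continuous_on linear_linear[THEN iffD1] lin)
       (auto simp: linear_conv_bounded_linear)
  then have lm: "(\<lambda>x. M t *v x) ` cball (0::real^'n) r \<in> lmeasurable" by (rule lmeasurable_compact)
  have "measure lebesgue ((+) c ` ((\<lambda>x. M t *v x) ` cball 0 r)) = measure lebesgue ((\<lambda>x. M t *v x) ` cball (0::real^'n) r)"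
    by (rule measure_translation)
  also have "\<dots> = exp (a * t) * measure lebesgue (cball (0::real^'n) r)"
    by (subst measure_matrix_image) (auto simp: M_det)
  finally have "measure lebesgue {y. norm (M (- t) *v (c - y)) \<le> r} = exp (a * t) * measure lebesgue (cball (0::real^'n) r)"
    by (simp add: eq)
  moreover have "compact {y. norm (M (- t) *v (c - y)) \<le> r}"
    unfolding eq by (intro compact_continuous_image cl continuous_intros)
  ultimately show ?thesis
    by (simp add: emeasure_compact_eq_measure borel_compact)
qed

end

subsection \<open>Rigidity of the decay spaces\<close>

text \<open>The assumption \<open>weak\<close> says that \<open>F\<close> maps the
  \<open>D\<close>-ball of radius \<open>\<Lambda> * D x z\<close> about \<open>x\<close> onto a set
  containing the \<open>D'\<close>-ball of radius \<open>D' (F x) (F z)\<close> about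
  \<open>F x\<close>. This is the direction that bounds the volume of images of quasi-balls from
  below.\<close>

locale weak_qs =
  A: dilation M D a + B: dilation M' D' b
  for M :: "real \<Rightarrow> real^'n^'n" and D a and M' :: "real \<Rightarrow> real^'n^'n" and D' b +
  fixes F G :: "real^'n \<Rightarrow> real^'n" and \<Lambda> :: real
  assumes contF: "continuous_on UNIV F" and contG: "continuous_on UNIV G"
    and GF: "G (F x) = x" and FG: "F (G y) = y"
    and \<Lambda>_pos: "\<Lambda> > 0"
    and weak: "D' (F x) (F y) \<le> D' (F x) (F z) \<Longrightarrow> D x y \<le> \<Lambda> * D x z"
begin

text \<open>The image under \<open>F\<close> of the ellipsoid \<open>z + M (- \<tau>) U\<close> with
  \<open>U\<close> the ball of radius \<open>r\<close>. Written through the inverse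
  \<open>G\<close>, it is visibly closed, and the condition can be read as one on the centre
  \<open>z\<close>.\<close>

definition preball :: "real \<Rightarrow> real \<Rightarrow> real^'n \<Rightarrow> (real^'n) set" where
  "preball r \<tau> z = {y. norm (M \<tau> *v (z - G y)) \<le> r}"

lemma closed_preball: "closed (preball r \<tau> z)"
  unfolding preball_def
  by (intro closed_Collect_le continuous_intros matrix_vector_mult_linear_continuous_on[THEN continuous_on_compose2[of UNIV]] contG) auto

lemma bounded_imageF: "bounded S \<Longrightarrow> bounded (F ` S)"
  by (meson bounded_closure closure_subset compact_closure compact_continuous_image
      compact_imp_bounded bounded_subset contF continuous_on_subset image_mono subset_UNIV)

lemma preball_finite:
  assumes "\<tau> \<ge> 0"
  shows "emeasure lborel (preball r \<tau> z) = ennreal (measure lborel (preball r \<tau> z))"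
proof -
  obtain C where C: "C > 0" "\<And>t x. t \<ge> 0 \<Longrightarrow> norm (M (- t) *v x) \<le> C * norm x"
    by (metis A.M_contractE)
  have "preball r \<tau> z \<subseteq> F ` cball z (C * r)"
  proof
    fix y assume y: "y \<in> preball r \<tau> z"
    have "norm (z - G y) = norm (M (- \<tau>) *v (M \<tau> *v (z - G y)))" by simp
    also have "\<dots> \<le> C * norm (M \<tau> *v (z - G y))" using assms by (intro C) auto
    also have "\<dots> \<le> C * r" using y C by (auto simp: preball_def intro!: mult_left_mono)
    finally have "G y \<in> cball z (C * r)" by (simp add: dist_norm)
    then show "y \<in> F ` cball z (C * r)" by (metis FG image_eqI)
  qed
  then have "bounded (preball r \<tau> z)"
    using bounded_imageF[OF bounded_cball] bounded_subset by blast
  then have "emeasure lborel (preball r \<tau> z) < \<infinity>" by (rule emeasure_bounded_finite)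
  then show ?thesis by (intro emeasure_eq_ennreal_measure) auto
qed

text \<open>If \<open>d\<close> is the \<open>D'\<close>-distance of the two values of
  \<open>F\<close>, the increment of \<open>\<xi> \<bullet> F\<close> is at most of order
  \<open>\<psi> (d powr b)\<close>. Here \<open>d powr b\<close> is the order of the volume of a
  quasi-ball that \<open>weak\<close> places inside the image of a source ellipsoid. The parameter
  \<open>\<rho>\<close> is left free in order to be set to the volume of that ellipsoid.\<close>

lemma increment_bound:
  assumes g: "gauge_fun \<psi>" and \<xi>: "\<xi> \<in> B.decay_space \<psi>"
  obtains C r where "C > 0" "r > 0"
    "\<And>z \<tau> p \<rho>. norm z \<le> R \<Longrightarrow> \<tau> \<ge> 0 \<Longrightarrow> norm p = 1 \<Longrightarrow> \<rho> > 0 \<Longrightarrow>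
      \<bar>\<xi> \<bullet> (F (z + M (- \<tau>) *v p) - F z)\<bar> \<le> C * \<psi> \<rho> * (1 + measure lborel (preball r \<tau> z) / \<rho>)"
proof -
  obtain CA where CA: "CA > 0" "\<And>t x. t \<ge> 0 \<Longrightarrow> norm (M (- t) *v x) \<le> CA * norm x"
    by (metis A.M_contractE)
  obtain R' where R': "\<And>x. x \<in> F ` cball 0 (R + CA) \<Longrightarrow> norm x \<le> R'"
    using bounded_imageF[OF bounded_cball] bounded_iff by metis
  \<comment> \<open>The values of \<open>F\<close> in question stay in a bounded region, so their
    scale is at most \<open>T\<close>, and the decay of \<open>\<xi>\<close> is uniform in this
    range.\<close>
  obtain T where T: "\<And>x y. norm (x - y) \<le> 2 * R' \<Longrightarrow> D' x y \<le> exp T"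
    by (metis B.D_bounded)
  obtain CB where CB: "CB > 0" "\<And>t. t \<le> T \<Longrightarrow> norm (transpose (M' t) *v \<xi>) \<le> CB * \<psi> (exp (b * t))"
    by (metis B.decay_space_bound[OF g \<xi>])
  obtain K' where K': "K' > 0" "\<And>x y t. D' x y \<le> exp t \<Longrightarrow> norm (M' (- t) *v (x - y)) \<le> K'"
    by (metis B.norm_le_of_D_le)
  obtain \<kappa>' where \<kappa>': "\<kappa>' > 0" "\<And>x y t. norm (M' (- t) *v (x - y)) \<le> \<kappa>' \<Longrightarrow> D' x y \<le> exp t"
    by (metis B.D_le_of_norm_le)
  obtain \<kappa> where \<kappa>: "\<kappa> > 0" "\<And>x y t. norm (M (- t) *v (x - y)) \<le> \<kappa> \<Longrightarrow> D x y \<le> exp t"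
    by (metis A.D_le_of_norm_le)
  obtain K where K: "K > 0" "\<And>x y t. D x y \<le> exp t \<Longrightarrow> norm (M (- t) *v (x - y)) \<le> K"
    by (metis A.norm_le_of_D_le)
  obtain CG where CG: "CG > 0" "\<And>r \<rho>. 0 < r \<Longrightarrow> 0 < \<rho> \<Longrightarrow> \<psi> r \<le> CG * \<psi> \<rho> * (1 + r / \<rho>)"
    by (metis gauge_fun_affine_bound[OF g])
  \<comment> \<open>\<open>T0\<close> converts the unit vector \<open>p\<close> into
    \<open>D z (z + v) \<le> exp (T0 - \<tau>)\<close>. Adding \<open>ln \<Lambda>\<close> accounts
    for the loss in \<open>weak\<close>, and \<open>M T1\<close> then only enlarges the radius to
    \<open>r\<close>.\<close>
  obtain T0 where T0: "\<And>p. norm p \<le> 1 \<Longrightarrow> norm (M (- T0) *v p) \<le> \<kappa>"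
    using A.M_shrink[OF \<kappa>(1), of 1] by metis
  define T1 where "T1 = ln \<Lambda> + T0"
  obtain B1 where B1: "B1 > 0" "\<And>v. norm (M T1 *v v) \<le> B1 * norm v"
    using matrix_vector_bounded by blast
  define r where "r = B1 * K"
  define m where "m = measure lborel (cball (0::real^'n) \<kappa>')"
  have m: "m > 0" unfolding m_def using content_cball_pos[OF \<kappa>'(1)] by simp
  define C where "C = K' * CB * CG * (1 + 1 / m)"
  have "\<bar>\<xi> \<bullet> (F (z + M (- \<tau>) *v p) - F z)\<bar> \<le> C * \<psi> \<rho> * (1 + measure lborel (preball r \<tau> z) / \<rho>)"
    if z: "norm z \<le> R" and \<tau>: "\<tau> \<ge> 0" and p: "norm p = 1" and \<rho>: "\<rho> > 0" for z \<tau> p \<rho>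
  proof -
    define v where "v = M (- \<tau>) *v p"
    define d where "d = D' (F z) (F (z + v))"
    define t where "t = ln d"
    have Mv: "M \<tau> *v v = p" by (simp add: v_def)
    have "v \<noteq> 0" using Mv p by auto
    then have ne: "F z \<noteq> F (z + v)" by (metis GF add_cancel_left_right)
    then have d: "d > 0" unfolding d_def by (rule B.D_pos)
    then have dt: "exp t = d" by (simp add: t_def)
    have nv: "norm v \<le> CA" using CA(2)[OF \<tau>, of p] p by (simp add: v_def)
    have "norm (F z) \<le> R'" "norm (F (z + v)) \<le> R'"
      using z nv CA norm_triangle_ineq[of z v] by (auto intro!: R')
    then have "norm (F z - F (z + v)) \<le> 2 * R'"
      using norm_triangle_ineq4[of "F z" "F (z + v)"] by simp
    then have "exp t \<le> exp T" using T dt d_def by metis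
    then have tT: "t \<le> T" by simp
    have *: "\<bar>\<xi> \<bullet> (F (z + v) - F z)\<bar> \<le> K' * CB * \<psi> (exp (b * t))"
    proof -
      let ?y = "F z - F (z + v)"
      have "\<xi> \<bullet> ?y = \<xi> \<bullet> (M' t *v (M' (- t) *v ?y))" by simp
      also have "\<dots> = (transpose (M' t) *v \<xi>) \<bullet> (M' (- t) *v ?y)"
        by (metis dot_lmul_matrix transpose_matrix_vector)
      also have "\<bar>\<dots>\<bar> \<le> norm (transpose (M' t) *v \<xi>) * norm (M' (- t) *v ?y)"
        by (rule Cauchy_Schwarz_ineq2)
      also have "\<dots> \<le> (CB * \<psi> (exp (b * t))) * K'"
        using CB(2)[OF tT] K'(2)[of "F z" "F (z + v)" t] dt
        by (intro mult_mono) (auto simp: d_def intro: order_trans[OF norm_ge_zero])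
      finally have "\<bar>\<xi> \<bullet> ?y\<bar> \<le> (CB * \<psi> (exp (b * t))) * K'" .
      moreover have "\<xi> \<bullet> (F (z + v) - F z) = - (\<xi> \<bullet> ?y)" by (simp add: inner_diff_right)
      ultimately show ?thesis by (simp add: mult_ac)
    qed
    have Dzv: "D z (z + v) \<le> exp (T0 - \<tau>)"
    proof (rule \<kappa>)
      have "M (- (T0 - \<tau>)) *v (z - (z + v)) = - (M (- (T0 - \<tau>)) *v v)"
        by (simp add: matrix_vector_minus)
      also have "\<dots> = - (M (- T0) *v (M \<tau> *v v))" by (simp add: A.M_mult_vec)
      also have "norm \<dots> \<le> \<kappa>" using T0[of p] p Mv by simp
      finally show "norm (M (- (T0 - \<tau>)) *v (z - (z + v))) \<le> \<kappa>" .
    qed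
    \<comment> \<open>The left set lies in the \<open>D'\<close>-ball about \<open>F z\<close> that
      reaches \<open>F (z + v)\<close>. By \<open>weak\<close> the preimage of that ball stays at
      source scale \<open>- \<tau>\<close>.\<close>
    have sub: "{y. norm (M' (- t) *v (F z - y)) \<le> \<kappa>'} \<subseteq> preball r \<tau> z"
    proof
      fix y assume "y \<in> {y. norm (M' (- t) *v (F z - y)) \<le> \<kappa>'}"
      then have "D' (F z) y \<le> exp t" by (intro \<kappa>'(2)) simp
      then have "D' (F z) (F (G y)) \<le> D' (F z) (F (z + v))" using dt by (simp add: FG d_def)
      then have "D z (G y) \<le> \<Lambda> * D z (z + v)" by (rule weak)
      also have "\<dots> \<le> \<Lambda> * exp (T0 - \<tau>)" using Dzv \<Lambda>_pos by simp
      also have "\<dots> = exp (T1 - \<tau>)" using \<Lambda>_pos by (simp add: T1_def exp_add exp_diff)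
      finally have "norm (M (- (T1 - \<tau>)) *v (z - G y)) \<le> K" by (rule K)
      then have "norm (M T1 *v (M (- (T1 - \<tau>)) *v (z - G y))) \<le> B1 * K"
        using B1 by (meson mult_left_mono less_imp_le order_trans)
      then show "y \<in> preball r \<tau> z" by (simp add: preball_def A.M_mult_vec r_def)
    qed
    have "ennreal (exp (b * t) * m) \<le> emeasure lborel (preball r \<tau> z)"
      unfolding m_def B.emeasure_ellipsoid[of t "F z" \<kappa>', symmetric]
      by (rule emeasure_mono[OF sub]) (simp add: closed_preball borel_closed)
    also have "\<dots> = ennreal (measure lborel (preball r \<tau> z))"
      by (rule preball_finite[OF \<tau>])
    finally have em: "exp (b * t) * m \<le> measure lborel (preball r \<tau> z)"
      by (simp add: ennreal_le_iff)
    then have em: "exp (b * t) / \<rho> \<le> 1 / m * (measure lborel (preball r \<tau> z) / \<rho>)"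
      using m \<rho> by (simp add: field_simps)
    have \<psi>\<rho>: "\<psi> \<rho> > 0" using g \<rho> by (rule gauge_fun_pos)
    have "\<psi> (exp (b * t)) \<le> CG * \<psi> \<rho> * (1 + exp (b * t) / \<rho>)" using \<rho> by (intro CG) auto
    also have "\<dots> \<le> CG * \<psi> \<rho> * ((1 + 1 / m) * (1 + measure lborel (preball r \<tau> z) / \<rho>))"
    proof (intro mult_left_mono)
      let ?q = "measure lborel (preball r \<tau> z) / \<rho>"
      have "?q \<ge> 0" using \<rho> by simp
      moreover have "1 + exp (b * t) / \<rho> \<le> 1 + 1 / m * ?q" using em by simp
      moreover have "(1 + 1 / m) * (1 + ?q) = (1 + 1 / m * ?q) + 1 / m + ?q"
        by (simp only: ring_distribs mult_1_left mult_1_right add_ac)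
      ultimately show "1 + exp (b * t) / \<rho> \<le> (1 + 1 / m) * (1 + ?q)"
        using divide_nonneg_nonneg[of 1 m] m by linarith
    qed (use CG \<psi>\<rho> in auto)
    finally have "K' * CB * \<psi> (exp (b * t)) \<le> K' * CB * (CG * \<psi> \<rho> * ((1 + 1 / m) * (1 + measure lborel (preball r \<tau> z) / \<rho>)))"
      using K' CB by (intro mult_left_mono) auto
    with * show ?thesis unfolding C_def v_def by (simp add: mult_ac)
  qed
  moreover have "C > 0" unfolding C_def using K' CB CG m by (simp add: add_pos_pos)
  moreover have "r > 0" unfolding r_def using B1 K by simp
  ultimately show ?thesis using that by blast
qed

text \<open>Joint closedness in centre and point supplies the measurability for Fubini.\<close>

lemma closed_preball_graph: "closed {q. snd q \<in> preball r \<tau> (fst q)}"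
  unfolding preball_def mem_Collect_eq
  by (intro closed_Collect_le continuous_intros
      matrix_vector_mult_linear_continuous_on[THEN continuous_on_compose2[of UNIV]]
      contG[THEN continuous_on_compose2[of UNIV]]) auto

lemma preball_graph_measurable: "{q. snd q \<in> preball r \<tau> (fst q)} \<in> sets (lborel \<Otimes>\<^sub>M (lborel :: (real^'n) measure))"
  using closed_preball_graph[of r \<tau>] unfolding lborel_prod by (simp add: borel_closed)

lemma measurable_preball: "(\<lambda>z. emeasure lborel (preball r \<tau> z)) \<in> borel_measurable lborel"
  using lborel.measurable_emeasure_Pair[OF preball_graph_measurable, of r \<tau>]
  by (simp add: vimage_def)

text \<open>Exchanging the integrals counts, for each \<open>y\<close>, the centres \<open>z\<close>
  whose ellipsoid contains \<open>G y\<close>. These fill an ellipsoid of the same shape about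
  \<open>G y\<close>, and \<open>y\<close> is confined to a fixed compact set.\<close>

lemma integral_preball:
  obtains C where "C > 0" "\<And>\<tau>. \<tau> \<ge> 0 \<Longrightarrow>
    (\<integral>\<^sup>+z. emeasure lborel (preball r \<tau> z) * indicator (cball 0 R) z \<partial>lborel) \<le> ennreal (C * exp (- (a * \<tau>)))"
proof -
  obtain CA where CA: "CA > 0" "\<And>t x. t \<ge> 0 \<Longrightarrow> norm (M (- t) *v x) \<le> CA * norm x"
    by (metis A.M_contractE)
  define R' where "R' = R + CA * r"
  define m where "m = measure lborel (cball (0::real^'n) r)"
  define m' where "m' = measure lborel (F ` cball 0 R')"
  have cF: "compact (F ` cball 0 R')"
    by (intro compact_continuous_image continuous_on_subset[OF contF]) auto
  have em': "emeasure lborel (F ` cball 0 R') = ennreal m'"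
    unfolding m'_def by (rule emeasure_compact_eq_measure[OF cF])
  have "(\<integral>\<^sup>+z. emeasure lborel (preball r \<tau> z) * indicator (cball 0 R) z \<partial>lborel) \<le> ennreal ((m * m' + 1) * exp (- (a * \<tau>)))"
    if \<tau>: "\<tau> \<ge> 0" for \<tau>
  proof -
    let ?f = "\<lambda>q. indicator {q. snd q \<in> preball r \<tau> (fst q)} q * indicator (cball 0 R) (fst q) :: ennreal"
    have mf: "?f \<in> borel_measurable (lborel \<Otimes>\<^sub>M lborel)"
      by (intro borel_measurable_times_ennreal borel_measurable_indicator preball_graph_measurable
          measurable_compose[OF measurable_fst]) auto
    have "(\<integral>\<^sup>+z. emeasure lborel (preball r \<tau> z) * indicator (cball 0 R) z \<partial>lborel)
        = (\<integral>\<^sup>+z. (\<integral>\<^sup>+y. ?f (z, y) \<partial>lborel) \<partial>lborel)"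
    proof (intro nn_integral_cong)
      fix z
      have "(\<integral>\<^sup>+y. ?f (z, y) \<partial>lborel) = (\<integral>\<^sup>+y. indicator (preball r \<tau> z) y * indicator (cball 0 R) z \<partial>lborel)"
        by (intro nn_integral_cong) (simp add: indicator_def)
      also have "\<dots> = (\<integral>\<^sup>+y. indicator (preball r \<tau> z) y \<partial>lborel) * indicator (cball 0 R) z"
        by (intro nn_integral_multc borel_measurable_indicator) (simp add: borel_closed closed_preball)
      also have "\<dots> = emeasure lborel (preball r \<tau> z) * indicator (cball 0 R) z"
        by (simp add: borel_closed closed_preball)
      finally show "emeasure lborel (preball r \<tau> z) * indicator (cball 0 R) z = (\<integral>\<^sup>+y. ?f (z, y) \<partial>lborel)" ..
    qed
    also have "\<dots> = (\<integral>\<^sup>+y. (\<integral>\<^sup>+z. ?f (z, y) \<partial>lborel) \<partial>lborel)"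
      using lborel_pair.Fubini'[of "\<lambda>z y. ?f (z, y)"] mf by (simp add: case_prod_unfold)
    also have "\<dots> \<le> (\<integral>\<^sup>+y. ennreal (exp (- (a * \<tau>)) * m) * indicator (F ` cball 0 R') y \<partial>lborel)"
    proof (intro nn_integral_mono)
      fix y
      let ?E = "{z. norm (M (- (- \<tau>)) *v (G y - z)) \<le> r}"
      have "closed ?E"
        by (intro closed_Collect_le continuous_intros
            matrix_vector_mult_linear_continuous_on[THEN continuous_on_compose2[of UNIV]]) auto
      then have mE: "?E \<in> sets lborel" by (simp add: borel_closed)
      have "?f (z, y) \<le> indicator ?E z * indicator (F ` cball 0 R') y" for z
      proof (cases "y \<in> preball r \<tau> z \<and> z \<in> cball 0 R")
        case True
        then have n: "norm (M \<tau> *v (z - G y)) \<le> r" by (simp add: preball_def)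
        have "norm (z - G y) = norm (M (- \<tau>) *v (M \<tau> *v (z - G y)))" by simp
        also have "\<dots> \<le> CA * norm (M \<tau> *v (z - G y))" using \<tau> by (intro CA) auto
        also have "\<dots> \<le> CA * r" using n CA by (auto intro!: mult_left_mono)
        finally have "norm (z - G y) \<le> CA * r" .
        moreover have "norm z \<le> R" using True by simp
        ultimately have "norm (G y) \<le> R'" unfolding R'_def
          using norm_triangle_ineq3[of z "G y"] by linarith
        then have "y \<in> F ` cball 0 R'" by (intro image_eqI[of _ _ "G y"]) (auto simp: FG)
        moreover have "z \<in> ?E" using n by (simp add: matrix_vector_mult_diff_distrib norm_minus_commute)
        ultimately show ?thesis by (simp add: indicator_def)
      qed (auto simp: indicator_def)
      then have "(\<integral>\<^sup>+z. ?f (z, y) \<partial>lborel) \<le> (\<integral>\<^sup>+z. indicator ?E z * indicator (F ` cball 0 R') y \<partial>lborel)"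
        by (intro nn_integral_mono)
      also have "\<dots> = (\<integral>\<^sup>+z. indicator ?E z \<partial>lborel) * indicator (F ` cball 0 R') y"
        by (intro nn_integral_multc borel_measurable_indicator mE)
      also have "(\<integral>\<^sup>+z. indicator ?E z \<partial>lborel) = emeasure lborel ?E"
        by (rule nn_integral_indicator[OF mE])
      also have "\<dots> = ennreal (exp (- (a * \<tau>)) * m)"
        unfolding A.emeasure_ellipsoid m_def by simp
      finally show "(\<integral>\<^sup>+z. ?f (z, y) \<partial>lborel) \<le> ennreal (exp (- (a * \<tau>)) * m) * indicator (F ` cball 0 R') y" .
    qed
    also have "\<dots> = ennreal (exp (- (a * \<tau>)) * m) * ennreal m'"
      using cF by (simp add: nn_integral_cmult_indicator borel_compact em')
    also have "\<dots> = ennreal (exp (- (a * \<tau>)) * m * m')"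
      by (simp add: ennreal_mult m_def m'_def)
    also have "\<dots> \<le> ennreal ((m * m' + 1) * exp (- (a * \<tau>)))"
      by (intro ennreal_leI) (simp add: algebra_simps)
    finally show ?thesis .
  qed
  moreover have "m * m' + 1 > 0" by (simp add: m_def m'_def add_nonneg_pos)
  ultimately show ?thesis using that by blast
qed

text \<open>With \<open>\<rho> = exp (- (a * \<tau>))\<close>, the order of the volume of the source
  ellipsoids, the average of image volume over \<open>\<rho>\<close> is bounded, and a multiple of
  \<open>\<psi> \<rho>\<close> remains.\<close>

lemma increment_integral:
  assumes g: "gauge_fun \<psi>" and \<xi>: "\<xi> \<in> B.decay_space \<psi>"
  obtains C where "C > 0"
    "\<And>\<tau> p. \<tau> \<ge> 0 \<Longrightarrow> norm p = 1 \<Longrightarrow>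
      (\<integral>\<^sup>+z. ennreal \<bar>\<xi> \<bullet> (F (z + M (- \<tau>) *v p) - F z)\<bar> * indicator (cball 0 R) z \<partial>lborel)
        \<le> ennreal (C * \<psi> (exp (- (a * \<tau>))))"
proof -
  obtain C1 r where C1: "C1 > 0" "r > 0"
    "\<And>z \<tau> p \<rho>. norm z \<le> R \<Longrightarrow> \<tau> \<ge> 0 \<Longrightarrow> norm p = 1 \<Longrightarrow> \<rho> > 0 \<Longrightarrow>
      \<bar>\<xi> \<bullet> (F (z + M (- \<tau>) *v p) - F z)\<bar> \<le> C1 * \<psi> \<rho> * (1 + measure lborel (preball r \<tau> z) / \<rho>)"
    using increment_bound[OF g \<xi>, of R] by metis
  obtain C2 where C2: "C2 > 0" "\<And>\<tau>. \<tau> \<ge> 0 \<Longrightarrow>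
    (\<integral>\<^sup>+z. emeasure lborel (preball r \<tau> z) * indicator (cball 0 R) z \<partial>lborel) \<le> ennreal (C2 * exp (- (a * \<tau>)))"
    using integral_preball[of r R] by metis
  define m where "m = measure lborel (cball (0::real^'n) R)"
  have em: "emeasure lborel (cball (0::real^'n) R) = ennreal m"
    unfolding m_def by (rule emeasure_compact_eq_measure) simp
  have m0: "m \<ge> 0" by (simp add: m_def)
  have "(\<integral>\<^sup>+z. ennreal \<bar>\<xi> \<bullet> (F (z + M (- \<tau>) *v p) - F z)\<bar> * indicator (cball 0 R) z \<partial>lborel)
        \<le> ennreal (C1 * (m + C2) * \<psi> (exp (- (a * \<tau>))))" if \<tau>: "\<tau> \<ge> 0" and p: "norm p = 1" for \<tau> p
  proof -
    let ?\<rho> = "exp (- (a * \<tau>))"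
    have \<psi>: "\<psi> ?\<rho> > 0" using g by (rule gauge_fun_pos) simp
    let ?e = "\<lambda>z. emeasure lborel (preball r \<tau> z)"
    have "(\<integral>\<^sup>+z. ennreal \<bar>\<xi> \<bullet> (F (z + M (- \<tau>) *v p) - F z)\<bar> * indicator (cball 0 R) z \<partial>lborel)
      \<le> (\<integral>\<^sup>+z. ennreal (C1 * \<psi> ?\<rho>) * (indicator (cball 0 R) z + ennreal (1 / ?\<rho>) * (?e z * indicator (cball 0 R) z)) \<partial>lborel)"
    proof (intro nn_integral_mono)
      fix z :: "real^'n"
      show "ennreal \<bar>\<xi> \<bullet> (F (z + M (- \<tau>) *v p) - F z)\<bar> * indicator (cball 0 R) z \<le>
        ennreal (C1 * \<psi> ?\<rho>) * (indicator (cball 0 R) z + ennreal (1 / ?\<rho>) * (?e z * indicator (cball 0 R) z))"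
      proof (cases "norm z \<le> R")
        case True
        have "ennreal \<bar>\<xi> \<bullet> (F (z + M (- \<tau>) *v p) - F z)\<bar>
            \<le> ennreal ((C1 * \<psi> ?\<rho>) * (1 + 1 / ?\<rho> * measure lborel (preball r \<tau> z)))"
          using C1(3)[OF True \<tau> p, of ?\<rho>] by (intro ennreal_leI) simp
        also have "\<dots> = ennreal (C1 * \<psi> ?\<rho>) * (1 + ennreal (1 / ?\<rho>) * ennreal (measure lborel (preball r \<tau> z)))"
          using C1 \<psi> by (simp only: ennreal_mult ennreal_plus ennreal_1 measure_nonneg mult_nonneg_nonneg
            less_imp_le zero_le_one add_nonneg_nonneg exp_ge_zero zero_le_divide_iff simp_thms)
        also have "ennreal (measure lborel (preball r \<tau> z)) = ?e z"
          using preball_finite[OF \<tau>] by simp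
        finally show ?thesis using True by simp
      qed simp
    qed
    also have "\<dots> = ennreal (C1 * \<psi> ?\<rho>) * (emeasure lborel (cball (0::real^'n) R) +
        ennreal (1 / ?\<rho>) * (\<integral>\<^sup>+z. ?e z * indicator (cball 0 R) z \<partial>lborel))"
    proof -
      have m1: "(\<lambda>z. ?e z * indicator (cball 0 R) z) \<in> borel_measurable lborel"
        by (intro borel_measurable_times_ennreal measurable_preball borel_measurable_indicator) auto
      have m2: "(\<lambda>z. k * (?e z * indicator (cball 0 R) z)) \<in> borel_measurable lborel" for k
        by (intro borel_measurable_times_ennreal m1 measurable_const) auto
      have m3: "(\<lambda>z::real^'n. indicator (cball 0 R) z :: ennreal) \<in> borel_measurable lborel"
        by (intro borel_measurable_indicator) auto
      show ?thesis
        by (subst nn_integral_cmult[OF borel_measurable_add[OF m3 m2]], subst nn_integral_add[OF m3 m2],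
            subst nn_integral_cmult[OF m1], subst nn_integral_indicator) auto
    qed
    also have "\<dots> \<le> ennreal (C1 * \<psi> ?\<rho>) * (ennreal m + ennreal (1 / ?\<rho>) * ennreal (C2 * ?\<rho>))"
      unfolding em by (intro mult_left_mono add_mono C2(2) \<tau>) auto
    also have "ennreal (1 / ?\<rho>) * ennreal (C2 * ?\<rho>) = ennreal C2"
      by (subst ennreal_mult[symmetric]) (use C2 in auto)
    also have "ennreal (C1 * \<psi> ?\<rho>) * (ennreal m + ennreal C2) = ennreal (C1 * \<psi> ?\<rho> * (m + C2))"
      using C1 C2 \<psi> m0 by (simp add: ennreal_mult ennreal_plus)
    finally show ?thesis by (simp add: mult_ac)
  qed
  moreover have "C1 * (m + C2) > 0" using C1 C2 m0 by simp
  ultimately show ?thesis using that by blast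
qed

section \<open>Directions of invariance, and chains of steps transversal to them\<close>

definition invariant_dirs :: "(real^'n \<Rightarrow> real) \<Rightarrow> (real^'n) set" where
  "invariant_dirs u = {w. \<forall>x s. u (x + s *\<^sub>R w) = u x}"

lemma subspace_invariant_dirs: "subspace (invariant_dirs u)"
  unfolding real_vector.subspace_def invariant_dirs_def
  by (auto simp: scaleR_add_right) (metis add.assoc)

lemma span_invariant_dirs: "span (invariant_dirs u) = invariant_dirs u"
  by (simp add: span_eq_iff subspace_invariant_dirs)

lemma invariant_dirsD: "w \<in> invariant_dirs u \<Longrightarrow> u (x + w) = u x"
  unfolding invariant_dirs_def by (metis (mono_tags, lifting) mem_Collect_eq scaleR_one)

lemma nn_integral_shift_ball:
  fixes g :: "real^'n \<Rightarrow> ennreal"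
  assumes "g \<in> borel_measurable borel" and "norm c + norm x + d \<le> R"
  shows "(\<integral>\<^sup>+y. g (y + c) * indicator (ball x d) y \<partial>lborel) \<le> (\<integral>\<^sup>+z. g z * indicator (cball 0 R) z \<partial>lborel)"
proof -
  have "(\<integral>\<^sup>+y. g (y + c) * indicator (ball x d) y \<partial>lborel) \<le> (\<integral>\<^sup>+y. g (c + y) * indicator (cball 0 R) (c + y) \<partial>lborel)"
  proof (intro nn_integral_mono)
    fix y
    have "norm (c + y) \<le> R" if "dist x y < d"
    proof -
      have "norm y \<le> norm x + dist x y" by (metis dist_norm norm_triangle_sub norm_minus_commute)
      then show ?thesis using that assms(2) norm_triangle_ineq[of c y] by linarith
    qed
    then show "g (y + c) * indicator (ball x d) y \<le> g (c + y) * indicator (cball 0 R) (c + y)"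
      by (auto simp: indicator_def add.commute)
  qed
  also have "\<dots> = (\<integral>\<^sup>+z. g z * indicator (cball 0 R) z \<partial>distr lborel borel ((+) c))"
    using assms(1) by (subst nn_integral_distr) (auto intro!: borel_measurable_times_ennreal borel_measurable_indicator)
  finally show ?thesis by (simp add: lborel_distr_plus)
qed

text \<open>Summing the increments of \<open>u = \<xi> \<bullet> F\<close> along a chain with steps \<open>v\<close> and averaging over the
  starting point. The chain follows the component \<open>v'\<close> of \<open>v\<close> transversal to the directions in
  which \<open>u\<close> is invariant, hence stays in a bounded region.\<close>

lemma chain_bound:
  fixes v v' x\<^sub>0 :: "real^'n" and u
  assumes cont: "continuous_on UNIV u" and vv': "v - v' \<in> invariant_dirs u"
    and osc: "\<And>y. y \<in> ball x\<^sub>0 d \<Longrightarrow> c \<le> \<bar>u (y + real m *\<^sub>R v') - u y\<bar>"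
    and R: "norm x\<^sub>0 + d + real m * norm v' \<le> R" and c: "c \<ge> 0"
    and I: "(\<integral>\<^sup>+z. ennreal \<bar>u (z + v) - u z\<bar> * indicator (cball 0 R) z \<partial>lborel) \<le> ennreal I" "I \<ge> 0"
  shows "c * measure lborel (ball x\<^sub>0 d) \<le> real m * I"
proof -
  let ?g = "\<lambda>z. ennreal \<bar>u (z + v) - u z\<bar>"
  have mg: "?g \<in> borel_measurable borel"
    by (intro measurable_compose[OF _ measurable_ennreal] borel_measurable_continuous_onI continuous_intros
        continuous_on_compose2[OF cont]) auto
  have mgk: "(\<lambda>y. ?g (y + w) * indicator (ball x\<^sub>0 d) y) \<in> borel_measurable lborel" for w
    by (intro borel_measurable_times_ennreal borel_measurable_indicator
        measurable_compose[OF _ mg, of "\<lambda>y. y + w"] borel_measurable_continuous_onI continuous_intros) auto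
  \<comment> \<open>\<open>v\<close> and \<open>v'\<close> differ by a direction of invariance,
    hence produce the same increments of \<open>u\<close>.\<close>
  have step: "u (z + v) = u (z + v')" for z
    using invariant_dirsD[OF vv', of "z + v'"] by simp
  have "ennreal (c * measure lborel (ball x\<^sub>0 d)) = ennreal c * emeasure lborel (ball x\<^sub>0 d)"
    using c emeasure_bounded_finite[OF bounded_ball, of x\<^sub>0 d]
    by (subst emeasure_eq_ennreal_measure) (auto simp: ennreal_mult)
  also have "\<dots> = (\<integral>\<^sup>+y. ennreal c * indicator (ball x\<^sub>0 d) y \<partial>lborel)"
    by (simp add: nn_integral_cmult_indicator)
  also have "\<dots> \<le> (\<integral>\<^sup>+y. (\<Sum>k<m. ?g (y + real k *\<^sub>R v') * indicator (ball x\<^sub>0 d) y) \<partial>lborel)"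
  proof (intro nn_integral_mono)
    fix y
    show "ennreal c * indicator (ball x\<^sub>0 d) y \<le> (\<Sum>k<m. ?g (y + real k *\<^sub>R v') * indicator (ball x\<^sub>0 d) y)"
    proof (cases "y \<in> ball x\<^sub>0 d")
      case True
      have "c \<le> \<bar>u (y + real m *\<^sub>R v') - u y\<bar>" by (rule osc[OF True])
      also have "u (y + real m *\<^sub>R v') - u y = (\<Sum>k<m. u (y + real (Suc k) *\<^sub>R v') - u (y + real k *\<^sub>R v'))"
        using sum_lessThan_telescope[of "\<lambda>k. u (y + real k *\<^sub>R v')" m] by simp
      also have "\<bar>\<dots>\<bar> \<le> (\<Sum>k<m. \<bar>u (y + real (Suc k) *\<^sub>R v') - u (y + real k *\<^sub>R v')\<bar>)" by (rule sum_abs)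
      also have "\<dots> = (\<Sum>k<m. \<bar>u (y + real k *\<^sub>R v' + v) - u (y + real k *\<^sub>R v')\<bar>)"
      proof (intro sum.cong refl)
        fix k
        have "y + real (Suc k) *\<^sub>R v' = (y + real k *\<^sub>R v') + v'" by (simp add: algebra_simps)
        then show "\<bar>u (y + real (Suc k) *\<^sub>R v') - u (y + real k *\<^sub>R v')\<bar> =
          \<bar>u (y + real k *\<^sub>R v' + v) - u (y + real k *\<^sub>R v')\<bar>" by (simp only: step)
      qed
      finally have "ennreal c \<le> ennreal (\<Sum>k<m. \<bar>u (y + real k *\<^sub>R v' + v) - u (y + real k *\<^sub>R v')\<bar>)"
        by (rule ennreal_leI)
      with True show ?thesis by (simp add: sum_ennreal)
    qed simp
  qed
  also have "\<dots> = (\<Sum>k<m. (\<integral>\<^sup>+y. ?g (y + real k *\<^sub>R v') * indicator (ball x\<^sub>0 d) y \<partial>lborel))"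
    by (intro nn_integral_sum mgk)
  \<comment> \<open>Each summand is an integral over a translate of the ball that is still contained
    in \<open>cball 0 R\<close>.\<close>
  also have "\<dots> \<le> (\<Sum>k<m. ennreal I)"
  proof (intro sum_mono)
    fix k assume k: "k \<in> {..<m}"
    then have "real k * norm v' \<le> real m * norm v'" by (intro mult_right_mono) auto
    then have "norm (real k *\<^sub>R v') + norm x\<^sub>0 + d \<le> R" using R by simp
    from nn_integral_shift_ball[OF mg this] I(1)
    show "(\<integral>\<^sup>+y. ?g (y + real k *\<^sub>R v') * indicator (ball x\<^sub>0 d) y \<partial>lborel) \<le> ennreal I"
      by (rule order_trans)
  qed
  also have "\<dots> = ennreal (real m * I)"
    using I(2) by (simp add: ennreal_mult ennreal_of_nat_eq_real_of_nat)
  finally show ?thesis using I(2) by (simp add: ennreal_le_iff)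
qed

text \<open>\<open>p i\<close> is the direction of
  \<open>transpose (M (- \<tau> i)) *v \<zeta>\<close>, where the pairing attains the norm. The
  times diverge because on a bounded range of times the gauge is bounded below, while the pairing is
  bounded throughout.\<close>

lemma decay_space_escape:
  assumes g: "gauge_fun \<psi>" and "\<zeta> \<notin> A.decay_space \<psi>"
  obtains \<tau> p where "\<And>i::nat. \<tau> i \<ge> 0" "\<And>i. norm (p i) = 1"
    "\<And>i. \<zeta> \<bullet> (M (- \<tau> i) *v p i) > real i * \<psi> (exp (- (a * \<tau> i)))" "filterlim \<tau> at_top sequentially"
proof -
  have "\<exists>t\<ge>0. norm (transpose (M (- t)) *v \<zeta>) > real i * \<psi> (exp (- (a * t)))" for i
    using assms(2) unfolding A.decay_space_def by (auto simp: not_le)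
  then obtain \<tau> where \<tau>: "\<And>i. \<tau> i \<ge> 0" "\<And>i. norm (transpose (M (- \<tau> i)) *v \<zeta>) > real i * \<psi> (exp (- (a * \<tau> i)))"
    by metis
  have pos: "\<psi> (exp t) > 0" for t using g by (simp add: gauge_fun_pos)
  define q where "q i = transpose (M (- \<tau> i)) *v \<zeta>" for i
  have q: "norm (q i) > 0" for i
    using \<tau>(2)[of i] pos[of "- (a * \<tau> i)"] unfolding q_def
    by (meson less_imp_le mult_nonneg_nonneg of_nat_0_le_iff order_le_less_trans)
  define p where "p i = q i /\<^sub>R norm (q i)" for i
  have p: "\<zeta> \<bullet> (M (- \<tau> i) *v p i) = norm (q i)" for i
  proof -
    have "\<zeta> \<bullet> (M (- \<tau> i) *v p i) = q i \<bullet> p i"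
      unfolding q_def by (metis dot_lmul_matrix transpose_matrix_vector)
    also have "\<dots> = norm (q i)" using q[of i] by (simp add: p_def dot_square_norm power2_eq_square)
    finally show ?thesis .
  qed
  obtain C where C: "C > 0" "\<And>t x. t \<ge> 0 \<Longrightarrow> norm (M (- t) *v x) \<le> C * norm x"
    by (metis A.M_contractE)
  have np: "norm (p i) = 1" for i using q[of i] by (simp add: p_def)
  have bound: "real i * \<psi> (exp (- (a * \<tau> i))) \<le> norm \<zeta> * C" for i
  proof -
    have "real i * \<psi> (exp (- (a * \<tau> i))) \<le> \<zeta> \<bullet> (M (- \<tau> i) *v p i)" using \<tau>(2)[of i] p q_def by simp
    also have "\<dots> \<le> norm \<zeta> * norm (M (- \<tau> i) *v p i)" by (rule norm_cauchy_schwarz)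
    also have "\<dots> \<le> norm \<zeta> * C" using C(2)[OF \<tau>(1)[of i], of "p i"] np by (intro mult_left_mono) auto
    finally show ?thesis .
  qed
  obtain G where G: "G > 0" "\<And>r s. 0 < r \<Longrightarrow> r \<le> s \<Longrightarrow> \<psi> r \<le> G * \<psi> s"
    by (metis gauge_fun_mono[OF g])
  have "filterlim \<tau> at_top sequentially"
    unfolding filterlim_at_top eventually_sequentially
  proof
    fix T
    define m where "m = \<psi> (exp (- (a * T))) / G"
    have m: "m > 0" using pos G by (simp add: m_def)
    show "\<exists>N. \<forall>i\<ge>N. T \<le> \<tau> i"
    proof (intro exI allI impI, rule ccontr)
      fix i assume i: "i \<ge> nat \<lceil>norm \<zeta> * C / m\<rceil> + 1" and "\<not> T \<le> \<tau> i"
      then have "exp (- (a * T)) \<le> exp (- (a * \<tau> i))" using A.a_pos by simp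
      from G(2)[OF _ this] have "m \<le> \<psi> (exp (- (a * \<tau> i)))" using G(1) by (simp add: m_def field_simps)
      then have "real i * m \<le> norm \<zeta> * C" using bound[of i] by (meson mult_left_mono of_nat_0_le_iff order_trans)
      then have "real i \<le> norm \<zeta> * C / m" using m by (simp add: field_simps)
      moreover have "norm \<zeta> * C / m < real i" using i by linarith
      ultimately show False by simp
    qed
  qed
  with \<tau> np p q_def that show ?thesis by metis
qed

text \<open>Along the escape sequence the transversal part \<open>v' i\<close> of a step is longer
  than a multiple of \<open>i\<close> times the gauge. About \<open>s / norm (v' i)\<close> such
  steps cover a fixed distance, so the total variation of \<open>u\<close> along the chain is of
  order \<open>1 / i\<close> on average. Hence \<open>u\<close> would be constant in a limit
  direction that is orthogonal to all its directions of invariance.\<close>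

lemma orthogonal_invariant_dirs_subset:
  assumes g: "gauge_fun \<psi>" and \<xi>: "\<xi> \<in> B.decay_space \<psi>"
    and \<zeta>: "\<And>w. w \<in> invariant_dirs (\<lambda>x. \<xi> \<bullet> F x) \<Longrightarrow> \<zeta> \<bullet> w = 0"
  shows "\<zeta> \<in> A.decay_space \<psi>"
proof (rule ccontr)
  define u where "u = (\<lambda>x. \<xi> \<bullet> F x)"
  let ?K = "invariant_dirs u"
  assume "\<zeta> \<notin> A.decay_space \<psi>"
  then obtain \<tau> p where \<tau>: "\<And>i::nat. \<tau> i \<ge> 0" and p: "\<And>i. norm (p i) = 1"
    and \<zeta>p: "\<And>i. \<zeta> \<bullet> (M (- \<tau> i) *v p i) > real i * \<psi> (exp (- (a * \<tau> i)))"
    and lim: "filterlim \<tau> at_top sequentially"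
    using decay_space_escape[OF g] by metis
  have pos: "\<psi> (exp t) > 0" for t using g by (simp add: gauge_fun_pos)
  define v where "v i = M (- \<tau> i) *v p i" for i
  \<comment> \<open>Only the part of a step orthogonal to \<open>?K\<close> changes
    \<open>u\<close>, and \<open>\<zeta>\<close> sees nothing but this part.\<close>
  have "\<exists>v' k. k \<in> ?K \<and> (\<forall>w\<in>?K. v' \<bullet> w = 0) \<and> v i = k + v'" for i
  proof -
    obtain y z where "y \<in> span ?K" "\<And>w. w \<in> span ?K \<Longrightarrow> orthogonal z w" "v i = y + z"
      using orthogonal_subspace_decomp_exists by metis
    then show ?thesis unfolding span_invariant_dirs Linear_Algebra.orthogonal_def by blast
  qed
  then obtain v' k where k: "\<And>i. k i \<in> ?K" and v': "\<And>i w. w \<in> ?K \<Longrightarrow> v' i \<bullet> w = 0" and v: "\<And>i. v i = k i + v' i"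
    by metis
  have contu: "continuous_on UNIV u" unfolding u_def by (intro continuous_intros contF)
  have \<zeta>v': "real i * \<psi> (exp (- (a * \<tau> i))) < norm \<zeta> * norm (v' i)" for i
  proof -
    have "\<zeta> \<bullet> k i = 0" using \<zeta> k by (simp add: u_def)
    then have "\<zeta> \<bullet> v i = \<zeta> \<bullet> v' i" by (simp add: v inner_add_right)
    moreover have "\<zeta> \<bullet> v' i \<le> norm \<zeta> * norm (v' i)" by (rule norm_cauchy_schwarz)
    ultimately show ?thesis using \<zeta>p[of i] by (simp add: v_def)
  qed
  have v'_pos: "norm (v' i) > 0" for i
  proof -
    have "0 \<le> real i * \<psi> (exp (- (a * \<tau> i)))" using pos by (simp add: less_imp_le)
    with \<zeta>v'[of i] show ?thesis by (metis less_le_trans mult_zero_right norm_ge_zero not_less order_le_less)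
  qed
  have v'_le: "norm (v' i) \<le> norm (v i)" for i
  proof -
    have "v' i \<bullet> v i = v' i \<bullet> v' i" using v'[OF k, of i i] by (simp add: v inner_add_right)
    then have "norm (v' i) * norm (v' i) \<le> norm (v' i) * norm (v i)"
      using norm_cauchy_schwarz[of "v' i" "v i"] by (simp add: dot_square_norm power2_eq_square)
    then show ?thesis using v'_pos[of i] by simp
  qed
  have v'_lim: "(\<lambda>i. norm (v' i)) \<longlonglongrightarrow> 0"
  proof -
    obtain C e where C: "C > 0" "e > 0" "\<And>t x. t \<ge> 0 \<Longrightarrow> norm (M (- t) *v x) \<le> C * exp (- e * t) * norm x"
      by (metis A.M_contractE)
    have "((\<lambda>t. C * exp (- e * t)) \<longlongrightarrow> 0) at_top" using C(2) by real_asymp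
    then have "(\<lambda>i. C * exp (- e * \<tau> i)) \<longlonglongrightarrow> 0" using lim by (rule filterlim_compose)
    moreover have "norm (v' i) \<le> C * exp (- e * \<tau> i)" for i
      using v'_le[of i] C(3)[OF \<tau>[of i], of "p i"] p[of i] by (simp add: v_def)
    ultimately show ?thesis by (rule_tac tendsto_sandwich[OF _ _ tendsto_const]) auto
  qed
  have "\<forall>i. v' i /\<^sub>R norm (v' i) \<in> sphere 0 1" using v'_pos by (simp add: less_imp_neq[THEN not_sym])
  then obtain w l where w: "w \<in> sphere 0 1" "strict_mono (l::nat\<Rightarrow>nat)" "(\<lambda>j. v' (l j) /\<^sub>R norm (v' (l j))) \<longlonglongrightarrow> w"
    using compact_sphere[of "0::real^'n" 1, unfolded compact_def, rule_format, of "\<lambda>i. v' i /\<^sub>R norm (v' i)"]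
    by (auto simp: o_def)
  \<comment> \<open>The limit inherits orthogonality to \<open>?K\<close>, and a unit vector
    orthogonal to \<open>?K\<close> does not lie in it.\<close>
  have "w \<notin> ?K"
  proof
    assume wK: "w \<in> ?K"
    have "(\<lambda>j. (v' (l j) /\<^sub>R norm (v' (l j))) \<bullet> w) \<longlonglongrightarrow> w \<bullet> w" by (intro tendsto_intros w)
    then have "w \<bullet> w = 0" using v'[OF wK] by (simp add: LIMSEQ_const_iff)
    then show False using w(1) by auto
  qed
  then obtain x s where "u (x + s *\<^sub>R w) \<noteq> u x" unfolding invariant_dirs_def by auto
  \<comment> \<open>The chains run in the direction \<open>w\<close>, so the displacement has to be
    positive; for a negative \<open>s\<close> the end points are exchanged.\<close>
  then have "\<exists>x s. s > 0 \<and> u (x + s *\<^sub>R w) \<noteq> u x"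
  proof (cases "s > 0")
    case False
    with \<open>u (x + s *\<^sub>R w) \<noteq> u x\<close> have "s < 0" by (cases "s = 0") auto
    with \<open>u (x + s *\<^sub>R w) \<noteq> u x\<close> show ?thesis
      by (intro exI[of _ "x + s *\<^sub>R w"] exI[of _ "- s"]) auto
  qed blast
  then obtain x s where s: "s > 0" and ux: "u (x + s *\<^sub>R w) \<noteq> u x" by blast
  \<comment> \<open>A third of the difference: errors below \<open>c\<close> at both ends still
    leave at least \<open>c\<close>.\<close>
  define c where "c = \<bar>u (x + s *\<^sub>R w) - u x\<bar> / 3"
  have c: "c > 0" using ux by (simp add: c_def)
  have near: "\<exists>d>0. \<forall>y. dist y z < d \<longrightarrow> \<bar>u y - u z\<bar> < c" for z
    using contu c unfolding continuous_on_iff by (auto simp: dist_real_def)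
  obtain d1 where d1: "d1 > 0" "\<And>y. dist y x < d1 \<Longrightarrow> \<bar>u y - u x\<bar> < c" using near by blast
  obtain d2 where d2: "d2 > 0" "\<And>y. dist y (x + s *\<^sub>R w) < d2 \<Longrightarrow> \<bar>u y - u (x + s *\<^sub>R w)\<bar> < c" using near by blast
  \<comment> \<open>The end of a chain is off by the error of its start plus that of its
    displacement, each below \<open>d\<close>.\<close>
  define d where "d = min d1 (d2 / 2)"
  have d: "d > 0" "d \<le> d1" "2 * d \<le> d2" using d1 d2 by (auto simp: d_def)
  define R where "R = norm x + d + s"
  obtain C where C: "C > 0" "\<And>\<tau> p. \<tau> \<ge> 0 \<Longrightarrow> norm p = 1 \<Longrightarrow>
      (\<integral>\<^sup>+z. ennreal \<bar>\<xi> \<bullet> (F (z + M (- \<tau>) *v p) - F z)\<bar> * indicator (cball 0 R) z \<partial>lborel)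
        \<le> ennreal (C * \<psi> (exp (- (a * \<tau>))))"
    by (rule increment_integral[OF g \<xi>, of R], rule that)
  \<comment> \<open>The number of steps that fit into the length \<open>s\<close>. The defect is at
    most one step and tends to 0.\<close>
  define m where "m i = nat \<lfloor>s / norm (v' i)\<rfloor>" for i
  have m_le: "real (m i) * norm (v' i) \<le> s" for i
  proof -
    have "real (m i) \<le> s / norm (v' i)" unfolding m_def using s by simp
    then show ?thesis using v'_pos[of i] by (simp add: field_simps)
  qed
  have m_ge: "s - norm (v' i) \<le> real (m i) * norm (v' i)" for i
  proof -
    have "s / norm (v' i) \<le> real (m i) + 1" unfolding m_def by linarith
    then have "s \<le> (real (m i) + 1) * norm (v' i)" using v'_pos[of i] by (simp add: field_simps)
    then show ?thesis by (simp add: algebra_simps)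
  qed
  have mlim: "(\<lambda>j. real (m (l j)) *\<^sub>R v' (l j)) \<longlonglongrightarrow> s *\<^sub>R w"
  proof -
    have "(\<lambda>j. norm (v' (l j))) \<longlonglongrightarrow> 0" using LIMSEQ_subseq_LIMSEQ[OF v'_lim w(2)] by (simp add: o_def)
    from tendsto_diff[OF tendsto_const[of s] this] have low: "(\<lambda>j. s - norm (v' (l j))) \<longlonglongrightarrow> s" by simp
    have "(\<lambda>j. real (m (l j)) * norm (v' (l j))) \<longlonglongrightarrow> s"
    proof (rule tendsto_sandwich[OF _ _ low tendsto_const])
      show "\<forall>\<^sub>F j in sequentially. s - norm (v' (l j)) \<le> real (m (l j)) * norm (v' (l j))"
        by (rule always_eventually) (blast intro: m_ge)
      show "\<forall>\<^sub>F j in sequentially. real (m (l j)) * norm (v' (l j)) \<le> s"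
        by (rule always_eventually) (blast intro: m_le)
    qed
    from tendsto_scaleR[OF this w(3)] show ?thesis
    proof (rule Lim_transform_eventually)
      have "(real (m (l j)) * norm (v' (l j))) *\<^sub>R (v' (l j) /\<^sub>R norm (v' (l j))) = real (m (l j)) *\<^sub>R v' (l j)" for j
        using v'_pos[of "l j"] by simp
      then show "\<forall>\<^sub>F j in sequentially.
          (real (m (l j)) * norm (v' (l j))) *\<^sub>R (v' (l j) /\<^sub>R norm (v' (l j))) = real (m (l j)) *\<^sub>R v' (l j)"
        by (intro always_eventually allI)
    qed
  qed
  \<comment> \<open>The denominator is the gain from the escape: by \<open>\<zeta>v'\<close>, the
    gauge is below \<open>norm \<zeta> * norm (v' i) / i\<close>, while \<open>m i\<close> steps
    have total length at most \<open>s\<close>.\<close>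
  have bound: "c * measure lborel (ball x d) \<le> s * norm \<zeta> * C / real (l j)"
    if j: "dist (real (m (l j)) *\<^sub>R v' (l j)) (s *\<^sub>R w) < d" "l j > 0" for j
  proof -
    let ?i = "l j"
    let ?\<psi> = "\<psi> (exp (- (a * \<tau> ?i)))"
    have "c * measure lborel (ball x d) \<le> real (m ?i) * (C * ?\<psi>)"
    proof (rule chain_bound[OF contu, where v = "v ?i" and v' = "v' ?i" and R = R])
      show "v ?i - v' ?i \<in> ?K" using k v by simp
      show "c \<le> \<bar>u (y + real (m ?i) *\<^sub>R v' ?i) - u y\<bar>" if y: "y \<in> ball x d" for y
      proof -
        have "dist y x < d1" using y d by (simp add: dist_commute)
        then have 1: "\<bar>u y - u x\<bar> < c" by (rule d1)
        have "dist (y + real (m ?i) *\<^sub>R v' ?i) (x + s *\<^sub>R w) \<le> dist y x + dist (real (m ?i) *\<^sub>R v' ?i) (s *\<^sub>R w)"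
          by (rule dist_triangle_add)
        also have "\<dots> < d2" using y j d by (simp add: dist_commute)
        finally have 2: "\<bar>u (y + real (m ?i) *\<^sub>R v' ?i) - u (x + s *\<^sub>R w)\<bar> < c" by (rule d2)
        have 3: "\<bar>u (x + s *\<^sub>R w) - u x\<bar> = 3 * c" by (simp add: c_def)
        from 1 2 3 show ?thesis by linarith
      qed
      show "norm x + d + real (m ?i) * norm (v' ?i) \<le> R" using m_le[of ?i] by (simp add: R_def)
      show "(\<integral>\<^sup>+z. ennreal \<bar>u (z + v ?i) - u z\<bar> * indicator (cball 0 R) z \<partial>lborel) \<le> ennreal (C * ?\<psi>)"
        using C(2)[OF \<tau>[of ?i] p[of ?i]] by (simp add: u_def v_def inner_diff_right)
    qed (use c C pos[of "- (a * \<tau> ?i)"] in auto)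
    also have "\<dots> = (real (m ?i) * ?\<psi>) * C" by simp
    also have "\<dots> \<le> (s * norm \<zeta> / real ?i) * C"
    proof (intro mult_right_mono)
      have "real ?i * (real (m ?i) * ?\<psi>) = real (m ?i) * (real ?i * ?\<psi>)" by simp
      also have "\<dots> \<le> real (m ?i) * (norm \<zeta> * norm (v' ?i))"
        using \<zeta>v'[of ?i] by (intro mult_left_mono) auto
      also have "\<dots> = norm \<zeta> * (real (m ?i) * norm (v' ?i))" by simp
      also have "\<dots> \<le> norm \<zeta> * s" using m_le by (intro mult_left_mono) auto
      finally show "real (m ?i) * ?\<psi> \<le> s * norm \<zeta> / real ?i" using j(2) by (simp add: field_simps)
    qed (use C in auto)
    finally show ?thesis by simp
  qed
  have "\<forall>\<^sub>F j in sequentially. dist (real (m (l j)) *\<^sub>R v' (l j)) (s *\<^sub>R w) < d"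
    using mlim d(1) by (rule tendstoD)
  moreover have "\<forall>\<^sub>F j in sequentially. l j > 0"
    using eventually_gt_at_top[of 0] by eventually_elim (metis seq_suble[OF w(2)] less_le_trans)
  ultimately have "\<forall>\<^sub>F j in sequentially. c * measure lborel (ball x d) \<le> s * norm \<zeta> * C / real (l j)"
    by eventually_elim (rule bound)
  moreover have "(\<lambda>j. s * norm \<zeta> * C / real (l j)) \<longlonglongrightarrow> 0"
    using LIMSEQ_subseq_LIMSEQ[OF lim_const_over_n w(2)] by (simp add: o_def)
  ultimately have "c * measure lborel (ball x d) \<le> 0"
    by (intro tendsto_lowerbound[of _ 0 sequentially]) auto
  moreover have "measure lborel (ball x d) > 0" using content_ball_pos[OF d(1)] by simp
  ultimately show False using c by (simp add: mult_le_0_iff)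
qed

text \<open>The component \<open>z\<close> of \<open>w\<close> orthogonal to the directions of
  invariance lies in the decay space of the source. It is therefore orthogonal to \<open>w\<close>,
  hence to itself.\<close>

theorem decay_space_rigid:
  assumes g: "gauge_fun \<psi>" and \<xi>: "\<xi> \<in> B.decay_space \<psi>"
    and w: "\<And>\<zeta>. \<zeta> \<in> A.decay_space \<psi> \<Longrightarrow> \<zeta> \<bullet> w = 0"
  shows "\<xi> \<bullet> F (x + w) = \<xi> \<bullet> F x"
proof -
  let ?K = "invariant_dirs (\<lambda>x. \<xi> \<bullet> F x)"
  obtain y z where y: "y \<in> span ?K" "\<And>w. w \<in> span ?K \<Longrightarrow> orthogonal z w" and wyz: "w = y + z"
    using orthogonal_subspace_decomp_exists by metis
  then have yK: "y \<in> ?K" and z: "\<And>w. w \<in> ?K \<Longrightarrow> z \<bullet> w = 0"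
    unfolding span_invariant_dirs Linear_Algebra.orthogonal_def by blast+
  have "z \<in> A.decay_space \<psi>" using g \<xi> z by (rule orthogonal_invariant_dirs_subset)
  then have "z \<bullet> w = 0" by (rule w)
  then have "z = 0" using z[OF yK] by (simp add: wyz inner_add_right)
  with wyz yK show ?thesis using invariant_dirsD[of w "\<lambda>x. \<xi> \<bullet> F x"] by simp
qed

theorem dim_decay_space_le:
  assumes g: "gauge_fun \<psi>"
  shows "dim (B.decay_space \<psi>) \<le> dim (A.decay_space \<psi>)"
proof -
  let ?A = "{w. \<forall>\<zeta>\<in>A.decay_space \<psi>. orthogonal \<zeta> w}" and ?B = "{w. \<forall>\<zeta>\<in>B.decay_space \<psi>. orthogonal \<zeta> w}"
  have "dim ?A \<le> dim ?B"
  proof (rule continuous_injective_image_subspace_dim_le)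
    show "subspace ?A" "subspace ?B" by (simp_all add: subspace_orthogonal_to_vectors)
    show "continuous_on ?A (\<lambda>w. F w - F 0)"
      by (intro continuous_intros continuous_on_subset[OF contF]) auto
    show "(\<lambda>w. F w - F 0) \<in> ?A \<rightarrow> ?B"
    proof (intro Pi_I CollectI ballI)
      fix w \<xi> assume w: "w \<in> ?A" and \<xi>: "\<xi> \<in> B.decay_space \<psi>"
      have "\<xi> \<bullet> F (0 + w) = \<xi> \<bullet> F 0"
        by (rule decay_space_rigid[OF g \<xi>]) (use w in \<open>simp add: Linear_Algebra.orthogonal_def\<close>)
      then show "orthogonal \<xi> (F w - F 0)" by (simp add: Linear_Algebra.orthogonal_def inner_diff_right)
    qed
    show "inj_on (\<lambda>w. F w - F 0) ?A"
    proof (rule inj_onI)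
      fix x y assume "F x - F 0 = F y - F 0"
      then have "F x = F y" by simp
      then show "x = y" by (metis GF)
    qed
  qed
  \<comment> \<open>Passing from the annihilators to the decay spaces reverses the
    inequality.\<close>
  moreover have "dim ?A + dim (A.decay_space \<psi>) = CARD('n)" "dim ?B + dim (B.decay_space \<psi>) = CARD('n)"
    using dim_subspace_orthogonal_to_vectors[OF A.subspace_decay_space[OF g] subspace_UNIV]
      dim_subspace_orthogonal_to_vectors[OF B.subspace_decay_space[OF g] subspace_UNIV] by auto
  ultimately show ?thesis by linarith
qed

end

subsection \<open>The matrix exponential\<close>

abbreviation mpow :: "'a::semiring_1^'n^'n \<Rightarrow> nat \<Rightarrow> 'a^'n^'n" where
  "mpow A k \<equiv> (((**) A) ^^ k) (mat 1)"

text \<open>An entrywise series serves the real and the complex case alike, so that a real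
  exponential can be computed from a complex Jordan form.\<close>

definition mexp :: "'a::{real_normed_field,banach}^'n^'n \<Rightarrow> 'a^'n^'n" where
  "mexp A = (\<chi> i j. \<Sum>k. (mpow A k $ i $ j) /\<^sub>R fact k)"

lemma mpow_add: "mpow A (i + j) = mpow A i ** mpow A j"
  by (induction i) (auto simp: matrix_mul_assoc)

lemma mpow_scaleR:
  fixes A :: "'a::real_normed_field^'n^'n"
  shows "mpow (s *\<^sub>R A) k = s ^ k *\<^sub>R mpow A k"
  by (induction k) (auto simp: Finite_Cartesian_Product.vec_eq_iff matrix_matrix_mult_def scaleR_sum_right mult_ac)

lemma mpow_entry_bound:
  fixes A :: "'a::real_normed_field^'n^'n"
  obtains m where "m \<ge> 0" "\<And>k i j. norm (mpow A k $ i $ j) \<le> m ^ k"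
proof -
  define c where "c = (\<Sum>i\<in>UNIV. \<Sum>j\<in>UNIV. norm (A $ i $ j))"
  define m where "m = real CARD('n) * c"
  have c: "norm (A $ i $ j) \<le> c" for i j
  proof -
    have "norm (A $ i $ j) \<le> (\<Sum>j\<in>UNIV. norm (A $ i $ j))" by (rule member_le_sum) auto
    also have "\<dots> \<le> c" unfolding c_def by (rule member_le_sum) (auto intro: sum_nonneg)
    finally show ?thesis .
  qed
  have "norm (mpow A k $ i $ j) \<le> m ^ k" for k i j
  proof (induction k arbitrary: i j)
    case 0 then show ?case by (simp add: Finite_Cartesian_Product.mat_def)
  next
    case (Suc k)
    have "norm (mpow A (Suc k) $ i $ j) = norm (\<Sum>l\<in>UNIV. A $ i $ l * mpow A k $ l $ j)"
      by (simp add: matrix_matrix_mult_def)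
    also have "\<dots> \<le> (\<Sum>l\<in>UNIV. norm (A $ i $ l * mpow A k $ l $ j))" by (rule norm_sum)
    also have "\<dots> \<le> (\<Sum>l\<in>(UNIV::'n set). c * m ^ k)"
      unfolding norm_mult by (intro sum_mono mult_mono c Suc order_trans[OF norm_ge_zero c]) auto
    also have "\<dots> = m ^ Suc k" by (simp add: m_def)
    finally show ?case .
  qed
  moreover have "m \<ge> 0" unfolding m_def c_def by (intro mult_nonneg_nonneg sum_nonneg) auto
  ultimately show ?thesis using that by blast
qed

lemma summable_mexp:
  fixes A :: "'a::{real_normed_field,banach}^'n^'n"
  shows "summable (\<lambda>k. norm ((mpow A k $ i $ j) /\<^sub>R fact k))"
proof -
  obtain m where m: "m \<ge> 0" "\<And>k i j. norm (mpow A k $ i $ j) \<le> m ^ k" using mpow_entry_bound by blast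
  show ?thesis
  proof (rule summable_comparison_test'[where N = 0])
    show "summable (\<lambda>k. m ^ k /\<^sub>R fact k)" by (rule summable_exp_generic)
    show "norm (norm ((mpow A k $ i $ j) /\<^sub>R fact k)) \<le> m ^ k /\<^sub>R fact k" for k
      using m by (simp add: divide_simps)
  qed
qed

lemma mexp_sums:
  fixes A :: "'a::{real_normed_field,banach}^'n^'n"
  shows "(\<lambda>k. (mpow A k $ i $ j) /\<^sub>R fact k) sums (mexp A $ i $ j)"
  unfolding mexp_def vec_lambda_beta by (rule summable_sums[OF summable_norm_cancel[OF summable_mexp]])

lemma mexp_eqI:
  fixes A :: "'a::{real_normed_field,banach}^'n^'n"
  assumes "\<And>i j. (\<lambda>k. (mpow A k $ i $ j) /\<^sub>R fact k) sums (X $ i $ j)"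
  shows "mexp A = X"
  using sums_unique2[OF mexp_sums assms] by (simp add: Finite_Cartesian_Product.vec_eq_iff)

lemma matrix_exp_eq_mexp: "matrix_exp A = mexp A"
proof -
  have "(\<lambda>k. mpow A k /\<^sub>R fact k) sums mexp A"
    unfolding sums_def
    by (intro vec_tendstoI) (use mexp_sums[of A] in \<open>simp add: sums_def\<close>)
  then show ?thesis unfolding matrix_exp_def by (simp add: sums_iff)
qed

lemma mexp_0 [simp]: "mexp 0 = mat 1"
proof (rule mexp_eqI)
  fix i j :: 'b
  have "(\<lambda>k. (mpow (0::'a^'b^'b) k $ i $ j) /\<^sub>R fact k) = (\<lambda>k. if k = 0 then mat 1 $ i $ j else 0)"
  proof
    fix k show "(mpow (0::'a^'b^'b) k $ i $ j) /\<^sub>R fact k = (if k = 0 then mat 1 $ i $ j else 0)"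
      by (cases k) (auto simp: matrix_matrix_mult_def)
  qed
  then show "(\<lambda>k. (mpow (0::'a^'b^'b) k $ i $ j) /\<^sub>R fact k) sums (mat 1 $ i $ j)"
    using sums_single[of 0 "\<lambda>_. (mat 1 :: 'a^'b^'b) $ i $ j"] by simp
qed

text \<open>Cauchy product of the entry series. Both factors come from powers of one matrix, so the
  binomial theorem for \<open>s\<close> and \<open>t\<close> collects the terms.\<close>

lemma mexp_scaleR_add:
  fixes A :: "'a::{real_normed_field,banach}^'n^'n"
  shows "mexp ((s + t) *\<^sub>R A) = mexp (s *\<^sub>R A) ** mexp (t *\<^sub>R A)"
proof (rule mexp_eqI)
  fix i j
  let ?a = "\<lambda>l k. (mpow (s *\<^sub>R A) k $ i $ l) /\<^sub>R fact k"
  let ?b = "\<lambda>l k. (mpow (t *\<^sub>R A) k $ l $ j) /\<^sub>R fact k"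
  have "(\<lambda>k. \<Sum>l\<in>UNIV. \<Sum>q\<le>k. ?a l q * ?b l (k - q)) sums (\<Sum>l\<in>UNIV. (mexp (s *\<^sub>R A) $ i $ l) * (mexp (t *\<^sub>R A) $ l $ j))"
  proof (rule sums_sum)
    fix l
    have "(\<lambda>k. \<Sum>q\<le>k. ?a l q * ?b l (k - q)) sums ((\<Sum>k. ?a l k) * (\<Sum>k. ?b l k))"
      by (rule Cauchy_product_sums summable_mexp)+
    then show "(\<lambda>k. \<Sum>q\<le>k. ?a l q * ?b l (k - q)) sums ((mexp (s *\<^sub>R A) $ i $ l) * (mexp (t *\<^sub>R A) $ l $ j))"
      by (simp add: mexp_def)
  qed
  moreover have "(\<Sum>l\<in>UNIV. \<Sum>q\<le>k. ?a l q * ?b l (k - q)) = (mpow ((s + t) *\<^sub>R A) k $ i $ j) /\<^sub>R fact k" for k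
  proof -
    have "(\<Sum>l\<in>UNIV. \<Sum>q\<le>k. ?a l q * ?b l (k - q)) = (\<Sum>q\<le>k. \<Sum>l\<in>UNIV. ?a l q * ?b l (k - q))"
      by (rule sum.swap)
    also have "\<dots> = (\<Sum>q\<le>k. (s ^ q * t ^ (k - q) / (fact q * fact (k - q))) *\<^sub>R (mpow A k $ i $ j))"
    proof (intro sum.cong refl)
      fix q assume "q \<in> {..k}"
      then have "mpow A k = mpow A q ** mpow A (k - q)" by (simp flip: mpow_add)
      then show "(\<Sum>l\<in>UNIV. ?a l q * ?b l (k - q)) = (s ^ q * t ^ (k - q) / (fact q * fact (k - q))) *\<^sub>R (mpow A k $ i $ j)"
        by (simp add: mpow_scaleR matrix_matrix_mult_def scaleR_sum_right divide_inverse mult_ac)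
    qed
    also have "\<dots> = (\<Sum>q\<le>k. s ^ q * t ^ (k - q) / (fact q * fact (k - q))) *\<^sub>R (mpow A k $ i $ j)"
      by (simp add: scaleR_sum_left)
    also have "(\<Sum>q\<le>k. s ^ q * t ^ (k - q) / (fact q * fact (k - q))) = (s + t) ^ k / fact k"
      unfolding binomial_ring sum_divide_distrib
      by (intro sum.cong refl) (simp add: binomial_fact field_simps)
    finally show ?thesis by (simp add: mpow_scaleR divide_inverse_commute)
  qed
  ultimately show "(\<lambda>k. (mpow ((s + t) *\<^sub>R A) k $ i $ j) /\<^sub>R fact k) sums ((mexp (s *\<^sub>R A) ** mexp (t *\<^sub>R A)) $ i $ j)"
    by (simp add: matrix_matrix_mult_def)
qed

lemma mpow_conj:
  assumes "Q ** P = mat 1" "P ** Q = mat 1"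
  shows "mpow (P ** X ** Q) k = P ** mpow X k ** Q"
proof (induction k)
  case (Suc k)
  have "mpow (P ** X ** Q) (Suc k) = P ** X ** (Q ** P) ** mpow X k ** Q"
    by (simp add: Suc matrix_mul_assoc)
  then show ?case using assms by (simp add: matrix_mul_assoc)
qed (simp add: assms)

lemma matrix_mult3_entry: "(P ** X ** Q) $ i $ j = (\<Sum>m\<in>UNIV. \<Sum>l\<in>UNIV. P $ i $ l * X $ l $ m * Q $ m $ j)"
  by (simp add: matrix_matrix_mult_def sum_distrib_right)

lemma mexp_conj:
  fixes X :: "'a::{real_normed_field,banach}^'n^'n"
  assumes "Q ** P = mat 1" "P ** Q = mat 1"
  shows "mexp (P ** X ** Q) = P ** mexp X ** Q"
proof (rule mexp_eqI)
  fix i j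
  have "(\<lambda>k. \<Sum>m\<in>UNIV. \<Sum>l\<in>UNIV. P $ i $ l * ((mpow X k $ l $ m) /\<^sub>R fact k) * Q $ m $ j) sums
    (\<Sum>m\<in>UNIV. \<Sum>l\<in>UNIV. P $ i $ l * mexp X $ l $ m * Q $ m $ j)"
    by (intro sums_sum sums_mult sums_mult2 mexp_sums)
  then show "(\<lambda>k. (mpow (P ** X ** Q) k $ i $ j) /\<^sub>R fact k) sums ((P ** mexp X ** Q) $ i $ j)"
    by (simp add: mpow_conj[OF assms] matrix_mult3_entry scaleR_sum_right)
qed

section \<open>From real to complex matrices\<close>

definition cmat :: "real^'n^'m \<Rightarrow> complex^'n^'m" where
  "cmat A = (\<chi> i j. complex_of_real (A $ i $ j))"

lemma cmat_mult: "cmat (A ** B) = cmat A ** cmat B"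
  by (simp add: cmat_def matrix_matrix_mult_def Finite_Cartesian_Product.vec_eq_iff)

lemma cmat_1 [simp]: "cmat (mat 1) = mat 1"
  by (simp add: cmat_def Finite_Cartesian_Product.mat_def Finite_Cartesian_Product.vec_eq_iff)

lemma cmat_scaleR: "cmat (s *\<^sub>R A) = s *\<^sub>R cmat A"
proof -
  have "complex_of_real (s * x) = s *\<^sub>R complex_of_real x" for x by (simp add: scaleR_conv_of_real)
  then show ?thesis by (simp add: cmat_def Finite_Cartesian_Product.vec_eq_iff)
qed

lemma mpow_cmat: "mpow (cmat A) k = cmat (mpow A k)"
  by (induction k) (auto simp: cmat_mult)

lemma mexp_cmat: "mexp (cmat A) = cmat (mexp A)"
proof (rule mexp_eqI)
  fix i j
  have "(mpow (cmat A) k $ i $ j) /\<^sub>R fact k = complex_of_real ((mpow A k $ i $ j) /\<^sub>R fact k)" for k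
    unfolding mpow_cmat by (simp add: cmat_def scaleR_conv_of_real)
  moreover have "cmat (mexp A) $ i $ j = complex_of_real (mexp A $ i $ j)" by (simp add: cmat_def)
  ultimately show "(\<lambda>k. (mpow (cmat A) k $ i $ j) /\<^sub>R fact k) sums (cmat (mexp A) $ i $ j)"
    using sums_of_real[OF mexp_sums[of A i j], where 'a = complex] by simp
qed

subsection \<open>Jordan matrices\<close>

text \<open>The inverse of the enumeration \<open>from_nat_into UNIV\<close> by which
  \<open>complex_mat\<close> is defined.\<close>

definition idx :: "'n::finite \<Rightarrow> nat" where "idx = to_nat_on UNIV"

lemma bij_idx: "bij_betw (idx :: 'n::finite \<Rightarrow> nat) UNIV {..<CARD('n)}"
  unfolding idx_def by (rule to_nat_on_finite) simp

lemma idx_less [simp]: "idx (i :: 'n::finite) < CARD('n)"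
  using bij_idx by (auto simp: bij_betw_def)

lemma idx_eq_iff [simp]: "idx i = idx j \<longleftrightarrow> i = j"
  using bij_idx by (metis (full_types) UNIV_I bij_betw_imp_inj_on inj_on_eq_iff)

lemma idx_surj: "p < CARD('n) \<Longrightarrow> \<exists>i::'n::finite. idx i = p"
  using bij_idx by (metis (full_types) bij_betw_imp_surj_on imageE lessThan_iff)

lemma from_nat_into_idx [simp]: "from_nat_into UNIV (idx i) = (i :: 'n::finite)"
  by (simp add: idx_def)

definition of_mat :: "'a Matrix.mat \<Rightarrow> 'a^'n^'n" where
  "of_mat X = (\<chi> i j. X $$ (idx i, idx j))"

lemma of_mat_complex_mat: "of_mat (complex_mat A) = cmat A"
  by (simp add: of_mat_def cmat_def complex_mat_def)

lemma of_mat_mult: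
  fixes X Y :: "'a::comm_semiring_1 Matrix.mat"
  assumes "X \<in> carrier_mat CARD('n) CARD('n)" "Y \<in> carrier_mat CARD('n) CARD('n)"
  shows "(of_mat (X * Y) :: 'a^'n^'n) = of_mat X ** of_mat Y"
proof -
  have "(X * Y) $$ (idx i, idx j) = (\<Sum>l\<in>(UNIV::'n set). X $$ (idx i, idx l) * Y $$ (idx l, idx j))" for i j :: 'n
  proof -
    have "(X * Y) $$ (idx i, idx j) = (\<Sum>p\<in>{..<CARD('n)}. X $$ (idx i, p) * Y $$ (p, idx j))"
      using assms by (auto simp: scalar_prod_def atLeast0LessThan)
    also have "\<dots> = (\<Sum>l\<in>(UNIV::'n set). X $$ (idx i, idx l) * Y $$ (idx l, idx j))"
      by (rule sum.reindex_bij_betw[OF bij_idx, symmetric])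
    finally show ?thesis .
  qed
  then show ?thesis by (simp add: of_mat_def matrix_matrix_mult_def)
qed

lemma of_mat_1 [simp]: "(of_mat (1\<^sub>m CARD('n)) :: 'a::semiring_1^'n^'n) = mat 1"
  by (simp add: of_mat_def Finite_Cartesian_Product.mat_def)

text \<open>A Jordan matrix is encoded by the list of its diagonal positions. Each position carries the
  diagonal entry and the number of positions that follow it inside its block.\<close>

definition jordan_positions :: "(nat \<times> 'a) list \<Rightarrow> ('a \<times> nat) list" where
  "jordan_positions xs = concat (map (\<lambda>(k, a). map (\<lambda>i. (a, k - 1 - i)) [0..<k]) xs)"

lemma jordan_positions_simps [simp]:
  "jordan_positions [] = []"
  "jordan_positions ((k, a) # xs) = map (\<lambda>i. (a, k - 1 - i)) [0..<k] @ jordan_positions xs"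
  by (simp_all add: jordan_positions_def)

lemma length_jordan_positions [simp]: "length (jordan_positions xs) = sum_list (map fst xs)"
  by (induction xs) auto

text \<open>What multiplication by a Jordan matrix needs to know of the list: a 1 above the diagonal
  leads to the next position of the same block.\<close>

definition position_chain :: "('a \<times> nat) list \<Rightarrow> bool" where
  "position_chain L \<longleftrightarrow> (\<forall>p<length L. snd (L ! p) > 0 \<longrightarrow>
     Suc p < length L \<and> fst (L ! Suc p) = fst (L ! p) \<and> snd (L ! Suc p) = snd (L ! p) - 1)"

lemma position_chain_jordan: "position_chain (jordan_positions xs)"
proof (induction xs)
  case Nil then show ?case by (simp add: position_chain_def)
next
  case (Cons x xs)
  obtain k a where x: "x = (k, a)" by (cases x)
  have sub: "Suc p - k = Suc (p - k)" if "\<not> p < k" for p using that by simp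
  show ?case unfolding position_chain_def x
  proof (intro allI impI)
    fix p assume p: "p < length (jordan_positions ((k, a) # xs))" "snd (jordan_positions ((k, a) # xs) ! p) > 0"
    show "Suc p < length (jordan_positions ((k, a) # xs)) \<and>
      fst (jordan_positions ((k, a) # xs) ! Suc p) = fst (jordan_positions ((k, a) # xs) ! p) \<and>
      snd (jordan_positions ((k, a) # xs) ! Suc p) = snd (jordan_positions ((k, a) # xs) ! p) - 1"
    proof (cases "p < k")
      case True
      then show ?thesis using p(2) by (auto simp: nth_append)
    next
      case False
      then have q: "p - k < length (jordan_positions xs)" "snd (jordan_positions xs ! (p - k)) > 0"
        using p by (auto simp: nth_append)
      show ?thesis using Cons[unfolded position_chain_def, rule_format, OF q] False
        by (auto simp: nth_append sub)
    qed
  qed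
qed

lemma jordan_matrix_entry:
  fixes xs :: "(nat \<times> 'a::{zero,one}) list"
  assumes "i < sum_list (map fst xs)" "j < sum_list (map fst xs)"
  shows "jordan_matrix xs $$ (i, j) = (if i = j then fst (jordan_positions xs ! i)
    else if j = Suc i \<and> snd (jordan_positions xs ! i) > 0 then 1 else 0)"
  using assms
proof (induction xs arbitrary: i j)
  case (Cons x xs)
  obtain k a where x: "x = (k, a)" by (cases x)
  have "jordan_matrix xs \<in> carrier_mat (sum_list (map fst xs)) (sum_list (map fst xs))" by simp
  then have dims: "dim_row (jordan_matrix xs) = sum_list (map fst xs)" "dim_col (jordan_matrix xs) = sum_list (map fst xs)"
    by auto
  have IH: "\<not> i < k \<Longrightarrow> \<not> j < k \<Longrightarrow> jordan_matrix xs $$ (i - k, j - k) = (if i - k = j - k then fst (jordan_positions xs ! (i - k))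
    else if j - k = Suc (i - k) \<and> snd (jordan_positions xs ! (i - k)) > 0 then 1 else 0)"
    using Cons.prems by (intro Cons.IH) (auto simp: x)
  have entry: "jordan_matrix ((k, a) # xs) $$ (i, j) = (if i < k then if j < k then jordan_block k a $$ (i, j) else 0
      else if j < k then 0 else jordan_matrix xs $$ (i - k, j - k))"
    unfolding jordan_matrix_Cons using Cons.prems by (subst index_mat_four_block) (simp_all add: dims x)
  have Cij: "i < k + sum_list (map fst xs)" "j < k + sum_list (map fst xs)" using Cons.prems by (simp_all add: x)
  consider "i < k" "j < k" | "i < k" "\<not> j < k" | "\<not> i < k" "j < k" | "\<not> i < k" "\<not> j < k" by blast
  then show ?case
  proof cases
    case 1
    then have "k - Suc i > 0 \<longleftrightarrow> Suc i < k" by simp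
    with 1 show ?thesis unfolding x entry by (auto simp: nth_append)
  next
    case 2
    then show ?thesis unfolding x entry by (auto simp: nth_append)
  next
    case 3
    then show ?thesis unfolding x entry by simp
  next
    case 4
    then have eq: "(i - k = j - k) = (i = j)" "(j - k = Suc (i - k)) = (j = Suc i)" by auto
    have L: "jordan_positions ((k, a) # xs) ! i = jordan_positions xs ! (i - k)"
      using 4 by (simp add: nth_append)
    show ?thesis unfolding x entry L using IH[OF 4] eq 4 by simp
  qed
qed simp

definition jmat :: "('a \<times> nat) list \<Rightarrow> 'a::{zero,one}^'n^'n" where
  "jmat L = (\<chi> i j. if i = j then fst (L ! idx i)
     else if idx j = Suc (idx i) \<and> snd (L ! idx i) > 0 then 1 else 0)"

lemma of_mat_jordan_matrix:
  assumes "sum_list (map fst xs) = CARD('n)"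
  shows "of_mat (jordan_matrix xs) = (jmat (jordan_positions xs) :: 'a::{zero,one}^'n^'n)"
  unfolding of_mat_def jmat_def using assms
  by (simp add: jordan_matrix_entry)

lemma jmat_mult_entry:
  fixes X :: "'a::comm_ring_1^'n^'n"
  assumes "position_chain L" "length L = CARD('n)"
  shows "(jmat L ** X) $ i $ j = fst (L ! idx i) * X $ i $ j +
    (if snd (L ! idx i) > 0 then X $ (from_nat_into UNIV (Suc (idx i))) $ j else 0)"
proof -
  let ?s = "from_nat_into UNIV (Suc (idx i)) :: 'n"
  have "(jmat L ** X) $ i $ j = (\<Sum>l\<in>UNIV. (if l = i then fst (L ! idx i) * X $ i $ j else 0) +
      (if idx l = Suc (idx i) \<and> snd (L ! idx i) > 0 then X $ l $ j else 0))"
    unfolding matrix_matrix_mult_def vec_lambda_beta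
    by (intro sum.cong refl) (auto simp: jmat_def)
  also have "\<dots> = fst (L ! idx i) * X $ i $ j + (\<Sum>l\<in>UNIV. (if idx l = Suc (idx i) \<and> snd (L ! idx i) > 0 then X $ l $ j else 0))"
    by (simp add: sum.distrib)
  also have "(\<Sum>l\<in>UNIV. (if idx l = Suc (idx i) \<and> snd (L ! idx i) > 0 then X $ l $ j else 0)) =
      (if snd (L ! idx i) > 0 then X $ ?s $ j else 0)"
  proof (cases "snd (L ! idx i) > 0")
    case True
    then have "Suc (idx i) < CARD('n)" using assms unfolding position_chain_def by (metis idx_less)
    then obtain l where l: "idx (l::'n) = Suc (idx i)" using idx_surj by blast
    then have s: "?s = l" by (metis from_nat_into_idx)
    have "idx l' = Suc (idx i) \<longleftrightarrow> l' = l" for l' :: 'n using l by (metis idx_eq_iff)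
    then show ?thesis using True by (simp add: s)
  qed simp
  finally show ?thesis .
qed

text \<open>Multiplication by the Jordan matrix combines a row with the next row of its block, so
  the entries follow Pascal's rule.\<close>

lemma mpow_jmat:
  fixes L :: "('a::comm_ring_1 \<times> nat) list"
  assumes L: "position_chain L" "length L = CARD('n)"
  shows "(mpow (jmat L :: 'a^'n^'n) r) $ i $ j =
    (if idx i \<le> idx j \<and> idx j - idx i \<le> snd (L ! idx i)
     then of_nat (r choose (idx j - idx i)) * fst (L ! idx i) ^ (r - (idx j - idx i)) else 0)"
proof (induction r arbitrary: i j)
  case 0
  show ?case
  proof (cases "i = j")
    case False
    then have "idx i \<noteq> idx j" by simp
    then have "idx i \<noteq> idx j" by simp
    then have z: "idx i \<le> idx j \<Longrightarrow> of_nat (0 choose (idx j - idx i)) = (0::'a)"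
      using le_neq_implies_less[of "idx i" "idx j"] by (subst binomial_eq_0) auto
    show ?thesis using False by (simp add: Finite_Cartesian_Product.mat_def z)
  qed (simp add: Finite_Cartesian_Product.mat_def)
next
  case (Suc r)
  let ?s = "from_nat_into UNIV (Suc (idx i)) :: 'n"
  let ?R = "snd (L ! idx i)" let ?\<mu> = "fst (L ! idx i)"
  have s: "?R > 0 \<Longrightarrow> idx ?s = Suc (idx i) \<and> snd (L ! idx ?s) = ?R - 1 \<and> fst (L ! idx ?s) = ?\<mu>"
  proof -
    assume R: "?R > 0"
    then have c: "Suc (idx i) < CARD('n)" "fst (L ! Suc (idx i)) = ?\<mu>" "snd (L ! Suc (idx i)) = ?R - 1"
      using L unfolding position_chain_def by (metis idx_less)+
    obtain l where l: "idx (l::'n) = Suc (idx i)" using idx_surj[OF c(1)] by blast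
    then have "?s = l" by (metis from_nat_into_idx)
    with l c show ?thesis by simp
  qed
  have step: "mpow (jmat L :: 'a^'n^'n) (Suc r) $ i $ j = ?\<mu> * mpow (jmat L) r $ i $ j +
     (if ?R > 0 then mpow (jmat L) r $ ?s $ j else 0)"
    using jmat_mult_entry[OF L, of "mpow (jmat L) r"] by simp
  consider "idx j < idx i" | "idx j = idx i" | d where "idx j = idx i + Suc d"
    by (metis add_Suc_right less_imp_Suc_add linorder_less_linear)
  then show ?case
  proof cases
    case 1
    have z: "(if ?R > 0 then mpow (jmat L) r $ ?s $ j else 0) = (0::'a)" using 1 s by (simp add: Suc.IH)
    show ?thesis unfolding step z using 1 by (simp add: Suc.IH)
  next
    case 2
    have z: "(if ?R > 0 then mpow (jmat L) r $ ?s $ j else 0) = (0::'a)" using 2 s by (simp add: Suc.IH)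
    show ?thesis unfolding step z using 2 by (simp add: Suc.IH)
  next
    case (3 d)
    show ?thesis
    proof (cases "Suc d \<le> ?R")
      case True
      then have R: "?R > 0" by simp
      have "mpow (jmat L) r $ ?s $ j = of_nat (r choose d) * ?\<mu> ^ (r - d)"
      proof -
        have s1: "idx ?s = Suc (idx i)" and s2: "snd (L ! Suc (idx i)) = ?R - 1" and s3: "fst (L ! Suc (idx i)) = ?\<mu>"
          using s[OF R] by metis+
        have "d \<le> ?R - 1" using True by simp
        then show ?thesis using 3 by (simp add: Suc.IH s1 s2 s3)
      qed
      moreover have "mpow (jmat L :: 'a^'n^'n) r $ i $ j = of_nat (r choose Suc d) * ?\<mu> ^ (r - Suc d)"
        using True 3 by (simp add: Suc.IH)
      \<comment> \<open>For \<open>r \<le> d\<close> the subtraction in the exponent is truncated,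
        but then the binomial coefficient on both sides is 0.\<close>
      moreover have "?\<mu> * (of_nat (r choose Suc d) * ?\<mu> ^ (r - Suc d)) = of_nat (r choose Suc d) * ?\<mu> ^ (r - d)"
      proof (cases "Suc d \<le> r")
        case True
        then have "r - d = Suc (r - Suc d)" by simp
        then show ?thesis by simp
      qed (simp add: binomial_eq_0)
      ultimately show ?thesis unfolding step using True 3 R by (simp add: algebra_simps)
    next
      case False
      have z: "(if ?R > 0 then mpow (jmat L) r $ ?s $ j else 0) = (0::'a)"
      proof (cases "?R > 0")
        case True
        have s1: "idx ?s = Suc (idx i)" and s2: "snd (L ! Suc (idx i)) = ?R - 1"
          using s[OF True] by metis+
        have "\<not> d \<le> ?R - 1" using False True by simp
        then show ?thesis using 3 by (simp add: Suc.IH s1 s2)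
      qed simp
      show ?thesis unfolding step z using 3 False by (simp add: Suc.IH)
    qed
  qed
qed

text \<open>The first \<open>d\<close> terms vanish. After a shift by \<open>d\<close> the factor
  \<open>t ^ d / fact d\<close> splits off and the exponential series remains.\<close>

lemma exp_binomial_sums:
  fixes x :: "'a::{real_normed_field,banach}"
  shows "(\<lambda>r. (t ^ r *\<^sub>R (of_nat (r choose d) * x ^ (r - d))) /\<^sub>R fact r) sums (exp (t *\<^sub>R x) * of_real (t ^ d / fact d))"
proof -
  have "(\<lambda>r. (t ^ (r + d) *\<^sub>R (of_nat ((r + d) choose d) * x ^ r)) /\<^sub>R fact (r + d)) sums (exp (t *\<^sub>R x) * of_real (t ^ d / fact d))"
  proof -
    have eq: "(t ^ (r + d) *\<^sub>R (of_nat ((r + d) choose d) * x ^ r)) /\<^sub>R fact (r + d) =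
        ((t *\<^sub>R x) ^ r /\<^sub>R fact r) * of_real (t ^ d / fact d)" for r
    proof -
      have "real ((r + d) choose d) / fact (r + d) = 1 / (fact r * fact d)"
        by (simp add: binomial_fact)
      then have "t ^ (r + d) * real ((r + d) choose d) / fact (r + d) = (t ^ r / fact r) * (t ^ d / fact d)"
        by (simp add: power_add field_simps)
      then have "(t ^ (r + d) * real ((r + d) choose d) / fact (r + d)) *\<^sub>R x ^ r = ((t ^ r / fact r) * (t ^ d / fact d)) *\<^sub>R x ^ r"
        by simp
      then show ?thesis
        by (simp add: scaleR_conv_of_real power_mult_distrib divide_inverse mult_ac)
    qed
    show ?thesis unfolding eq by (intro sums_mult2 exp_converges)
  qed
  moreover have "(t ^ r *\<^sub>R (of_nat (r choose d) * x ^ (r - d))) /\<^sub>R fact r = 0" if "r < d" for r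
    using that by (simp add: binomial_eq_0)
  ultimately show ?thesis
    using sums_zero_iff_shift[of d "\<lambda>r. (t ^ r *\<^sub>R (of_nat (r choose d) * x ^ (r - d))) /\<^sub>R fact r"]
    by simp
qed

lemma mexp_jmat:
  fixes L :: "('a::{real_normed_field,banach} \<times> nat) list"
  assumes L: "position_chain L" "length L = CARD('n)"
  shows "mexp (t *\<^sub>R (jmat L :: 'a^'n^'n)) = (\<chi> i j.
    if idx i \<le> idx j \<and> idx j - idx i \<le> snd (L ! idx i)
    then exp (t *\<^sub>R fst (L ! idx i)) * of_real (t ^ (idx j - idx i) / fact (idx j - idx i)) else 0)"
proof (rule mexp_eqI)
  fix i j
  show "(\<lambda>k. (mpow (t *\<^sub>R (jmat L :: 'a^'n^'n)) k $ i $ j) /\<^sub>R fact k) sums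
    ((\<chi> i j. if idx i \<le> idx j \<and> idx j - idx i \<le> snd (L ! idx i)
    then exp (t *\<^sub>R fst (L ! idx i)) * of_real (t ^ (idx j - idx i) / fact (idx j - idx i)) else 0) $ i $ j)"
    using exp_binomial_sums[of t "idx j - idx i" "fst (L ! idx i)"]
    by (auto simp: mpow_scaleR mpow_jmat[OF L])
qed

lemma jordan_nf_exists_complex:
  fixes X :: "complex Matrix.mat"
  assumes "X \<in> carrier_mat n n"
  shows "\<exists>n_as. jordan_nf X n_as"
  using char_poly_factorized[OF assms] jordan_nf_exists[OF assms] by blast

lemma of_mat_similar:
  fixes X Y :: "'a::comm_ring_1 Matrix.mat"
  assumes "similar_mat X Y" "X \<in> carrier_mat CARD('n) CARD('n)"
  obtains P Q :: "'a^'n^'n" where "P ** Q = mat 1" "Q ** P = mat 1" "of_mat X = P ** of_mat Y ** Q"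
proof -
  obtain P Q where w: "similar_mat_wit X Y P Q" using assms unfolding similar_mat_def by blast
  have n: "CARD('n) = dim_row X" using assms by auto
  note d = similar_mat_witD[OF n w]
  have "(of_mat P :: 'a^'n^'n) ** of_mat Q = mat 1" "(of_mat Q :: 'a^'n^'n) ** of_mat P = mat 1"
    using d by (metis of_mat_mult of_mat_1)+
  moreover have "(of_mat X :: 'a^'n^'n) = of_mat P ** of_mat Y ** of_mat Q"
    using d(3-) by (simp add: of_mat_mult[where 'n = 'n] matrix_mul_assoc)
  ultimately show ?thesis using that by blast
qed

subsection \<open>Decay rates in Jordan coordinates\<close>

lemma position_chain_iter:
  assumes "position_chain L" "p < length L" "d \<le> snd (L ! p)"
  shows "p + d < length L \<and> fst (L ! (p + d)) = fst (L ! p) \<and> snd (L ! (p + d)) = snd (L ! p) - d"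
  using assms(3)
proof (induction d)
  case (Suc d)
  then have IH: "p + d < length L" "fst (L ! (p + d)) = fst (L ! p)" "snd (L ! (p + d)) = snd (L ! p) - d" by auto
  have "snd (L ! (p + d)) > 0" using IH Suc.prems by simp
  with assms(1) IH show ?case unfolding position_chain_def by auto
qed (use assms in auto)

lemma power_le_fact_exp: "x \<ge> 0 \<Longrightarrow> x ^ d \<le> fact d * exp (x::real)"
proof -
  assume x: "x \<ge> 0"
  have "sum (\<lambda>n. x ^ n /\<^sub>R fact n) {d} \<le> (\<Sum>n. x ^ n /\<^sub>R fact n)"
    using x by (intro sum_le_suminf summable_exp_generic) auto
  then have "x ^ d / fact d \<le> exp x" by (simp add: exp_def divide_inverse mult.commute)
  then show ?thesis by (simp add: field_simps)
qed

lemma poly_exp_decay_bound: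
  assumes "\<delta> > 0" "c > 0"
  obtains C where "C > 0" "\<And>t. t \<ge> 0 \<Longrightarrow> (1 + c * t) ^ m * exp (- (\<delta> * t)) \<le> (C::real)"
proof -
  \<comment> \<open>Chosen so that \<open>k * (1 + c * t) = k + \<delta> * t\<close>, to which
    \<open>power_le_fact_exp\<close> applies.\<close>
  define k where "k = \<delta> / c"
  have k: "k > 0" using assms by (simp add: k_def)
  have "(1 + c * t) ^ m * exp (- (\<delta> * t)) \<le> fact m * exp k / k ^ m" if t: "t \<ge> 0" for t
  proof -
    have "(k * (1 + c * t)) ^ m \<le> fact m * exp (k * (1 + c * t))"
      using k t assms by (intro power_le_fact_exp) auto
    also have "k * (1 + c * t) = k + \<delta> * t" using assms by (simp add: k_def field_simps)
    finally have "k ^ m * (1 + c * t) ^ m \<le> fact m * exp (k + \<delta> * t)"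
      by (simp add: \<open>k * (1 + c * t) = k + \<delta> * t\<close>[symmetric] power_mult_distrib)
    then have "(1 + c * t) ^ m \<le> fact m * exp (k + \<delta> * t) / k ^ m" using k by (simp add: field_simps)
    then have "(1 + c * t) ^ m * exp (- (\<delta> * t)) \<le> fact m * exp (k + \<delta> * t) / k ^ m * exp (- (\<delta> * t))"
      by (intro mult_right_mono) auto
    also have "\<dots> = fact m * exp k / k ^ m" by (simp add: exp_add exp_minus)
    finally show ?thesis .
  qed
  moreover have "fact m * exp k / k ^ m > 0" using k by simp
  ultimately show ?thesis using that by blast
qed

text \<open>The leading exponent of a nonzero sum dominates it at infinity.\<close>

lemma polynomial_coeffs_vanish:
  fixes c :: "'b \<Rightarrow> complex"
  assumes fin: "finite S" and inj: "inj_on e S"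
    and bd: "\<And>t::real. t \<ge> 1 \<Longrightarrow> norm (\<Sum>l\<in>S. c l * of_real (t ^ e l)) \<le> h t"
    and h: "\<And>D. D \<ge> m \<Longrightarrow> ((\<lambda>t. h t / t ^ D) \<longlongrightarrow> 0) at_top"
    and l: "l \<in> S" "e l \<ge> m"
  shows "c l = 0"
proof (rule ccontr)
  assume "c l \<noteq> 0"
  define S' where "S' = {l\<in>S. c l \<noteq> 0}"
  have S': "finite S'" "l \<in> S'" using fin l \<open>c l \<noteq> 0\<close> by (auto simp: S'_def)
  \<comment> \<open>The largest exponent with a nonzero coefficient. It is at least \<open>m\<close>
    because \<open>l\<close> competes for it, so \<open>h\<close> is negligible against this
    power.\<close>
  have "Max (e ` S') \<in> e ` S'" by (rule Max_in) (use S' in auto)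
  then obtain k where k: "k \<in> S'" "e k = Max (e ` S')" by auto
  have max: "e i \<le> e k" if "i \<in> S'" for i using that S' k by simp
  have summand: "((\<lambda>t. c i * of_real (t ^ e i / t ^ e k)) \<longlongrightarrow> (if i = k then c k else 0)) at_top" if i: "i \<in> S'" for i
  proof (cases "i = k")
    case True
    have "\<forall>\<^sub>F t in at_top. c k = c i * of_real (t ^ e i / t ^ e k :: real)"
      using eventually_gt_at_top[of 0] by eventually_elim (simp add: True)
    then have "((\<lambda>t. c i * of_real (t ^ e i / t ^ e k)) \<longlongrightarrow> c k) at_top"
      by (rule Lim_transform_eventually[OF tendsto_const])
    then show ?thesis by (simp only: True simp_thms if_True)
  next
    case False
    then have lt: "e i < e k" using max[OF i] i k inj unfolding S'_def inj_on_def by fastforce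
    have "((\<lambda>t::real. inverse (t ^ (e k - e i))) \<longlongrightarrow> 0) at_top"
      by (intro tendsto_inverse_0_at_top filterlim_pow_at_top filterlim_ident) (use lt in simp)
    moreover have "\<forall>\<^sub>F t::real in at_top. inverse (t ^ (e k - e i)) = t ^ e i / t ^ e k"
      using eventually_gt_at_top[of 0] by eventually_elim (use lt in \<open>simp add: power_diff field_simps\<close>)
    ultimately have "((\<lambda>t::real. t ^ e i / t ^ e k) \<longlongrightarrow> 0) at_top" by (rule Lim_transform_eventually)
    then have "((\<lambda>t. c i * of_real (t ^ e i / t ^ e k)) \<longlongrightarrow> c i * of_real 0) at_top" by (intro tendsto_intros)
    with False show ?thesis by simp
  qed
  have "((\<lambda>t. \<Sum>i\<in>S'. c i * of_real (t ^ e i / t ^ e k)) \<longlongrightarrow> (\<Sum>i\<in>S'. if i = k then c k else 0)) at_top"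
    by (intro tendsto_sum summand)
  then have lim: "((\<lambda>t. \<Sum>i\<in>S'. c i * of_real (t ^ e i / t ^ e k)) \<longlongrightarrow> c k) at_top"
    using S' k by simp
  have "((\<lambda>t. h t / t ^ e k) \<longlongrightarrow> 0) at_top"
    by (intro h) (use max[OF S'(2)] l in simp)
  moreover have "\<forall>\<^sub>F t in at_top. norm (\<Sum>i\<in>S'. c i * of_real (t ^ e i / t ^ e k)) \<le> h t / t ^ e k"
    using eventually_ge_at_top[of 1]
  proof eventually_elim
    case (elim t)
    have "(\<Sum>i\<in>S'. c i * of_real (t ^ e i / t ^ e k)) = (\<Sum>i\<in>S'. c i * of_real (t ^ e i)) / of_real (t ^ e k)"
      by (simp add: sum_divide_distrib)
    also have "(\<Sum>i\<in>S'. c i * of_real (t ^ e i)) = (\<Sum>i\<in>S. c i * of_real (t ^ e i))"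
      using fin unfolding S'_def by (intro sum.mono_neutral_left) auto
    finally have "norm (\<Sum>i\<in>S'. c i * of_real (t ^ e i / t ^ e k)) = norm (\<Sum>i\<in>S. c i * of_real (t ^ e i)) / t ^ e k"
      using elim by (simp add: norm_divide norm_power)
    also have "\<dots> \<le> h t / t ^ e k" using bd[OF elim] elim by (intro divide_right_mono) auto
    finally show ?case .
  qed
  ultimately have "((\<lambda>t. \<Sum>i\<in>S'. c i * of_real (t ^ e i / t ^ e k)) \<longlongrightarrow> 0) at_top"
    by (rule Lim_null_comparison[rotated])
  with lim have "c k = 0" using tendsto_unique trivial_limit_at_top_linorder by blast
  with k show False by (simp add: S'_def)
qed

text \<open>The positions whose coordinate covector is
  \<open>O (exp (- (\<rho> * t)) * (1 + t) ^ m)\<close> under the transposed flow: row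
  \<open>p\<close> of the exponential of \<open>- t\<close> times the Jordan matrix has order
  \<open>exp (- (t * Re \<mu>)) * t ^ k\<close>, where \<open>k\<close> positions follow
  \<open>p\<close> in its block.\<close>

definition slow_positions :: "(complex \<times> nat) list \<Rightarrow> real \<Rightarrow> nat \<Rightarrow> nat set" where
  "slow_positions L \<rho> m = {p. p < length L \<and> (Re (fst (L ! p)) > \<rho> \<or> Re (fst (L ! p)) = \<rho> \<and> snd (L ! p) \<le> m)}"

definition jexp :: "(complex \<times> nat) list \<Rightarrow> real \<Rightarrow> complex^'n^'n" where
  "jexp L t = mexp (t *\<^sub>R jmat L)"

lemma jexp_entry:
  fixes i j :: "'n::finite"
  assumes "position_chain L" "length L = CARD('n)"
  shows "jexp L t $ i $ j = (if idx i \<le> idx j \<and> idx j - idx i \<le> snd (L ! idx i)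
    then exp (t *\<^sub>R fst (L ! idx i)) * of_real (t ^ (idx j - idx i) / fact (idx j - idx i)) else 0)"
  unfolding jexp_def mexp_jmat[OF assms] by simp

lemma norm_jexp_entry_le:
  fixes i j :: "'n::finite"
  assumes L: "position_chain L" "length L = CARD('n)" and t: "t \<ge> 0"
  shows "norm ((jexp L (- t) :: complex^'n^'n) $ i $ j) \<le> exp (- (Re (fst (L ! idx i)) * t)) * (1 + t) ^ snd (L ! idx i)"
proof (cases "idx i \<le> idx j \<and> idx j - idx i \<le> snd (L ! idx i)")
  case True
  let ?d = "idx j - idx i"
  have "norm ((jexp L (- t) :: complex^'n^'n) $ i $ j) = exp (- (Re (fst (L ! idx i)) * t)) * (t ^ ?d / fact ?d)"
    using True t by (simp add: jexp_entry[OF L] norm_mult norm_power norm_divide mult.commute)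
  also have "t ^ ?d / fact ?d \<le> t ^ ?d" using t by (simp add: divide_le_eq fact_ge_1 mult_le_cancel_left1)
  also have "t ^ ?d \<le> (1 + t) ^ ?d" using t by (intro power_mono) auto
  also have "\<dots> \<le> (1 + t) ^ snd (L ! idx i)" using t True by (intro power_increasing) auto
  finally show ?thesis by simp
next
  case False
  then have "(jexp L (- t) :: complex^'n^'n) $ i $ j = 0" by (simp only: jexp_entry[OF L] if_False)
  then show ?thesis using t by simp
qed

lemma norm_vec_le_component_sum:
  fixes x :: "'a::real_normed_vector^'n"
  shows "norm x \<le> (\<Sum>i\<in>UNIV. norm (x $ i))"
  by (simp add: norm_vec_def L2_set_le_sum)

lemma linear_complex_matrix: "linear (\<lambda>z. (X :: complex^'n^'m) *v z)"
  by (rule linearI) (auto simp: matrix_vector_mult_def Finite_Cartesian_Product.vec_eq_iff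
      sum.distrib ring_distribs scaleR_sum_right)

lemma matrix_vector_bounded_complex:
  fixes X :: "complex^'n^'m"
  obtains B where "B > 0" "\<And>v. norm (X *v v) \<le> B * norm v"
  using linear_bounded_pos[OF linear_complex_matrix[of X]] by auto

text \<open>The bound for coordinate covectors is immediate from the entries. Conversely, the last
  column of a block gathers the coordinates of that block into a polynomial with distinct exponents,
  so cancellation cannot hide a coordinate that decays too slowly.\<close>

lemma jexp_transpose_decay:
  fixes w :: "complex^'n"
  assumes L: "position_chain L" "length L = CARD('n)" and c: "c > 0"
  shows "(\<exists>C. \<forall>t\<ge>0. norm (transpose (jexp L (- t)) *v w) \<le> C * (exp (- (\<rho> * t)) * (1 + c * t) ^ m)) \<longleftrightarrow>
    (\<forall>l. idx l \<notin> slow_positions L \<rho> m \<longrightarrow> w $ l = 0)" (is "?lhs \<longleftrightarrow> ?rhs")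
proof
  assume ?rhs
  \<comment> \<open>Compares \<open>1 + t\<close> with \<open>1 + c * t\<close>; its powers go into
    the constants.\<close>
  define B where "B = max 1 (1 / c)"
  have B: "B \<ge> 1" "(1 + t) \<le> B * (1 + c * t)" if "t \<ge> 0" for t
  proof -
    have "1 * 1 \<le> B * 1" "1 / c * (c * t) \<le> B * (c * t)"
      unfolding B_def using c that by (intro mult_right_mono; simp)+
    then show "(1 + t) \<le> B * (1 + c * t)" using c by (simp add: algebra_simps)
  qed (simp add: B_def)
  have "\<exists>C\<ge>0. \<forall>t\<ge>0. exp (- (Re (fst (L ! idx l)) * t)) * (1 + t) ^ snd (L ! idx l) * norm (w $ l) \<le> C * (exp (- (\<rho> * t)) * (1 + c * t) ^ m)" for l
  proof (cases "w $ l = 0")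
    case False
    let ?r = "Re (fst (L ! idx l))" let ?k = "snd (L ! idx l)"
    have "idx l \<in> slow_positions L \<rho> m" using \<open>?rhs\<close> False by blast
    then consider "?r > \<rho>" | "?r = \<rho>" "?k \<le> m" unfolding slow_positions_def by blast
    then show ?thesis
    proof cases
      case 1
      then have "?r - \<rho> > 0" by simp
      then obtain C where C: "C > 0" "\<And>t. t \<ge> 0 \<Longrightarrow> (1 + 1 * t) ^ ?k * exp (- ((?r - \<rho>) * t)) \<le> C"
        using poly_exp_decay_bound[of "?r - \<rho>" 1 ?k] by auto
      have "exp (- (?r * t)) * (1 + t) ^ ?k * norm (w $ l) \<le> (C * norm (w $ l)) * (exp (- (\<rho> * t)) * (1 + c * t) ^ m)"
        if t: "t \<ge> 0" for t
      proof -
        have "exp (- (?r * t)) = exp (- ((?r - \<rho>) * t)) * exp (- (\<rho> * t))"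
          by (simp add: left_diff_distrib flip: exp_add)
        then have "exp (- (?r * t)) * (1 + t) ^ ?k * norm (w $ l) = ((1 + 1 * t) ^ ?k * exp (- ((?r - \<rho>) * t))) * (norm (w $ l) * exp (- (\<rho> * t)))"
          by simp
        also have "\<dots> \<le> C * (norm (w $ l) * exp (- (\<rho> * t)))" using C(2)[OF t] by (intro mult_right_mono) auto
        also have "\<dots> \<le> C * (norm (w $ l) * exp (- (\<rho> * t))) * (1 + c * t) ^ m"
          using mult_left_mono[of 1 "(1 + c * t) ^ m" "C * (norm (w $ l) * exp (- (\<rho> * t)))"] C c t
          by (simp add: one_le_power)
        finally show ?thesis by (simp add: mult_ac)
      qed
      then show ?thesis using C by (intro exI[of _ "C * norm (w $ l)"]) auto
    next
      case 2
      have "exp (- (?r * t)) * (1 + t) ^ ?k * norm (w $ l) \<le> (B ^ m * norm (w $ l)) * (exp (- (\<rho> * t)) * (1 + c * t) ^ m)"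
        if t: "t \<ge> 0" for t
      proof -
        have "(1 + t) ^ ?k \<le> (1 + t) ^ m" using 2 t by (intro power_increasing) auto
        also have "\<dots> \<le> (B * (1 + c * t)) ^ m" using B t by (intro power_mono) auto
        finally have "(1 + t) ^ ?k * (exp (- (?r * t)) * norm (w $ l)) \<le> (B * (1 + c * t)) ^ m * (exp (- (?r * t)) * norm (w $ l))"
          by (intro mult_right_mono) auto
        then show ?thesis using 2 by (simp add: power_mult_distrib mult_ac)
      qed
      then show ?thesis using B[of 0] by (intro exI[of _ "B ^ m * norm (w $ l)"]) auto
    qed
  qed (auto intro: exI[of _ 0])
  then obtain C where C: "\<And>l. C l \<ge> 0" "\<And>l t. t \<ge> 0 \<Longrightarrow>
    exp (- (Re (fst (L ! idx l)) * t)) * (1 + t) ^ snd (L ! idx l) * norm (w $ l) \<le> C l * (exp (- (\<rho> * t)) * (1 + c * t) ^ m)"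
    by metis
  have "norm (transpose (jexp L (- t)) *v w) \<le> (\<Sum>j\<in>(UNIV::'n set). \<Sum>l\<in>UNIV. C l) * (exp (- (\<rho> * t)) * (1 + c * t) ^ m)"
    if t: "t \<ge> 0" for t
  proof -
    have "norm (transpose (jexp L (- t)) *v w) \<le> (\<Sum>j\<in>UNIV. norm ((transpose (jexp L (- t)) *v w) $ j))"
      by (rule norm_vec_le_component_sum)
    also have "\<dots> \<le> (\<Sum>j\<in>(UNIV::'n set). \<Sum>l\<in>UNIV. C l * (exp (- (\<rho> * t)) * (1 + c * t) ^ m))"
    proof (intro sum_mono)
      fix j
      have "(transpose (jexp L (- t)) *v w) $ j = (\<Sum>l\<in>UNIV. (jexp L (- t) :: complex^'n^'n) $ l $ j * w $ l)"
        by (simp add: matrix_vector_mult_def Finite_Cartesian_Product.transpose_def del: transpose_matrix_vector)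
      also have "norm \<dots> \<le> (\<Sum>l\<in>UNIV. norm ((jexp L (- t) :: complex^'n^'n) $ l $ j * w $ l))" by (rule norm_sum)
      also have "\<dots> \<le> (\<Sum>l\<in>UNIV. C l * (exp (- (\<rho> * t)) * (1 + c * t) ^ m))"
        unfolding norm_mult
        by (intro sum_mono order_trans[OF mult_right_mono[OF norm_jexp_entry_le[OF L t]] C(2)[OF t]]) auto
      finally show "norm ((transpose (jexp L (- t)) *v w) $ j) \<le> (\<Sum>l\<in>UNIV. C l * (exp (- (\<rho> * t)) * (1 + c * t) ^ m))" .
    qed
    also have "\<dots> = (\<Sum>j\<in>(UNIV::'n set). \<Sum>l\<in>UNIV. C l) * (exp (- (\<rho> * t)) * (1 + c * t) ^ m)"
      by (simp add: sum_distrib_right)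
    finally show ?thesis .
  qed
  then show ?lhs by blast
next
  assume ?lhs
  then obtain C where C: "\<And>t. t \<ge> 0 \<Longrightarrow> norm (transpose (jexp L (- t)) *v w) \<le> C * (exp (- (\<rho> * t)) * (1 + c * t) ^ m)"
    by blast
  show ?rhs
  proof (intro allI impI)
    fix l0 :: 'n assume l0: "idx l0 \<notin> slow_positions L \<rho> m"
    let ?r = "Re (fst (L ! idx l0))" let ?k = "snd (L ! idx l0)"
    have len: "idx l < length L" for l :: 'n by (simp add: L)
    note ch = position_chain_iter[OF L(1) len]
    \<comment> \<open>The last position of the block of \<open>l0\<close>. In its column the
      position \<open>l\<close> of the block contributes the power
      \<open>t ^ snd (L ! idx l)\<close>.\<close>
    obtain j where j: "idx (j::'n) = idx l0 + ?k" using ch[of ?k l0] idx_surj L(2) by (metis order_refl)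
    have Lj: "fst (L ! idx j) = fst (L ! idx l0)" "snd (L ! idx j) = 0" using ch[of ?k l0] j by auto
    define S where "S = {l::'n. idx l + snd (L ! idx l) = idx j}"
    have inS: "idx l \<le> idx j \<and> idx j - idx l \<le> snd (L ! idx l) \<longleftrightarrow> l \<in> S" for l
    proof
      assume a: "idx l \<le> idx j \<and> idx j - idx l \<le> snd (L ! idx l)"
      then have "snd (L ! idx j) = snd (L ! idx l) - (idx j - idx l)" using ch[of "idx j - idx l" l] by simp
      with a Lj show "l \<in> S" by (simp add: S_def)
    qed (auto simp: S_def)
    have Sfst: "fst (L ! idx l) = fst (L ! idx l0)" if "l \<in> S" for l
      using ch[of "snd (L ! idx l)" l] that Lj by (simp add: S_def)
    define a where "a l = w $ l * (of_real ((- 1) ^ snd (L ! idx l) / fact (snd (L ! idx l))))" for l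
    \<comment> \<open>What is left of the assumed bound after division by the common exponential of
      the block. That \<open>l0\<close> is outside \<open>slow_positions\<close> makes it negligible
      against \<open>t ^ D\<close> for \<open>D \<ge> ?k\<close>.\<close>
    define h where "h t = \<bar>C\<bar> * (exp (- ((\<rho> - ?r) * t)) * (1 + c * t) ^ m)" for t :: real
    have "a l0 = 0"
    proof (rule polynomial_coeffs_vanish[where S = S and e = "\<lambda>l. snd (L ! idx l)" and h = h and m = ?k])
      show "finite S" by simp
      show "inj_on (\<lambda>l. snd (L ! idx l)) S"
        by (rule inj_onI) (metis (mono_tags, lifting) S_def add_right_cancel idx_eq_iff mem_Collect_eq)
      show "l0 \<in> S" by (simp add: S_def j)
      show "norm (\<Sum>l\<in>S. a l * of_real (t ^ snd (L ! idx l))) \<le> h t" if "t \<ge> 1" for t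
      proof -
        have t: "t \<ge> 0" using that by simp
        have "(transpose (jexp L (- t)) *v w) $ j = (\<Sum>l\<in>UNIV. (jexp L (- t) :: complex^'n^'n) $ l $ j * w $ l)"
          by (simp add: matrix_vector_mult_def Finite_Cartesian_Product.transpose_def del: transpose_matrix_vector)
        also have "\<dots> = (\<Sum>l\<in>S. (jexp L (- t) :: complex^'n^'n) $ l $ j * w $ l)"
          by (intro sum.mono_neutral_right) (auto simp: jexp_entry[OF L] inS)
        also have "\<dots> = (\<Sum>l\<in>S. exp ((- t) *\<^sub>R fst (L ! idx l0)) * (a l * of_real (t ^ snd (L ! idx l))))"
        proof (intro sum.cong refl)
          fix l assume l: "l \<in> S"
          then have "idx j - idx l = snd (L ! idx l)" "idx l \<le> idx j" by (auto simp: S_def)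
          then show "(jexp L (- t) :: complex^'n^'n) $ l $ j * w $ l = exp ((- t) *\<^sub>R fst (L ! idx l0)) * (a l * of_real (t ^ snd (L ! idx l)))"
            using Sfst[OF l] by (simp add: jexp_entry[OF L] a_def power_minus[of t] power_minus[of "of_real t"])
        qed
        finally have "norm ((transpose (jexp L (- t)) *v w) $ j) = exp (- (?r * t)) * norm (\<Sum>l\<in>S. a l * of_real (t ^ snd (L ! idx l)))"
          by (simp only: sum_distrib_left[symmetric] norm_mult norm_exp_eq_Re) (simp add: mult.commute)
        moreover have "norm ((transpose (jexp L (- t)) *v w) $ j) \<le> \<bar>C\<bar> * (exp (- (\<rho> * t)) * (1 + c * t) ^ m)"
        proof -
          have "norm ((transpose (jexp L (- t)) *v w) $ j) \<le> norm (transpose (jexp L (- t)) *v w)"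
            by (rule Finite_Cartesian_Product.norm_nth_le)
          also have "\<dots> \<le> C * (exp (- (\<rho> * t)) * (1 + c * t) ^ m)" by (rule C[OF t])
          also have "\<dots> \<le> \<bar>C\<bar> * (exp (- (\<rho> * t)) * (1 + c * t) ^ m)" using c t by (intro mult_right_mono) auto
          finally show ?thesis .
        qed
        ultimately have "exp (?r * t) * (exp (- (?r * t)) * norm (\<Sum>l\<in>S. a l * of_real (t ^ snd (L ! idx l)))) \<le> exp (?r * t) * (\<bar>C\<bar> * (exp (- (\<rho> * t)) * (1 + c * t) ^ m))"
          by (intro mult_left_mono) auto
        moreover have "exp (?r * t) * exp (- (?r * t)) = 1" by (simp add: exp_minus)
        moreover have "exp (?r * t) * (\<bar>C\<bar> * (exp (- (\<rho> * t)) * (1 + c * t) ^ m)) = h t"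
          unfolding h_def by (simp add: left_diff_distrib exp_diff exp_minus field_simps)
        ultimately show ?thesis by (simp add: mult.assoc[symmetric])
      qed
      show "((\<lambda>t. h t / t ^ D) \<longlongrightarrow> 0) at_top" if D: "D \<ge> ?k" for D
      proof (cases "?r < \<rho>")
        case True
        define \<delta> where "\<delta> = (\<rho> - ?r) / 2"
        have \<delta>: "\<delta> > 0" using True by (simp add: \<delta>_def)
        obtain K where K: "K > 0" "\<And>t. t \<ge> 0 \<Longrightarrow> (1 + c * t) ^ m * exp (- (\<delta> * t)) \<le> K"
          using poly_exp_decay_bound[OF \<delta> c] by blast
        show ?thesis
        proof (rule Lim_null_comparison)
          show "((\<lambda>t. \<bar>C\<bar> * K * exp (- (\<delta> * t))) \<longlongrightarrow> 0) at_top" using \<delta> by real_asymp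
          show "\<forall>\<^sub>F t in at_top. norm (h t / t ^ D) \<le> \<bar>C\<bar> * K * exp (- (\<delta> * t))"
            using eventually_ge_at_top[of 1]
          proof eventually_elim
            case (elim t)
            have h0: "h t \<ge> 0" unfolding h_def using c elim by simp
            have e2: "exp (- ((\<rho> - ?r) * t)) = exp (- (\<delta> * t)) * exp (- (\<delta> * t))"
              by (simp add: \<delta>_def flip: exp_add)
            have "norm (h t / t ^ D) = h t / t ^ D" using h0 elim by simp
            also have "\<dots> \<le> h t / 1" using h0 elim by (intro divide_left_mono) (auto simp: one_le_power)
            also have "\<dots> = \<bar>C\<bar> * ((1 + c * t) ^ m * exp (- (\<delta> * t))) * exp (- (\<delta> * t))"
              unfolding h_def e2 by simp
            also have "\<dots> \<le> \<bar>C\<bar> * K * exp (- (\<delta> * t))" using K(2)[of t] elim by (intro mult_right_mono mult_left_mono) auto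
            finally show ?case .
          qed
        qed
      next
        case False
        then have r: "?r = \<rho>" "?k > m" using l0 len by (auto simp: slow_positions_def)
        then have mD: "m < D" using D by simp
        have "((\<lambda>t::real. inverse t + c) \<longlongrightarrow> 0 + c) at_top"
          by (intro tendsto_intros tendsto_inverse_0_at_top filterlim_ident)
        moreover have "((\<lambda>t::real. inverse (t ^ (D - m))) \<longlongrightarrow> 0) at_top"
          by (intro tendsto_inverse_0_at_top filterlim_pow_at_top filterlim_ident) (use mD in simp)
        ultimately have "((\<lambda>t::real. \<bar>C\<bar> * ((inverse t + c) ^ m * inverse (t ^ (D - m)))) \<longlongrightarrow> \<bar>C\<bar> * ((0 + c) ^ m * 0)) at_top"
          by (intro tendsto_mult tendsto_const tendsto_power)
        then have "((\<lambda>t::real. \<bar>C\<bar> * ((inverse t + c) ^ m * inverse (t ^ (D - m)))) \<longlongrightarrow> 0) at_top" by simp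
        moreover have "\<forall>\<^sub>F t in at_top. \<bar>C\<bar> * ((inverse t + c) ^ m * inverse (t ^ (D - m))) = h t / t ^ D"
          using eventually_gt_at_top[of 0]
        proof eventually_elim
          case (elim t)
          have "inverse t + c = (1 + c * t) / t" using elim by (simp add: field_simps)
          moreover have "t ^ D = t ^ m * t ^ (D - m)" using mD by (simp flip: power_add)
          ultimately show ?case using r by (simp add: h_def divide_inverse power_mult_distrib power_inverse)
        qed
        ultimately show ?thesis by (rule Lim_transform_eventually)
      qed
    qed simp
    then show "w $ l0 = 0" by (simp add: a_def)
  qed
qed

text \<open>The same \<open>SOME\<close> term as in \<open>real_part_jordan_form\<close>, so that
  counts made for this list speak about that form.\<close>

definition jordan_list :: "real^'n^'n \<Rightarrow> (nat \<times> complex) list" where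
  "jordan_list A = (SOME n_as. jordan_nf (complex_mat A) n_as)"

abbreviation jpos :: "real^'n^'n \<Rightarrow> (complex \<times> nat) list" where
  "jpos A \<equiv> jordan_positions (jordan_list A)"

lemma complex_mat_carrier: "complex_mat (A :: real^'n^'n) \<in> carrier_mat CARD('n) CARD('n)"
  by (simp add: complex_mat_def)

lemma jordan_nf_jordan_list: "jordan_nf (complex_mat A) (jordan_list A)"
  unfolding jordan_list_def
  using jordan_nf_exists_complex[OF complex_mat_carrier] by (rule someI_ex)

lemma similar_jordan_list: "similar_mat (complex_mat A) (jordan_matrix (jordan_list A))"
  using jordan_nf_jordan_list[of A] by (simp add: jordan_nf_def)

lemma sum_list_jordan_list: "sum_list (map fst (jordan_list (A :: real^'n^'n))) = CARD('n)"
proof -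
  obtain n P Q where "{complex_mat A, jordan_matrix (jordan_list A), P, Q} \<subseteq> carrier_mat n n"
    using similar_matD[OF similar_jordan_list[of A]] by blast
  then have "dim_row (complex_mat A) = dim_row (jordan_matrix (jordan_list A))" by auto
  then show ?thesis using complex_mat_carrier[of A] by simp
qed

lemma jpos_chain: "position_chain (jpos A)" "length (jpos (A :: real^'n^'n)) = CARD('n)"
  by (simp_all add: position_chain_jordan sum_list_jordan_list)

lemma matrix_exp_jordan:
  fixes A :: "real^'n^'n"
  obtains P Q :: "complex^'n^'n" where "P ** Q = mat 1" "Q ** P = mat 1"
    "\<And>t. cmat (matrix_exp (t *\<^sub>R A)) = P ** jexp (jpos A) t ** Q"
proof -
  obtain P Q :: "complex^'n^'n" where PQ: "P ** Q = mat 1" "Q ** P = mat 1"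
    and eq: "of_mat (complex_mat A) = P ** of_mat (jordan_matrix (jordan_list A)) ** Q"
    by (rule of_mat_similar[OF similar_jordan_list complex_mat_carrier])
  have "cmat (matrix_exp (t *\<^sub>R A)) = P ** jexp (jpos A) t ** Q" for t
  proof -
    have "cmat (matrix_exp (t *\<^sub>R A)) = mexp (t *\<^sub>R cmat A)"
      by (simp add: matrix_exp_eq_mexp mexp_cmat[symmetric] cmat_scaleR)
    also have "t *\<^sub>R cmat A = P ** (t *\<^sub>R jmat (jpos A)) ** Q"
      using eq by (simp add: of_mat_complex_mat of_mat_jordan_matrix[OF sum_list_jordan_list]
          Finite_Cartesian_Product.vec_eq_iff matrix_mult3_entry scaleR_sum_right)
    also have "mexp \<dots> = P ** jexp (jpos A) t ** Q"
      unfolding jexp_def by (rule mexp_conj[OF PQ(2,1)])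
    finally show ?thesis .
  qed
  with PQ that show ?thesis by blast
qed

lemma jordan_position_in_list:
  "x \<in> set (jordan_positions xs) \<longleftrightarrow> (\<exists>k a. (k, a) \<in> set xs \<and> fst x = a \<and> snd x < k)"
proof (induction xs)
  case (Cons y ys)
  obtain k a where y: "y = (k, a)" by (cases y)
  have "x \<in> (\<lambda>i. (a, k - Suc i)) ` {0..<k} \<longleftrightarrow> fst x = a \<and> snd x < k"
  proof
    assume "fst x = a \<and> snd x < k"
    then show "x \<in> (\<lambda>i. (a, k - Suc i)) ` {0..<k}"
      by (intro image_eqI[of _ _ "k - Suc (snd x)"]) (auto simp: prod_eq_iff)
  qed auto
  then show ?case using Cons by (auto simp: y)
qed simp

lemma jpos_positive:
  fixes A :: "real^'n^'n"
  assumes "positive_real_parts A" "p < CARD('n)"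
  shows "Re (fst (jpos A ! p)) > 0"
proof -
  have "jpos A ! p \<in> set (jpos A)" using assms(2) jpos_chain(2)[of A] by (intro nth_mem) simp
  then obtain k where k: "(k, fst (jpos A ! p)) \<in> set (jordan_list A)" "k > 0"
    unfolding jordan_position_in_list by auto
  have "poly (char_poly (complex_mat A)) (fst (jpos A ! p)) = 0"
    unfolding jordan_nf_char_poly[OF jordan_nf_jordan_list] poly_prod_list prod_list_zero_iff
    using k by (force simp: image_iff)
  then have "eigenvalue (complex_mat A) (fst (jpos A ! p))"
    using eigenvalue_root_char_poly[OF complex_mat_carrier] by blast
  with assms(1) show ?thesis by (simp add: positive_real_parts_def)
qed

text \<open>Splits a complex vector into real and imaginary part, on which a real matrix acts
  separately.\<close>

definition cpair :: "(real^'n) \<times> (real^'n) \<Rightarrow> complex^'n" where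
  "cpair p = (\<chi> i. Complex (fst p $ i) (snd p $ i))"

lemma cpair_mult: "cmat X *v cpair (x, y) = cpair (X *v x, X *v y)"
  by (simp add: cmat_def cpair_def matrix_vector_mult_def Finite_Cartesian_Product.vec_eq_iff complex_eq_iff)

lemma transpose_cmat: "transpose (cmat X) = cmat (transpose X)"
  by (simp add: cmat_def Finite_Cartesian_Product.transpose_def)

lemma norm_cpair: "norm x \<le> norm (cpair (x, y))" "norm y \<le> norm (cpair (x, y))" "norm (cpair (x, y)) \<le> norm x + norm y"
proof -
  show "norm x \<le> norm (cpair (x, y))" "norm y \<le> norm (cpair (x, y))"
    unfolding norm_vec_def by (intro L2_set_mono; simp add: cpair_def cmod_def real_le_rsqrt)+
  have "norm (cpair (x, y)) \<le> L2_set (\<lambda>i. norm (x $ i) + norm (y $ i)) UNIV"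
    unfolding norm_vec_def
  proof (intro L2_set_mono)
    show "norm (cpair (x, y) $ i) \<le> norm (x $ i) + norm (y $ i)" for i
      using cmod_le[of "Complex (x $ i) (y $ i)"] by (simp add: cpair_def)
  qed simp
  also have "\<dots> \<le> norm x + norm y" unfolding norm_vec_def by (rule L2_set_triangle_ineq)
  finally show "norm (cpair (x, y)) \<le> norm x + norm y" .
qed

lemma linear_cpair: "linear cpair"
  by (rule linearI) (auto simp: cpair_def Finite_Cartesian_Product.vec_eq_iff complex_eq_iff)

text \<open>\<open>dim\<close> is the dimension over the reals, hence 2 for each complex
  coordinate.\<close>

lemma dim_coordinate_subspace:
  "dim {y::complex^'n. \<forall>l. l \<notin> I \<longrightarrow> y $ l = 0} = 2 * card I"
proof -
  define d :: "(complex^'n) set" where "d = (\<lambda>(i, u). axis i u) ` (I \<times> Basis)"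
  have d: "d \<subseteq> Basis" unfolding d_def by (auto simp: Basis_vec_def)
  have "{y::complex^'n. \<forall>l. l \<notin> I \<longrightarrow> y $ l = 0} = {y. \<forall>b\<in>Basis. b \<notin> d \<longrightarrow> y \<bullet> b = 0}"
  proof (intro Set.set_eqI iffI; clarify)
    fix y :: "complex^'n" and b assume y: "\<forall>l. l \<notin> I \<longrightarrow> y $ l = 0" and b: "b \<in> Basis" "b \<notin> d"
    then obtain i u where iu: "b = axis i u" "u \<in> Basis" by (auto simp: Basis_vec_def)
    with b have "i \<notin> I" by (auto simp: d_def)
    with y iu show "y \<bullet> b = 0" by (simp add: inner_axis)
  next
    fix y :: "complex^'n" and l assume y: "\<forall>b\<in>Basis. b \<notin> d \<longrightarrow> y \<bullet> b = 0" and l: "l \<notin> I"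
    have "y $ l \<bullet> u = 0" if u: "u \<in> Basis" for u
    proof -
      have "axis l u \<notin> d" using l u by (auto simp: d_def axis_eq_axis)
      moreover have "axis l u \<in> Basis" using u by (auto simp: Basis_vec_def)
      ultimately have "y \<bullet> axis l u = 0" using y by blast
      then show ?thesis by (simp add: inner_axis)
    qed
    then show "y $ l = 0" using euclidean_all_zero_iff[of "y $ l"] by blast
  qed
  moreover have "card d = card (I \<times> (Basis :: complex set))" unfolding d_def
    by (intro card_image inj_onI) (auto simp: axis_eq_axis)
  ultimately show ?thesis using dim_substandard[OF d] by (simp add: card_cartesian_product)
qed

text \<open>The decay space of a power-logarithm gauge, expressed in time. The constant
  \<open>c\<close> keeps the trace that enters through the logarithm of the determinant.\<close>

definition decay_vectors :: "(real \<Rightarrow> real^'n^'n) \<Rightarrow> real \<Rightarrow> real \<Rightarrow> nat \<Rightarrow> (real^'n) set" where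
  "decay_vectors M \<rho> c m = {\<xi>. \<exists>C. \<forall>t\<ge>0. norm (transpose (M (- t)) *v \<xi>) \<le> C * (exp (- (\<rho> * t)) * (1 + c * t) ^ m)}"

text \<open>The complex covectors with the same decay become a coordinate subspace under
  \<open>transpose P\<close>, of real dimension twice the count. They are also exactly the covectors
  with real and imaginary part in \<open>?S\<close>, so this dimension is twice that of
  \<open>?S\<close>.\<close>

lemma dim_decay_vectors:
  fixes A :: "real^'n^'n"
  assumes c: "c > 0"
  shows "dim (decay_vectors (\<lambda>t. matrix_exp (t *\<^sub>R A)) \<rho> c m) = card (slow_positions (jpos A) \<rho> m)"
proof -
  let ?L = "jpos A" and ?M = "\<lambda>t. matrix_exp (t *\<^sub>R A)" and ?g = "\<lambda>t. exp (- (\<rho> * t)) * (1 + c * t) ^ m"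
  let ?S = "decay_vectors ?M \<rho> c m"
  have g: "?g t \<ge> 0" if "t \<ge> 0" for t using c that by simp
  obtain P Q :: "complex^'n^'n" where PQ: "P ** Q = mat 1" "Q ** P = mat 1"
    and M: "\<And>t. cmat (?M t) = P ** jexp ?L t ** Q"
    by (rule matrix_exp_jordan[of A], rule that)
  define I where "I = {l::'n. idx l \<in> slow_positions ?L \<rho> m}"
  have tr: "transpose P *v (transpose Q *v z) = z" "transpose Q *v (transpose P *v z) = z" for z
    using PQ by (simp_all add: matrix_vector_mul_assoc matrix_transpose_mul[symmetric] transpose_mat del: transpose_matrix_vector)
  obtain BP where BP: "BP > 0" "\<And>v. norm (transpose P *v v) \<le> BP * norm v" using matrix_vector_bounded_complex by blast
  obtain BQ where BQ: "BQ > 0" "\<And>v. norm (transpose Q *v v) \<le> BQ * norm v" using matrix_vector_bounded_complex by blast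
  define T where "T = {z. \<exists>C. \<forall>t\<ge>0. norm (transpose (cmat (?M (- t))) *v z) \<le> C * ?g t}"
  have Mt: "transpose (cmat (?M t)) *v z = transpose Q *v (transpose (jexp ?L t) *v (transpose P *v z))" for t z
    by (simp only: M matrix_transpose_mul matrix_vector_mul_assoc matrix_mul_assoc)
  have T_iff: "z \<in> T \<longleftrightarrow> (\<forall>l. l \<notin> I \<longrightarrow> (transpose P *v z) $ l = 0)" for z
  proof -
    have "z \<in> T \<longleftrightarrow> (\<exists>C. \<forall>t\<ge>0. norm (transpose (jexp ?L (- t)) *v (transpose P *v z)) \<le> C * ?g t)"
    proof
      assume "z \<in> T"
      then obtain C where C: "\<And>t. t \<ge> 0 \<Longrightarrow> norm (transpose (cmat (?M (- t))) *v z) \<le> C * ?g t" unfolding T_def by blast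
      have "norm (transpose (jexp ?L (- t)) *v (transpose P *v z)) \<le> (BP * C) * ?g t" if t: "t \<ge> 0" for t
      proof -
        have "norm (transpose (jexp ?L (- t)) *v (transpose P *v z)) = norm (transpose P *v (transpose (cmat (?M (- t))) *v z))"
          by (simp only: Mt tr)
        also have "\<dots> \<le> BP * norm (transpose (cmat (?M (- t))) *v z)" by (rule BP)
        also have "\<dots> \<le> BP * (C * ?g t)" using C[OF t] BP by (intro mult_left_mono) auto
        finally show ?thesis by (simp only: mult.assoc)
      qed
      then show "\<exists>C. \<forall>t\<ge>0. norm (transpose (jexp ?L (- t)) *v (transpose P *v z)) \<le> C * ?g t" by blast
    next
      assume "\<exists>C. \<forall>t\<ge>0. norm (transpose (jexp ?L (- t)) *v (transpose P *v z)) \<le> C * ?g t"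
      then obtain C where C: "\<And>t. t \<ge> 0 \<Longrightarrow> norm (transpose (jexp ?L (- t)) *v (transpose P *v z)) \<le> C * ?g t" by blast
      have "norm (transpose (cmat (?M (- t))) *v z) \<le> (BQ * C) * ?g t" if t: "t \<ge> 0" for t
      proof -
        have "norm (transpose (cmat (?M (- t))) *v z) \<le> BQ * norm (transpose (jexp ?L (- t)) *v (transpose P *v z))"
          unfolding Mt by (rule BQ)
        also have "\<dots> \<le> BQ * (C * ?g t)" using C[OF t] BQ by (intro mult_left_mono) auto
        finally show ?thesis by (simp only: mult.assoc)
      qed
      then show "z \<in> T" unfolding T_def by blast
    qed
    also have "\<dots> \<longleftrightarrow> (\<forall>l. l \<notin> I \<longrightarrow> (transpose P *v z) $ l = 0)"
      unfolding I_def using jexp_transpose_decay[OF jpos_chain c, where w = "transpose P *v z"] by simp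
    finally show ?thesis .
  qed
  have cp: "norm (transpose (cmat (?M t)) *v cpair (x, y)) = norm (cpair (transpose (?M t) *v x, transpose (?M t) *v y))" for t x y
    by (simp only: transpose_cmat cpair_mult)
  have cpair_T: "cpair (x, y) \<in> T \<longleftrightarrow> x \<in> ?S \<and> y \<in> ?S" for x y
  proof
    assume "cpair (x, y) \<in> T"
    then obtain C where C0: "\<And>t. t \<ge> 0 \<Longrightarrow> norm (transpose (cmat (?M (- t))) *v cpair (x, y)) \<le> C * ?g t"
      unfolding T_def by blast
    have C: "norm (cpair (transpose (?M (- t)) *v x, transpose (?M (- t)) *v y)) \<le> C * ?g t" if "t \<ge> 0" for t
      using C0[OF that] by (simp only: cp)
    have "norm (transpose (?M (- t)) *v x) \<le> C * ?g t" "norm (transpose (?M (- t)) *v y) \<le> C * ?g t" if "t \<ge> 0" for t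
      by (rule order_trans[OF norm_cpair(1) C[OF that]], rule order_trans[OF norm_cpair(2) C[OF that]])
    then show "x \<in> ?S \<and> y \<in> ?S"
      unfolding decay_vectors_def by (intro conjI CollectI exI[of _ C] allI impI)
  next
    assume "x \<in> ?S \<and> y \<in> ?S"
    then obtain C C' where C: "\<And>t. t \<ge> 0 \<Longrightarrow> norm (transpose (?M (- t)) *v x) \<le> C * ?g t"
      "\<And>t. t \<ge> 0 \<Longrightarrow> norm (transpose (?M (- t)) *v y) \<le> C' * ?g t"
      unfolding decay_vectors_def by blast
    have "norm (transpose (cmat (?M (- t))) *v cpair (x, y)) \<le> (C + C') * ?g t" if t: "t \<ge> 0" for t
    proof -
      have "norm (transpose (cmat (?M (- t))) *v cpair (x, y)) \<le> norm (transpose (?M (- t)) *v x) + norm (transpose (?M (- t)) *v y)"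
        unfolding cp by (rule norm_cpair)
      also have "\<dots> \<le> C * ?g t + C' * ?g t" by (intro add_mono C t)
      finally show ?thesis by (simp only: distrib_right)
    qed
    then show "cpair (x, y) \<in> T" unfolding T_def by blast
  qed
  have T_eq: "T = (\<lambda>z. transpose Q *v z) ` {y. \<forall>l. l \<notin> I \<longrightarrow> y $ l = 0}"
  proof (intro Set.set_eqI iffI)
    fix z assume "z \<in> T"
    then show "z \<in> (\<lambda>z. transpose Q *v z) ` {y. \<forall>l. l \<notin> I \<longrightarrow> y $ l = 0}"
      using T_iff by (intro image_eqI[of _ _ "transpose P *v z"]) (simp_all only: tr mem_Collect_eq)
  next
    fix z assume "z \<in> (\<lambda>z. transpose Q *v z) ` {y. \<forall>l. l \<notin> I \<longrightarrow> y $ l = 0}"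
    then show "z \<in> T" using T_iff tr(1) by (auto simp del: transpose_matrix_vector)
  qed
  have injQ: "inj (\<lambda>z. transpose Q *v z)" by (rule injI) (metis tr(1))
  have "dim ((\<lambda>z. transpose Q *v z) ` {y. \<forall>l. l \<notin> I \<longrightarrow> y $ l = 0}) = dim {y::complex^'n. \<forall>l. l \<notin> I \<longrightarrow> y $ l = 0}"
    by (rule dim_image_eq[OF linear_complex_matrix inj_on_subset[OF injQ subset_UNIV]])
  then have "dim T = dim {y::complex^'n. \<forall>l. l \<notin> I \<longrightarrow> y $ l = 0}" by (simp only: T_eq)
  then have dT: "dim T = 2 * card I" by (simp only: dim_coordinate_subspace)
  have "subspace T"
    unfolding T_eq by (intro linear_subspace_image linear_complex_matrix) (auto simp: real_vector.subspace_def)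
  \<comment> \<open>\<open>dim_Times\<close> asks for subspaces; the property is pulled back from
    \<open>T\<close> along the real vectors.\<close>
  have S0: "subspace ?S"
  proof -
    have "cpair (0, 0) = 0" by (simp add: cpair_def Finite_Cartesian_Product.vec_eq_iff complex_eq_iff)
    then have "cpair (0, 0) \<in> T" using subspace_0[OF \<open>subspace T\<close>] by metis
    then have "0 \<in> ?S" using cpair_T by blast
    then have "?S = (\<lambda>x. cpair (x, 0)) -` T" unfolding vimage_def using cpair_T by blast
    moreover have "linear (\<lambda>x. cpair (x, 0))"
      by (rule linearI) (auto simp: cpair_def Finite_Cartesian_Product.vec_eq_iff complex_eq_iff)
    ultimately show ?thesis using linear_subspace_vimage[OF _ \<open>subspace T\<close>] by simp
  qed
  have "cpair ` (?S \<times> ?S) = T"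
  proof (intro Set.set_eqI iffI)
    fix z assume z: "z \<in> T"
    define x y :: "real^'n" where "x = (\<chi> i. Re (z $ i))" and "y = (\<chi> i. Im (z $ i))"
    have zc: "z = cpair (x, y)" by (simp add: x_def y_def cpair_def Finite_Cartesian_Product.vec_eq_iff)
    with z have "x \<in> ?S \<and> y \<in> ?S" using cpair_T[of x y] by simp
    then show "z \<in> cpair ` (?S \<times> ?S)" unfolding zc by (intro imageI SigmaI) auto
  qed (auto simp: cpair_T)
  moreover have injc: "inj cpair" by (rule injI) (auto simp: cpair_def Finite_Cartesian_Product.vec_eq_iff prod_eq_iff)
  have "dim (cpair ` (?S \<times> ?S)) = dim (?S \<times> ?S)"
    by (rule dim_image_eq[OF linear_cpair inj_on_subset[OF injc subset_UNIV]])
  ultimately have "dim T = dim (?S \<times> ?S)" by (simp only:)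
  also have "\<dots> = dim ?S + dim ?S" by (rule dim_Times[OF S0 S0])
  finally have "dim ?S = card I" using dT by simp
  also have "card I = card (idx ` I)" by (intro card_image[symmetric] inj_onI) simp
  also have "idx ` I = slow_positions ?L \<rho> m"
    using idx_surj jpos_chain(2)[of A] unfolding I_def slow_positions_def by (fastforce simp del: length_jordan_positions)
  finally show ?thesis .
qed

subsection \<open>The metric of a dilation group\<close>

lemma abs_det_le:
  fixes X :: "real^'n^'n"
  assumes "\<And>i. \<bar>X $ i $ k\<bar> \<le> \<epsilon>" and "\<And>i j. j \<noteq> k \<Longrightarrow> \<bar>X $ i $ j\<bar> \<le> C"
  shows "\<bar>det X\<bar> \<le> fact CARD('n) * (\<epsilon> * C ^ (CARD('n) - 1))"
proof -
  have "\<bar>det X\<bar> \<le> (\<Sum>p\<in>{p. p permutes (UNIV::'n set)}. \<bar>of_int (sign p) * (\<Prod>i\<in>UNIV. X $ i $ p i)\<bar>)"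
    unfolding Determinants.det_def by (rule sum_abs)
  also have "\<dots> \<le> (\<Sum>p\<in>{p. p permutes (UNIV::'n set)}. \<epsilon> * C ^ (CARD('n) - 1))"
  proof (intro sum_mono)
    fix p :: "'n \<Rightarrow> 'n" assume "p \<in> {p. p permutes UNIV}"
    then have p: "p permutes UNIV" by simp
    \<comment> \<open>Each term of the expansion takes exactly one factor from column
      \<open>k\<close>.\<close>
    obtain i where i: "p i = k" using permutes_surj[OF p] by (metis surjD)
    have "\<bar>of_int (sign p) * (\<Prod>i\<in>UNIV. X $ i $ p i)\<bar> = (\<Prod>i\<in>UNIV. \<bar>X $ i $ p i\<bar>)"
      by (simp add: abs_mult abs_prod sign_def)
    also have "\<dots> = \<bar>X $ i $ p i\<bar> * (\<Prod>i\<in>UNIV - {i}. \<bar>X $ i $ p i\<bar>)"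
      by (rule prod.remove) auto
    also have "\<dots> \<le> \<epsilon> * (\<Prod>i\<in>UNIV - {i}. C)"
    proof (intro mult_mono prod_mono conjI)
      fix l assume "l \<in> UNIV - {i}"
      then have "p l \<noteq> k" using i permutes_inj[OF p] by (metis DiffD2 injD singletonI)
      then show "\<bar>X $ l $ p l\<bar> \<le> C" by (rule assms(2))
    qed (use assms(1)[of i] i in \<open>auto intro: prod_nonneg order_trans[OF abs_ge_zero]\<close>)
    also have "(\<Prod>i\<in>UNIV - {i}. C) = C ^ (CARD('n) - 1)" by (simp add: card_Diff_singleton)
    finally show "\<bar>of_int (sign p) * (\<Prod>i\<in>UNIV. X $ i $ p i)\<bar> \<le> \<epsilon> * C ^ (CARD('n) - 1)" .
  qed
  also have "\<dots> = fact CARD('n) * (\<epsilon> * C ^ (CARD('n) - 1))"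
    by (simp add: card_permutations[OF refl])
  finally show ?thesis .
qed

text \<open>Cramer's rule: \<open>x $ k * det X\<close> is the determinant of \<open>X\<close> with
  column \<open>k\<close> replaced by \<open>X *v x\<close>. The result bounds
  \<open>norm (X *v x)\<close> from below, uniformly over matrices with bounded entries.\<close>

lemma det_vec_bound:
  assumes C: "C > 0"
  obtains K where "K > 0" "\<And>(X::real^'n^'n) x. \<forall>i j. \<bar>X $ i $ j\<bar> \<le> C \<Longrightarrow> \<bar>det X\<bar> * norm x \<le> K * norm (X *v x)"
proof -
  define K where "K = real CARD('n) * (fact CARD('n) * C ^ (CARD('n) - 1))"
  have "\<bar>det X\<bar> * norm x \<le> K * norm (X *v x)" if X: "\<forall>i j. \<bar>X $ i $ j\<bar> \<le> C" for X :: "real^'n^'n" and x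
  proof -
    have "\<bar>det X\<bar> * \<bar>x $ k\<bar> \<le> fact CARD('n) * C ^ (CARD('n) - 1) * norm (X *v x)" for k
    proof -
      have "\<bar>x $ k * det X\<bar> = \<bar>det (\<chi> i j. if j = k then (X *v x) $ i else X $ i $ j)\<bar>"
        by (simp add: cramer_lemma)
      also have "\<dots> \<le> fact CARD('n) * (norm (X *v x) * C ^ (CARD('n) - 1))"
        by (rule abs_det_le[where k = k]) (use X in \<open>auto simp: component_le_norm_cart\<close>)
      finally show ?thesis by (simp add: abs_mult mult_ac)
    qed
    then have "(\<Sum>k\<in>UNIV. \<bar>det X\<bar> * \<bar>x $ k\<bar>) \<le> (\<Sum>k\<in>(UNIV::'n set). fact CARD('n) * C ^ (CARD('n) - 1) * norm (X *v x))"
      by (intro sum_mono)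
    moreover have "\<bar>det X\<bar> * norm x \<le> \<bar>det X\<bar> * (\<Sum>k\<in>UNIV. \<bar>x $ k\<bar>)"
      by (intro mult_left_mono norm_le_l1_cart) auto
    ultimately show ?thesis by (simp add: K_def sum_distrib_left mult_ac)
  qed
  moreover have "K > 0" unfolding K_def using C by simp
  ultimately show ?thesis using that by blast
qed

text \<open>The deviation from the linear function vanishes at the integers, hence is bounded on the
  whole line, and a bounded additive function is 0.\<close>

lemma additive_bounded_imp_linear:
  fixes g :: "real \<Rightarrow> real"
  assumes add: "\<And>s t. g (s + t) = g s + g t" and bd: "\<And>t. 0 \<le> t \<Longrightarrow> t \<le> 1 \<Longrightarrow> \<bar>g t\<bar> \<le> K"
  shows "g t = g 1 * t"
proof -
  define h where "h t = g t - g 1 * t" for t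
  have hadd: "h (s + t) = h s + h t" for s t by (simp add: h_def add algebra_simps)
  have h0: "h 0 = 0" using hadd[of 0 0] by simp
  have hn: "h (real n * t) = real n * h t" for n t
    by (induction n) (auto simp: h0 hadd algebra_simps)
  have hm: "h (- t) = - h t" for t using hadd[of t "- t"] h0 by simp
  have hint: "h (of_int n) = 0" for n
  proof (cases n)
    case (nonneg k) then show ?thesis using hn[of k 1] by (simp add: h_def)
  next
    case (neg k)
    have "h (real (Suc k)) = 0" using hn[of "Suc k" 1] by (simp add: h_def)
    then show ?thesis using hm[of "real (Suc k)"] by (simp add: neg)
  qed
  have hb: "\<bar>h t\<bar> \<le> K + \<bar>g 1\<bar>" for t
  proof -
    have "h t = h (frac t) + h (of_int \<lfloor>t\<rfloor>)" by (simp flip: hadd add: frac_def)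
    then have "h t = g (frac t) - g 1 * frac t" by (simp add: hint) (simp add: h_def)
    moreover have "\<bar>g (frac t)\<bar> \<le> K" by (intro bd) (auto simp: frac_lt_1 less_imp_le)
    moreover have "\<bar>g 1 * frac t\<bar> \<le> \<bar>g 1\<bar> * 1"
      unfolding abs_mult by (intro mult_left_mono) (auto simp: frac_lt_1 less_imp_le)
    ultimately show ?thesis by linarith
  qed
  have "h t = 0"
  proof (rule ccontr)
    assume "h t \<noteq> 0"
    then obtain n :: nat where "(K + \<bar>g 1\<bar>) < real n * \<bar>h t\<bar>" using reals_Archimedean3[of "\<bar>h t\<bar>"] by auto
    then show False using hb[of "real n * t"] hn[of n t] by (simp add: abs_mult)
  qed
  then show ?thesis by (simp add: h_def)
qed

lemma matrix_exp_add: "matrix_exp ((s + t) *\<^sub>R A) = matrix_exp (s *\<^sub>R A) ** matrix_exp (t *\<^sub>R A)"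
  by (simp add: matrix_exp_eq_mexp mexp_scaleR_add)

text \<open>Read off from the explicit entries in Jordan coordinates.\<close>

lemma continuous_matrix_exp_entry: "continuous_on UNIV (\<lambda>t. matrix_exp (t *\<^sub>R A) $ i $ j)"
proof -
  obtain P Q :: "complex^'a^'a" where M: "\<And>t. cmat (matrix_exp (t *\<^sub>R A)) = P ** jexp (jpos A) t ** Q"
    by (rule matrix_exp_jordan[of A], rule that)
  have "matrix_exp (t *\<^sub>R A) $ i $ j = Re ((P ** jexp (jpos A) t ** Q) $ i $ j)" for t
    unfolding M[symmetric] by (simp add: cmat_def)
  then have eq: "(\<lambda>t. matrix_exp (t *\<^sub>R A) $ i $ j) = (\<lambda>t. Re (\<Sum>m\<in>UNIV. \<Sum>l\<in>UNIV. P $ i $ l * jexp (jpos A) t $ l $ m * Q $ m $ j))"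
    by (simp add: matrix_mult3_entry fun_eq_iff)
  have cj: "continuous_on UNIV (\<lambda>t. (jexp (jpos A) t :: complex^'a^'a) $ l $ m)" for l m
  proof (cases "idx l \<le> idx m \<and> idx m - idx l \<le> snd (jpos A ! idx l)")
    case True
    then show ?thesis by (simp add: jexp_entry[OF jpos_chain] del: of_real_divide of_real_power) (intro continuous_intros; simp)
  next
    case False
    then show ?thesis by (simp only: jexp_entry[OF jpos_chain] if_False continuous_on_const)
  qed
  show ?thesis unfolding eq
    by (intro continuous_on_Re continuous_on_sum continuous_on_mult continuous_on_const cj)
qed

text \<open>Half of the smallest real part \<open>r\<close> is given up to absorb the polynomial
  factors of the Jordan blocks.\<close>

lemma matrix_exp_contracting:
  fixes A :: "real^'n^'n"
  assumes "positive_real_parts A"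
  obtains C e where "C > 0" "e > 0" "\<And>t i j. t \<ge> 0 \<Longrightarrow> \<bar>matrix_exp ((- t) *\<^sub>R A) $ i $ j\<bar> \<le> C * exp (- (e * t))"
proof -
  obtain P Q :: "complex^'n^'n" where M: "\<And>t. cmat (matrix_exp (t *\<^sub>R A)) = P ** jexp (jpos A) t ** Q"
    by (rule matrix_exp_jordan[of A], rule that)
  let ?L = "jpos A"
  define r where "r = Min ((\<lambda>l::'n. Re (fst (?L ! idx l))) ` UNIV)"
  have r: "r > 0" unfolding r_def using jpos_positive[OF assms] by (subst Min_gr_iff) auto
  have r_le: "r \<le> Re (fst (?L ! idx l))" for l :: 'n unfolding r_def by (rule Min_le) auto
  have "\<exists>K>0. \<forall>t\<ge>0. \<forall>m. norm ((jexp ?L (- t) :: complex^'n^'n) $ l $ m) \<le> K * exp (- (r / 2 * t))" for l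
  proof -
    obtain K where K: "K > 0" "\<And>t. t \<ge> 0 \<Longrightarrow> (1 + 1 * t) ^ snd (?L ! idx l) * exp (- (r / 2 * t)) \<le> K"
      using poly_exp_decay_bound[of "r / 2" 1 "snd (?L ! idx l)"] r by auto
    have "norm ((jexp ?L (- t) :: complex^'n^'n) $ l $ m) \<le> K * exp (- (r / 2 * t))" if t: "t \<ge> 0" for t m
    proof -
      have "norm ((jexp ?L (- t) :: complex^'n^'n) $ l $ m) \<le> exp (- (Re (fst (?L ! idx l)) * t)) * (1 + t) ^ snd (?L ! idx l)"
        by (rule norm_jexp_entry_le[OF jpos_chain t])
      also have "\<dots> \<le> exp (- (r * t)) * (1 + t) ^ snd (?L ! idx l)"
        using r_le[of l] t by (intro mult_right_mono) (auto intro: mult_right_mono)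
      also have "exp (- (r * t)) = exp (- (r / 2 * t)) * exp (- (r / 2 * t))" by (simp flip: exp_add)
      also have "exp (- (r / 2 * t)) * exp (- (r / 2 * t)) * (1 + t) ^ snd (?L ! idx l) = ((1 + 1 * t) ^ snd (?L ! idx l) * exp (- (r / 2 * t))) * exp (- (r / 2 * t))"
        by simp
      also have "\<dots> \<le> K * exp (- (r / 2 * t))" using K(2)[OF t] by (intro mult_right_mono) auto
      finally show ?thesis .
    qed
    with K show ?thesis by blast
  qed
  then obtain K where K: "\<And>l. K l > 0" "\<And>l m t. t \<ge> 0 \<Longrightarrow> norm ((jexp ?L (- t) :: complex^'n^'n) $ l $ m) \<le> K l * exp (- (r / 2 * t))"
    by metis
  define c where "c i j = (\<Sum>m\<in>UNIV. \<Sum>l\<in>UNIV. norm (P $ i $ l) * K l * norm (Q $ m $ j))" for i j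
  have b: "\<bar>matrix_exp ((- t) *\<^sub>R A) $ i $ j\<bar> \<le> c i j * exp (- (r / 2 * t))" if t: "t \<ge> 0" for t i j
  proof -
    have "\<bar>matrix_exp ((- t) *\<^sub>R A) $ i $ j\<bar> = norm (cmat (matrix_exp ((- t) *\<^sub>R A)) $ i $ j)"
      by (simp add: cmat_def)
    also have "\<dots> = norm (\<Sum>m\<in>UNIV. \<Sum>l\<in>UNIV. P $ i $ l * jexp ?L (- t) $ l $ m * Q $ m $ j)"
      by (simp only: M matrix_mult3_entry)
    also have "\<dots> \<le> (\<Sum>m\<in>UNIV. \<Sum>l\<in>UNIV. norm (P $ i $ l) * (K l * exp (- (r / 2 * t))) * norm (Q $ m $ j))"
    proof (intro order_trans[OF norm_sum] sum_mono)
      fix m l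
      show "norm (P $ i $ l * jexp ?L (- t) $ l $ m * Q $ m $ j) \<le> norm (P $ i $ l) * (K l * exp (- (r / 2 * t))) * norm (Q $ m $ j)"
        unfolding norm_mult by (intro mult_right_mono mult_left_mono K t) auto
    qed
    also have "\<dots> = c i j * exp (- (r / 2 * t))"
      unfolding c_def sum_distrib_right by (intro sum.cong refl) simp
    finally show ?thesis .
  qed
  have c0: "c i j \<ge> 0" for i j unfolding c_def using K(1) by (intro sum_nonneg mult_nonneg_nonneg) (auto simp: less_imp_le)
  define C where "C = (\<Sum>i\<in>UNIV. \<Sum>j\<in>UNIV. c i j) + 1"
  have cC: "c i j \<le> C" for i j
  proof -
    have "c i j \<le> (\<Sum>j\<in>UNIV. c i j)" by (rule member_le_sum) (auto simp: c0)
    also have "\<dots> \<le> (\<Sum>i\<in>UNIV. \<Sum>j\<in>UNIV. c i j)" by (rule member_le_sum) (auto intro: sum_nonneg c0)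
    finally show ?thesis by (simp add: C_def)
  qed
  have "\<bar>matrix_exp ((- t) *\<^sub>R A) $ i $ j\<bar> \<le> C * exp (- (r / 2 * t))" if t: "t \<ge> 0" for t i j
    using b[OF t, of i j] cC[of i j] by (meson exp_ge_zero mult_right_mono order_trans)
  moreover have "C > 0" unfolding C_def by (intro add_nonneg_pos sum_nonneg c0) auto
  ultimately show ?thesis using that[of C "r / 2"] r by simp
qed

lemma norm_matrix_vector_le:
  fixes X :: "real^'n^'m"
  assumes "\<And>i j. \<bar>X $ i $ j\<bar> \<le> c"
  shows "norm (X *v v) \<le> (real CARD('m) * real CARD('n)) * c * norm v"
proof -
  have "norm (X *v v) \<le> (\<Sum>i\<in>UNIV. \<bar>(X *v v) $ i\<bar>)" by (rule norm_le_l1_cart)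
  also have "\<dots> \<le> (\<Sum>i\<in>(UNIV::'m set). \<Sum>j\<in>(UNIV::'n set). c * norm v)"
  proof (intro sum_mono)
    fix i
    have "\<bar>(X *v v) $ i\<bar> \<le> (\<Sum>j\<in>UNIV. \<bar>X $ i $ j * v $ j\<bar>)"
      unfolding matrix_vector_mult_def by (simp add: sum_abs)
    also have "\<dots> \<le> (\<Sum>j\<in>(UNIV::'n set). c * norm v)"
      unfolding abs_mult
      by (intro sum_mono mult_mono assms component_le_norm_cart order_trans[OF abs_ge_zero assms]) auto
    finally show "\<bar>(X *v v) $ i\<bar> \<le> (\<Sum>j\<in>(UNIV::'n set). c * norm v)" .
  qed
  finally show ?thesis by simp
qed

text \<open>The logarithm of the determinant is additive in \<open>t\<close> and bounded on the unit
  interval, hence linear. Its slope is positive because the entries of \<open>exp (- t A)\<close>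
  tend to 0, and with them the determinant.\<close>

lemma det_matrix_exp:
  fixes A :: "real^'n^'n"
  assumes "positive_real_parts A"
  obtains a where "a > 0" "\<And>t. det (matrix_exp (t *\<^sub>R A)) = exp (a * t)"
proof -
  define f where "f t = det (matrix_exp (t *\<^sub>R A))" for t
  have fadd: "f (s + t) = f s * f t" for s t unfolding f_def by (simp add: matrix_exp_add det_mul)
  have f0: "f 0 = 1" by (simp add: f_def matrix_exp_eq_mexp)
  \<comment> \<open>Nonzero because of the inverse at \<open>- t\<close>, and a square by halving
    the time.\<close>
  have fpos: "f t > 0" for t
  proof -
    have "f t * f (- t) = 1" using fadd[of t "- t"] f0 by simp
    moreover have "f t = f (t / 2) * f (t / 2)" using fadd[of "t / 2" "t / 2"] by simp
    ultimately show ?thesis by (metis mult_zero_left not_square_less_zero not_less_iff_gr_or_eq zero_neq_one)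
  qed
  have cont: "continuous_on UNIV f" unfolding f_def Determinants.det_def
    by (intro continuous_intros continuous_matrix_exp_entry)
  have cln: "continuous_on {0..1} (\<lambda>t. ln (f t))"
    using fpos by (intro continuous_intros continuous_on_subset[OF cont]) (auto simp: less_imp_neq[THEN not_sym])
  obtain K where K0: "\<forall>x\<in>(\<lambda>t. ln (f t)) ` {0..1}. norm x \<le> K"
    using compact_imp_bounded[OF compact_continuous_image[OF cln compact_Icc]] unfolding bounded_iff by blast
  have K: "\<bar>ln (f t)\<bar> \<le> K" if "t \<in> {0..1}" for t
    using bspec[OF K0 imageI[OF that]] by simp
  define a where "a = ln (f 1)"
  have "ln (f t) = a * t" for t unfolding a_def
    by (rule additive_bounded_imp_linear[where K = K]) (use K fpos in \<open>auto simp: fadd ln_mult less_imp_neq[THEN not_sym]\<close>)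
  then have f: "f t = exp (a * t)" for t by (metis exp_ln fpos)
  obtain C e where C: "C > 0" "e > 0" "\<And>t i j. t \<ge> 0 \<Longrightarrow> \<bar>matrix_exp ((- t) *\<^sub>R A) $ i $ j\<bar> \<le> C * exp (- (e * t))"
    using matrix_exp_contracting[OF assms] by blast
  have "a > 0"
  proof (rule ccontr)
    assume "\<not> a > 0"
    have "1 \<le> fact CARD('n) * (C * exp (- (e * t)) * C ^ (CARD('n) - 1))" if t: "t \<ge> 0" for t
    proof -
      have "exp (- (e * t)) \<le> 1" using C t by simp
      then have le: "C * exp (- (e * t)) \<le> C" using C by (simp add: mult_le_cancel_left1)
      have "1 \<le> exp (a * (- t))" using \<open>\<not> a > 0\<close> t by (simp add: mult_nonpos_nonneg)
      also have "\<dots> \<le> \<bar>det (matrix_exp ((- t) *\<^sub>R A))\<bar>" using f[of "- t"] by (simp add: f_def)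
      also have "\<dots> \<le> fact CARD('n) * (C * exp (- (e * t)) * C ^ (CARD('n) - 1))"
        by (rule abs_det_le) (use C(3)[OF t] le in \<open>blast intro: order_trans\<close>)+
      finally show ?thesis .
    qed
    then have "\<forall>\<^sub>F t in at_top. 1 \<le> fact CARD('n) * (C * exp (- (e * t)) * C ^ (CARD('n) - 1))"
      using eventually_ge_at_top[of 0] by (rule eventually_mono[rotated])
    moreover have "((\<lambda>t. exp (- (e * t))) \<longlongrightarrow> 0) at_top" using C(2) by real_asymp
    then have "((\<lambda>t. fact CARD('n) * (C * exp (- (e * t)) * C ^ (CARD('n) - 1))) \<longlongrightarrow> fact CARD('n) * (C * 0 * C ^ (CARD('n) - 1))) at_top"
      by (intro tendsto_mult tendsto_const)
    ultimately have "1 \<le> fact CARD('n) * (C * 0 * C ^ (CARD('n) - 1))"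
      by (intro tendsto_lowerbound[of _ _ at_top]) auto
    then show False by simp
  qed
  with f that show ?thesis unfolding f_def by blast
qed

text \<open>\<open>LEAST\<close> over the reals says something only where a minimum exists. The
  level set is nonempty by the intermediate value theorem, bounded below since \<open>\<phi>\<close>
  exceeds 1 near minus infinity, and closed.\<close>

lemma least_level:
  fixes \<phi> :: "real \<Rightarrow> real"
  assumes cont: "continuous_on UNIV \<phi>" and hi: "(\<phi> \<longlongrightarrow> 0) at_top" and lo: "filterlim \<phi> at_top at_bot"
  shows "\<phi> (LEAST t. \<phi> t = 1) = 1"
proof -
  let ?S = "{t. \<phi> t = 1}"
  obtain u where u: "\<And>t. t \<le> u \<Longrightarrow> \<phi> t > 1"
    using lo unfolding filterlim_at_top_dense eventually_at_bot_linorder by blast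
  have "\<forall>\<^sub>F t in at_top. \<phi> t < 1" using hi by (rule order_tendstoD) simp
  then obtain v where v: "v \<ge> u" "\<phi> v < 1"
    using eventually_conj[OF _ eventually_ge_at_top[of u]] by (metis (mono_tags, lifting) eventually_at_top_linorder order_refl)
  have "\<exists>t\<ge>u. t \<le> v \<and> \<phi> t = 1"
    by (rule IVT2') (use u[of u] v in \<open>auto intro: continuous_on_subset[OF cont]\<close>)
  then have ne: "?S \<noteq> {}" by auto
  have bdd: "bdd_below ?S"
  proof (rule bdd_belowI)
    fix t assume "t \<in> ?S" then show "u \<le> t" using u[of t] by fastforce
  qed
  have "closed ?S" using cont by (intro closed_Collect_eq) auto
  from closed_contains_Inf[OF ne bdd this] have "Inf ?S \<in> ?S" .
  moreover have "(LEAST t. \<phi> t = 1) = Inf ?S"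
    by (rule Least_equality) (use calculation cInf_lower[OF _ bdd] in auto)
  ultimately show ?thesis by simp
qed

lemma inner_product_norm_equiv:
  fixes g :: "'a::euclidean_space \<Rightarrow> 'a \<Rightarrow> real"
  assumes "is_inner_product g"
  obtains c C where "c > 0" "C > 0" "\<And>x. c * norm x \<le> sqrt (g x x)" "\<And>x. sqrt (g x x) \<le> C * norm x"
proof -
  have bil: "bilinear g" and pos: "\<And>u. u \<noteq> 0 \<Longrightarrow> g u u > 0" using assms by (auto simp: is_inner_product_def)
  have cont: "continuous_on (sphere 0 1) (\<lambda>x. g x x)"
    by (rule bilinear_continuous_on_compose[OF _ _ bil]) (auto intro: continuous_intros)
  have ne: "sphere (0::'a) 1 \<noteq> {}" by simp
  obtain x0 where x0: "x0 \<in> sphere 0 1" "\<And>y. y \<in> sphere 0 1 \<Longrightarrow> g x0 x0 \<le> g y y"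
    using continuous_attains_inf[OF compact_sphere ne cont] by blast
  obtain x1 where x1: "x1 \<in> sphere 0 1" "\<And>y. y \<in> sphere 0 1 \<Longrightarrow> g y y \<le> g x1 x1"
    using continuous_attains_sup[OF compact_sphere ne cont] by blast
  have p0: "g x0 x0 > 0" "g x1 x1 > 0" using x0 x1 by (auto intro!: pos)
  have scale: "g x x = (norm x)\<^sup>2 * g (x /\<^sub>R norm x) (x /\<^sub>R norm x)" if "x \<noteq> 0" for x
    using that by (simp add: bilinear_lmul[OF bil] bilinear_rmul[OF bil] power2_eq_square field_simps)
  have "sqrt (g x0 x0) * norm x \<le> sqrt (g x x) \<and> sqrt (g x x) \<le> sqrt (g x1 x1) * norm x" for x
  proof (cases "x = 0")
    case True then show ?thesis by (simp add: bilinear_lzero[OF bil])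
  next
    case False
    then have s: "x /\<^sub>R norm x \<in> sphere 0 1" by simp
    have "sqrt (g x x) = norm x * sqrt (g (x /\<^sub>R norm x) (x /\<^sub>R norm x))"
      unfolding scale[OF False] by (simp add: real_sqrt_mult)
    then show ?thesis using x0(2)[OF s] x1(2)[OF s] by (simp add: mult.commute mult_left_mono)
  qed
  then show ?thesis using that[of "sqrt (g x0 x0)" "sqrt (g x1 x1)"] p0 by auto
qed

text \<open>The norm at the identity is equivalent to the Euclidean one, so the level equation that
  defines the quasimetric turns into \<open>D_scale\<close> with the constants \<open>1 / c'\<close>
  and \<open>1 / c\<close>.\<close>

theorem admissible_dilation:
  fixes A :: "real^'n^'n"
  assumes A: "positive_real_parts A" and m: "admissible_metric A m"
  obtains a where "dilation (\<lambda>t. matrix_exp (t *\<^sub>R A)) (parabolic_visual A m) a"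
proof -
  let ?M = "\<lambda>t. matrix_exp (t *\<^sub>R A)"
  have M0: "?M 0 = mat 1" by (simp add: matrix_exp_eq_mexp)
  obtain a where a: "a > 0" "\<And>t. det (?M t) = exp (a * t)" using det_matrix_exp[OF A] by blast
  obtain C0 e where C0: "C0 > 0" "e > 0" "\<And>t i j. t \<ge> 0 \<Longrightarrow> \<bar>?M (- t) $ i $ j\<bar> \<le> C0 * exp (- (e * t))"
    using matrix_exp_contracting[OF A] by blast
  define C where "C = real CARD('n) * real CARD('n) * C0"
  have C: "C > 0" using C0 by (simp add: C_def)
  have contr: "norm (?M (- t) *v x) \<le> C * exp (- e * t) * norm x" if "t \<ge> 0" for t x
    using norm_matrix_vector_le[OF C0(3)[OF that], of x] by (simp add: C_def mult_ac)
  have mv: "?M s *v (?M t *v x) = ?M (s + t) *v x" for s t x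
    by (simp add: matrix_exp_add matrix_vector_mul_assoc)
  have "is_inner_product (m (0, 0))" using m by (simp add: admissible_metric_def left_invariant_metric_def)
  then obtain c c' where c: "c > 0" "c' > 0" "\<And>x. c * norm x \<le> sqrt (m (0, 0) x x)" "\<And>x. sqrt (m (0, 0) x x) \<le> c' * norm x"
    using inner_product_norm_equiv by blast
  have hn: "c * norm x \<le> horizontal_norm m x" "horizontal_norm m x \<le> c' * norm x" for x
    using c(3)[of "(x, 0)"] c(4)[of "(x, 0)"] by (simp_all add: horizontal_norm_def)
  have bil: "bilinear (m (0, 0))" using \<open>is_inner_product (m (0, 0))\<close> by (simp add: is_inner_product_def)
  have level: "slice_dist A m (LEAST t. slice_dist A m t x y = 1) x y = 1" if "x \<noteq> y" for x y
  proof (rule least_level)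
    let ?v = "x - y"
    have sd: "slice_dist A m t x y = horizontal_norm m (?M (- t) *v ?v)" for t by (simp add: slice_dist_def)
    have "continuous_on UNIV (\<lambda>t. ?M (- t) *v ?v)"
      unfolding matrix_vector_mult_def
      by (intro continuous_on_vec_lambda continuous_intros continuous_on_compose2[OF continuous_matrix_exp_entry]) auto
    then have cv: "continuous_on UNIV (\<lambda>t. (?M (- t) *v ?v, 0::real))" by (intro continuous_intros)
    have "continuous_on UNIV (\<lambda>t. m (0, 0) (?M (- t) *v ?v, 0) (?M (- t) *v ?v, 0))"
      by (rule bilinear_continuous_on_compose[OF cv cv bil])
    then show "continuous_on UNIV (\<lambda>t. slice_dist A m t x y)"
      unfolding sd horizontal_norm_def by (rule continuous_on_real_sqrt)
    show "((\<lambda>t. slice_dist A m t x y) \<longlongrightarrow> 0) at_top"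
    proof (rule Lim_null_comparison)
      show "\<forall>\<^sub>F t in at_top. norm (slice_dist A m t x y) \<le> c' * (C * exp (- e * t) * norm ?v)"
        using eventually_ge_at_top[of 0]
      proof eventually_elim
        case (elim t)
        have "slice_dist A m t x y \<ge> 0" using hn(1)[of "?M (- t) *v ?v"] c(1) unfolding sd
          by (meson less_imp_le mult_nonneg_nonneg norm_ge_zero order_trans)
        moreover have "slice_dist A m t x y \<le> c' * (C * exp (- e * t) * norm ?v)" unfolding sd
          by (rule order_trans[OF hn(2)]) (use contr[OF elim, of ?v] c(2) in \<open>auto intro: mult_left_mono\<close>)
        ultimately show ?case by simp
      qed
      have "((\<lambda>t. exp (- e * t)) \<longlongrightarrow> 0) at_top" using C0(2) by real_asymp
      then have "((\<lambda>t. c' * (C * exp (- e * t) * norm ?v)) \<longlongrightarrow> c' * (C * 0 * norm ?v)) at_top"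
        by (intro tendsto_mult tendsto_const)
      then show "((\<lambda>t. c' * (C * exp (- e * t) * norm ?v)) \<longlongrightarrow> 0) at_top" by simp
    qed
    show "filterlim (\<lambda>t. slice_dist A m t x y) at_top at_bot"
    proof (rule filterlim_at_top_mono)
      show "filterlim (\<lambda>t. c * norm ?v / C * exp (- e * t)) at_top at_bot"
        using C0(2) c(1) C that by real_asymp
      show "\<forall>\<^sub>F t in at_bot. c * norm ?v / C * exp (- e * t) \<le> slice_dist A m t x y"
        using eventually_le_at_bot[of 0]
      proof eventually_elim
        case (elim t)
        \<comment> \<open>The contraction estimate for the inverse map bounds the norm at negative
          times from below.\<close>
        have "norm ?v = norm (?M (- (- t)) *v (?M (- t) *v ?v))" by (simp only: mv) (simp add: matrix_exp_eq_mexp)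
        also have "\<dots> \<le> C * exp (- e * (- t)) * norm (?M (- t) *v ?v)" using elim by (intro contr) simp
        finally have "norm ?v / C * exp (- e * t) \<le> norm (?M (- t) *v ?v)"
          using C by (simp add: field_simps exp_minus)
        then have "c * (norm ?v / C * exp (- e * t)) \<le> c * norm (?M (- t) *v ?v)" using c(1) by (intro mult_left_mono) auto
        also have "\<dots> \<le> slice_dist A m t x y" unfolding sd by (rule hn)
        finally show ?case by simp
      qed
    qed
  qed
  have "dilation ?M (parabolic_visual A m) a"
  proof
    show "\<exists>C>0. \<exists>e>0. \<forall>t\<ge>0. \<forall>x. norm (?M (- t) *v x) \<le> C * exp (- e * t) * norm x"
      using C C0(2) contr by blast
    show "\<exists>k>0. \<exists>k'>0. \<forall>x y. x \<noteq> y \<longrightarrow> 0 < parabolic_visual A m x y \<and>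
      k \<le> norm (?M (- ln (parabolic_visual A m x y)) *v (x - y)) \<and> norm (?M (- ln (parabolic_visual A m x y)) *v (x - y)) \<le> k'"
    proof (intro exI conjI allI impI)
      show "1 / c' > 0" "1 / c > 0" using c by auto
      fix x y :: "real^'n" assume xy: "x \<noteq> y"
      let ?v = "?M (- ln (parabolic_visual A m x y)) *v (x - y)"
      show "0 < parabolic_visual A m x y" using xy by (simp add: parabolic_visual_def)
      have "horizontal_norm m ?v = 1"
        using level[OF xy] xy by (simp add: parabolic_visual_def slice_dist_def)
      then show "1 / c' \<le> norm ?v" "norm ?v \<le> 1 / c"
        using hn[of ?v] c by (simp_all add: field_simps)
    qed
  qed (use a M0 in \<open>auto simp: matrix_exp_add parabolic_visual_def\<close>)
  with that show ?thesis by blast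
qed

subsection \<open>Counting Jordan blocks\<close>

text \<open>Conjugation by the permutation matrix that exchanges the two groups of
  coordinates.\<close>

lemma similar_four_block_swap:
  fixes A B :: "'a::comm_ring_1 Matrix.mat"
  assumes A: "A \<in> carrier_mat n n" and B: "B \<in> carrier_mat m m"
  shows "similar_mat (four_block_mat A (0\<^sub>m n m) (0\<^sub>m m n) B) (four_block_mat B (0\<^sub>m m n) (0\<^sub>m n m) A)"
proof (rule similar_matI)
  let ?P = "four_block_mat (0\<^sub>m n m) (1\<^sub>m n) (1\<^sub>m m) (0\<^sub>m m n) :: 'a Matrix.mat"
  let ?Q = "four_block_mat (0\<^sub>m m n) (1\<^sub>m m) (1\<^sub>m n) (0\<^sub>m n m) :: 'a Matrix.mat"
  have P: "?P \<in> carrier_mat (n + m) (n + m)" and Q: "?Q \<in> carrier_mat (n + m) (n + m)"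
    by (intro carrier_matI; simp)+
  show "{four_block_mat A (0\<^sub>m n m) (0\<^sub>m m n) B, four_block_mat B (0\<^sub>m m n) (0\<^sub>m n m) A, ?P, ?Q} \<subseteq> carrier_mat (n + m) (n + m)"
    using A B P Q by (auto intro!: carrier_matI)
  show "?P * ?Q = 1\<^sub>m (n + m)"
    by (subst mult_four_block_mat[of _ n m _ n _ m _ _ n _ m]) (auto simp: four_block_one_mat)
  show "?Q * ?P = 1\<^sub>m (n + m)"
    by (subst mult_four_block_mat[of _ m n _ m _ n _ _ m _ n]) (auto simp: four_block_one_mat add.commute)
  have PB: "?P * four_block_mat B (0\<^sub>m m n) (0\<^sub>m n m) A = four_block_mat (0\<^sub>m n m) A B (0\<^sub>m m n)"
    using A B by (subst mult_four_block_mat[of _ n m _ n _ m _ _ m _ n]) auto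
  show "four_block_mat A (0\<^sub>m n m) (0\<^sub>m m n) B = ?P * four_block_mat B (0\<^sub>m m n) (0\<^sub>m n m) A * ?Q"
    unfolding PB using A B by (subst mult_four_block_mat[of _ n m _ n _ m _ _ n _ m]) auto
qed

lemma jordan_matrix_append:
  "jordan_matrix (xs @ ys) = four_block_mat (jordan_matrix xs)
    (0\<^sub>m (sum_list (map fst xs)) (sum_list (map fst ys))) (0\<^sub>m (sum_list (map fst ys)) (sum_list (map fst xs))) (jordan_matrix ys)"
  unfolding jordan_matrix_def map_append diag_block_mat_append Let_def
  by (simp flip: jordan_matrix_def)

lemma similar_jordan_append:
  fixes xs ys :: "(nat \<times> 'a::comm_ring_1) list"
  assumes "similar_mat (jordan_matrix xs) (jordan_matrix xs')" "similar_mat (jordan_matrix ys) (jordan_matrix ys')"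
    and "sum_list (map fst xs) = sum_list (map fst xs')" "sum_list (map fst ys) = sum_list (map fst ys')"
  shows "similar_mat (jordan_matrix (xs @ ys)) (jordan_matrix (xs' @ ys'))"
  unfolding jordan_matrix_append assms(3,4)[symmetric]
  by (rule similar_mat_four_block_0_0[OF assms(1,2) jordan_matrix_carrier jordan_matrix_carrier])

lemma similar_jordan_swap:
  fixes xs ys :: "(nat \<times> 'a::comm_ring_1) list"
  shows "similar_mat (jordan_matrix (xs @ ys)) (jordan_matrix (ys @ xs))"
  unfolding jordan_matrix_append by (rule similar_four_block_swap[OF jordan_matrix_carrier jordan_matrix_carrier])

text \<open>One block swap moves the head to its place in the other list, and induction treats the
  tail. Sorting the blocks therefore stays within a similarity class.\<close>

lemma similar_jordan_mset:
  fixes xs ys :: "(nat \<times> 'a::comm_ring_1) list"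
  assumes "mset xs = mset ys"
  shows "similar_mat (jordan_matrix xs) (jordan_matrix ys)"
  using assms
proof (induction xs arbitrary: ys)
  case Nil
  then show ?case by (simp add: similar_mat_refl[OF jordan_matrix_carrier])
next
  case (Cons x xs)
  have sim_refl: "similar_mat (jordan_matrix zs) (jordan_matrix zs)" for zs :: "(nat \<times> 'a) list"
    by (rule similar_mat_refl[OF jordan_matrix_carrier])
  have "x \<in> set ys" using Cons.prems by (metis list.set_intros(1) set_mset_mset)
  then obtain us vs where ys: "ys = us @ x # vs" by (meson split_list)
  have ms: "mset xs = mset (us @ vs)" using Cons.prems by (simp add: ys)
  have len: "sum_list (map fst xs) = sum_list (map fst (us @ vs))"
    using ms by (metis mset_map sum_mset_sum_list)
  have "similar_mat (jordan_matrix ([x] @ xs)) (jordan_matrix ([x] @ (us @ vs)))"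
    by (rule similar_jordan_append[OF sim_refl Cons.IH[OF ms] refl len])
  moreover have "similar_mat (jordan_matrix (([x] @ us) @ vs)) (jordan_matrix ((us @ [x]) @ vs))"
    by (rule similar_jordan_append[OF similar_jordan_swap sim_refl]) simp_all
  ultimately show ?case using similar_mat_trans by (simp add: ys) blast
qed

text \<open>Among pairs with a given second component the list is determined by its sorted first
  components, and stability of the second sort keeps that order.\<close>

lemma sort_key_snd_fst_eq:
  fixes xs ys :: "('a::linorder \<times> 'b::linorder) list"
  assumes "mset xs = mset ys"
  shows "sort_key snd (sort_key fst xs) = sort_key snd (sort_key fst ys)"
proof (rule properties_for_sort_key)
  show "mset (sort_key snd (sort_key fst ys)) = mset (sort_key fst xs)" using assms by simp
  show "sorted (map snd (sort_key snd (sort_key fst ys)))" by simp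
  fix k :: "'a \<times> 'b"
  have det: "filter (\<lambda>x. snd k = snd x) (sort_key fst zs) = map (\<lambda>a. (a, snd k)) (sort (map fst (filter (\<lambda>x. snd k = snd x) zs)))"
    for zs :: "('a \<times> 'b) list"
  proof -
    let ?f = "filter (\<lambda>x. snd k = snd x) zs"
    have "filter (\<lambda>x. snd k = snd x) (sort_key fst zs) = sort_key fst ?f" by (simp add: filter_sort)
    also have "\<dots> = map (\<lambda>a. (a, snd k)) (map fst (sort_key fst ?f))"
      by (simp, rule map_idI[symmetric]) (auto simp: prod_eq_iff)
    also have "map fst (sort_key fst ?f) = sort (map fst ?f)"
      by (rule sym, rule properties_for_sort) simp_all
    finally show ?thesis .
  qed
  have "filter (\<lambda>x. snd k = snd x) (sort_key snd (sort_key fst ys)) = filter (\<lambda>x. snd k = snd x) (sort_key fst ys)"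
    by (metis (mono_tags, lifting) sort_key_stable filter_cong)
  also have "\<dots> = filter (\<lambda>x. snd k = snd x) (sort_key fst xs)"
  proof -
    have "mset (map fst (filter (\<lambda>x. snd k = snd x) xs)) = mset (map fst (filter (\<lambda>x. snd k = snd x) ys))"
      using assms by (simp add: mset_filter)
    then have "sort (map fst (filter (\<lambda>x. snd k = snd x) xs)) = sort (map fst (filter (\<lambda>x. snd k = snd x) ys))"
      by (metis properties_for_sort mset_sort sorted_sort)
    then show ?thesis by (simp add: det)
  qed
  finally show "filter (\<lambda>x. snd k = snd x) (sort_key snd (sort_key fst ys)) = filter (\<lambda>x. snd k = snd x) (sort_key fst xs)" .
qed

section \<open>Recovering the multiset of blocks from counts of positions\<close>

definition real_blocks :: "real^'n^'n \<Rightarrow> (nat \<times> real) list" where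
  "real_blocks A = map (\<lambda>(k, a). (k, Re a)) (jordan_list A)"

lemma real_part_jordan_form_eq:
  "real_part_jordan_form A = jordan_matrix (sort_key snd (sort_key fst (real_blocks A)))"
  by (simp add: real_part_jordan_form_def real_blocks_def jordan_list_def)

definition count_positions :: "('a \<times> nat) list \<Rightarrow> ('a \<Rightarrow> nat \<Rightarrow> bool) \<Rightarrow> nat" where
  "count_positions L P = length (filter (\<lambda>(a, r). P a r) L)"

lemma card_slow_positions:
  "card (slow_positions L \<rho> m) = count_positions L (\<lambda>a r. Re a > \<rho> \<or> Re a = \<rho> \<and> r \<le> m)"
  unfolding slow_positions_def count_positions_def length_filter_conv_card
  by (intro arg_cong[where f = card]) (auto simp: case_prod_beta)

lemma count_positions_or:
  assumes "\<And>a r. \<not> (P a r \<and> Q a r)"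
  shows "count_positions L (\<lambda>a r. P a r \<or> Q a r) = count_positions L P + count_positions L Q"
  unfolding count_positions_def using assms by (induction L) auto

lemma count_positions_cong:
  assumes "\<And>a r. (a, r) \<in> set L \<Longrightarrow> P a r = Q a r"
  shows "count_positions L P = count_positions L Q"
  unfolding count_positions_def using assms by (metis (mono_tags, lifting) case_prodE case_prod_conv filter_cong)

text \<open>A block of size greater than \<open>m\<close> has exactly one position that is followed
  by \<open>m\<close> others, and a smaller block has none.\<close>

lemma count_block_positions:
  "count_positions (jordan_positions xs) (\<lambda>a r. Re a = \<rho> \<and> r = m) = length (filter (\<lambda>(k, a). Re a = \<rho> \<and> m < k) xs)"
proof (induction xs)
  case Nil then show ?case by (simp add: count_positions_def)
next
  case (Cons x xs)
  obtain k a where x: "x = (k, a)" by (cases x)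
  have "length (filter (\<lambda>i. Re a = \<rho> \<and> k - Suc i = m) [0..<k]) = (if Re a = \<rho> \<and> m < k then 1 else 0)"
  proof -
    have "{i. i < k \<and> Re a = \<rho> \<and> k - Suc i = m} = (if Re a = \<rho> \<and> m < k then {k - Suc m} else {})" by auto
    then have "card {i. i < k \<and> Re a = \<rho> \<and> k - Suc i = m} = (if Re a = \<rho> \<and> m < k then 1 else 0)" by simp
    moreover have "length (filter (\<lambda>i. Re a = \<rho> \<and> k - Suc i = m) [0..<k]) = card {i. i < k \<and> Re a = \<rho> \<and> k - Suc i = m}"
      unfolding length_filter_conv_card by (intro arg_cong[where f = card]) auto
    ultimately show ?thesis by simp
  qed
  then show ?case using Cons unfolding count_positions_def x
    by (simp add: filter_map o_def)
qed

text \<open>Supplies a threshold just above \<open>\<rho>\<close> that no real part attains.\<close>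

lemma exists_gap_above:
  fixes S :: "real set"
  assumes "finite S"
  obtains \<rho>' where "\<rho>' > \<rho>" "\<And>x. x \<in> S \<Longrightarrow> x > \<rho> \<longleftrightarrow> x > \<rho>'" "\<rho>' \<notin> S"
proof -
  define T where "T = insert (\<rho> + 1) {x\<in>S. x > \<rho>}"
  define \<rho>' where "\<rho>' = (\<rho> + Min T) / 2"
  have T: "finite T" "T \<noteq> {}" using assms by (auto simp: T_def)
  have 1: "Min T > \<rho>" using T by (subst Min_gr_iff) (auto simp: T_def)
  have 2: "Min T \<le> x" if "x \<in> S" "x > \<rho>" for x using T that by (intro Min_le) (auto simp: T_def)
  have 3: "\<rho>' > \<rho>" "\<rho>' < Min T" using 1 by (auto simp: \<rho>'_def)
  show ?thesis
  proof (rule that[OF 3(1)])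
    show "x > \<rho> \<longleftrightarrow> x > \<rho>'" if "x \<in> S" for x using 2[OF that] 3 by linarith
    show "\<rho>' \<notin> S" using 2[of \<rho>'] 3 by linarith
  qed
qed

lemma jordan_list_block_pos: "(k, a) \<in> set (jordan_list A) \<Longrightarrow> k > 0"
  using jordan_nf_jordan_list[of A] unfolding jordan_nf_def by (force simp: image_iff)

text \<open>Successive differences of the given counts: removing the positions of larger real part
  leaves those at \<open>\<rho>\<close>, subtracting over \<open>m\<close> leaves those followed by
  exactly \<open>m\<close> others, which number the blocks of size greater than \<open>m\<close>,
  and one more difference gives the blocks of each size.\<close>

lemma mset_real_blocks_eq:
  fixes A B :: "real^'n^'n"
  assumes eq: "\<And>\<rho> m. card (slow_positions (jpos A) \<rho> m) = card (slow_positions (jpos B) \<rho> m)"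
  shows "mset (real_blocks A) = mset (real_blocks B)"
proof -
  define f where "f L \<rho> m = count_positions L (\<lambda>a r. Re a > \<rho> \<or> Re a = \<rho> \<and> r \<le> m)" for L :: "(complex \<times> nat) list" and \<rho> m
  define g where "g L \<rho> = count_positions L (\<lambda>a r. Re a > \<rho>)" for L :: "(complex \<times> nat) list" and \<rho>
  define e where "e L \<rho> m = count_positions L (\<lambda>a r. Re a = \<rho> \<and> r \<le> m)" for L :: "(complex \<times> nat) list" and \<rho> m
  define h where "h L \<rho> m = count_positions L (\<lambda>a r. Re a = \<rho> \<and> r = m)" for L :: "(complex \<times> nat) list" and \<rho> m
  have f: "f (jpos A) \<rho> m = f (jpos B) \<rho> m" for \<rho> m using eq by (simp add: f_def card_slow_positions)
  have fge: "f L \<rho> m = g L \<rho> + e L \<rho> m" for L \<rho> m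
    unfolding f_def g_def e_def by (rule count_positions_or) auto
  have g: "g (jpos A) \<rho> = g (jpos B) \<rho>" for \<rho>
  proof -
    let ?S = "(\<lambda>x. Re (fst x)) ` (set (jpos A) \<union> set (jpos B))"
    have fin: "finite ?S" by simp
    obtain \<rho>' where \<rho>': "\<And>x. x \<in> ?S \<Longrightarrow> x > \<rho> \<longleftrightarrow> x > \<rho>'" "\<rho>' \<notin> ?S"
      by (rule exists_gap_above[OF fin, of \<rho>], rule that)
    \<comment> \<open>No position has real part \<open>\<rho>'\<close>, so the clause for equality
      in \<open>f\<close> contributes nothing at this threshold.\<close>
    have "g L \<rho> = f L \<rho>' 0" if L: "set L \<subseteq> set (jpos A) \<union> set (jpos B)" for L
      unfolding g_def f_def
    proof (rule count_positions_cong)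
      fix a r assume "(a, r) \<in> set L"
      then have "Re a \<in> ?S" using L by (force simp: image_iff)
      then show "(Re a > \<rho>) = (Re a > \<rho>' \<or> Re a = \<rho>' \<and> r \<le> 0)" using \<rho>' by auto
    qed
    then show ?thesis using f by simp
  qed
  have e: "e (jpos A) \<rho> m = e (jpos B) \<rho> m" for \<rho> m using f[of \<rho> m] g[of \<rho>] by (simp add: fge)
  have h0: "h L \<rho> 0 = e L \<rho> 0" for L \<rho> by (simp add: h_def e_def)
  have hS: "e L \<rho> (Suc m) = e L \<rho> m + h L \<rho> (Suc m)" for L \<rho> m
    unfolding h_def e_def
    by (subst count_positions_or[symmetric]) (auto intro!: count_positions_cong)
  have h: "h (jpos A) \<rho> m = h (jpos B) \<rho> m" for \<rho> m
  proof (cases m)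
    case 0 then show ?thesis by (simp add: h0 e)
  next
    case (Suc k)
    have "e (jpos A) \<rho> k + h (jpos A) \<rho> (Suc k) = e (jpos B) \<rho> k + h (jpos B) \<rho> (Suc k)"
      using e[of \<rho> "Suc k"] by (simp only: hS)
    then show ?thesis using e[of \<rho> k] Suc by simp
  qed
  have cnt: "count (mset (real_blocks X)) (Suc j, \<rho>) + h (jpos X) \<rho> (Suc j) = h (jpos X) \<rho> j" for X :: "real^'n^'n" and j \<rho>
  proof -
    have "length (filter (\<lambda>(k, a). Re a = \<rho> \<and> j < k) xs) =
      count (mset (map (\<lambda>(k, a). (k, Re a)) xs)) (Suc j, \<rho>) + length (filter (\<lambda>(k, a). Re a = \<rho> \<and> Suc j < k) xs)"
      for xs :: "(nat \<times> complex) list"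
      by (induction xs) auto
    then show ?thesis unfolding h_def count_block_positions real_blocks_def by simp
  qed
  have cnt0: "count (mset (real_blocks X)) (0, \<rho>) = 0" for X :: "real^'n^'n" and \<rho>
    using jordan_list_block_pos[of 0 _ X] by (auto simp: real_blocks_def count_eq_zero_iff)
  show ?thesis
  proof (rule multiset_eqI)
    fix x :: "nat \<times> real"
    obtain k \<rho> where x: "x = (k, \<rho>)" by (cases x)
    show "count (mset (real_blocks A)) x = count (mset (real_blocks B)) x"
    proof (cases k)
      case 0 then show ?thesis by (simp add: x cnt0)
    next
      case (Suc j)
      then show ?thesis using cnt[of A j \<rho>] cnt[of B j \<rho>] h[of \<rho> j] h[of \<rho> "Suc j"] by (simp add: x)
    qed
  qed
qed

lemma real_part_jordan_form_eqI:
  fixes A B :: "real^'n^'n"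
  assumes "\<And>\<rho> m. card (slow_positions (jpos A) \<rho> m) = card (slow_positions (jpos B) \<rho> m)"
  shows "real_part_jordan_form A = real_part_jordan_form B"
  unfolding real_part_jordan_form_eq
  using sort_key_snd_fst_eq[OF mset_real_blocks_eq[OF assms]] by simp

lemma sum_list_real_blocks: "sum_list (map fst (real_blocks (A :: real^'n^'n))) = CARD('n)"
proof -
  have "map fst (real_blocks A) = map fst (jordan_list A)" by (simp add: real_blocks_def case_prod_beta o_def)
  then show ?thesis by (simp add: sum_list_jordan_list)
qed

lemma real_part_jordan_form_similar:
  fixes A B :: "real^'n^'n"
  assumes "real_part_jordan_form A = real_part_jordan_form B"
  obtains W V :: "real^'n^'n" where "W ** V = mat 1" "V ** W = mat 1"
    "jmat (jordan_positions (real_blocks A)) = W ** jmat (jordan_positions (real_blocks B)) ** V"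
proof -
  have s: "similar_mat (jordan_matrix (real_blocks X)) (real_part_jordan_form X)" for X :: "real^'n^'n"
    unfolding real_part_jordan_form_eq by (rule similar_jordan_mset) simp
  have "similar_mat (jordan_matrix (real_blocks A)) (jordan_matrix (real_blocks B))"
    using s[of A] similar_mat_sym[OF s[of B]] assms similar_mat_trans by metis
  moreover have "jordan_matrix (real_blocks A) \<in> carrier_mat CARD('n) CARD('n)"
    using jordan_matrix_carrier[of "real_blocks A"] by (simp add: sum_list_real_blocks)
  ultimately obtain W V :: "real^'n^'n" where "W ** V = mat 1" "V ** W = mat 1"
    "of_mat (jordan_matrix (real_blocks A)) = W ** of_mat (jordan_matrix (real_blocks B)) ** V"
    by (rule of_mat_similar)
  with that show ?thesis by (simp add: of_mat_jordan_matrix[OF sum_list_real_blocks])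
qed

subsection \<open>Equal forms give a linear quasisymmetric map\<close>

definition real_positions :: "(complex \<times> nat) list \<Rightarrow> (real \<times> nat) list" where
  "real_positions L = map (\<lambda>(a, r). (Re a, r)) L"

lemma jordan_positions_real_blocks: "jordan_positions (real_blocks A) = real_positions (jpos A)"
proof -
  have "jordan_positions (map (\<lambda>(k, a). (k, Re a)) xs) = real_positions (jordan_positions xs)" for xs
    by (induction xs) (auto simp: real_positions_def)
  then show ?thesis by (simp add: real_blocks_def)
qed

lemma real_positions_chain:
  assumes "position_chain L" shows "position_chain (real_positions L)"
  using assms unfolding position_chain_def real_positions_def by (auto simp: case_prod_beta)

text \<open>The unitary factor of the exponential, coming from the imaginary parts of the
  diagonal.\<close>

definition udiag :: "(complex \<times> nat) list \<Rightarrow> real \<Rightarrow> complex^'n^'n" where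
  "udiag L t = (\<chi> i j. if i = j then cis (t * Im (fst (L ! idx i))) else 0)"

lemma udiag_mult_entry:
  "(X ** udiag L t) $ i $ j = X $ i $ j * cis (t * Im (fst (L ! idx j)))"
  "(udiag L t ** X) $ i $ j = cis (t * Im (fst (L ! idx i))) * X $ i $ j"
proof -
  have "(X ** udiag L t) $ i $ j = (\<Sum>k\<in>UNIV. if k = j then X $ i $ j * cis (t * Im (fst (L ! idx j))) else 0)"
    unfolding matrix_matrix_mult_def vec_lambda_beta by (intro sum.cong refl) (auto simp: udiag_def)
  then show "(X ** udiag L t) $ i $ j = X $ i $ j * cis (t * Im (fst (L ! idx j)))" by simp
  have "(udiag L t ** X) $ i $ j = (\<Sum>k\<in>UNIV. if k = i then cis (t * Im (fst (L ! idx i))) * X $ i $ j else 0)"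
    unfolding matrix_matrix_mult_def vec_lambda_beta by (intro sum.cong refl) (auto simp: udiag_def)
  then show "(udiag L t ** X) $ i $ j = cis (t * Im (fst (L ! idx i))) * X $ i $ j" by simp
qed

text \<open>The diagonal entry is constant on each block, so the imaginary part of the diagonal
  commutes with the rest of the Jordan matrix, which is real.\<close>

lemma jexp_factor:
  fixes L :: "(complex \<times> nat) list"
  assumes L: "position_chain L" "length L = CARD('n)"
  shows "(jexp L t :: complex^'n^'n) = cmat (mexp (t *\<^sub>R jmat (real_positions L))) ** udiag L t"
    and "(jexp L t :: complex^'n^'n) = udiag L t ** cmat (mexp (t *\<^sub>R jmat (real_positions L)))"
proof -
  have L': "position_chain (real_positions L)" "length (real_positions L) = CARD('n)"
    using L real_positions_chain by (auto simp: real_positions_def)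
  have n: "fst (real_positions L ! idx i) = Re (fst (L ! idx i))" "snd (real_positions L ! idx i) = snd (L ! idx i)" for i :: 'n
    using L by (simp_all add: real_positions_def case_prod_beta)
  have e: "exp (t *\<^sub>R z) = of_real (exp (t * Re z)) * cis (t * Im z)" for z
    by (simp add: exp_eq_polar)
  have entry: "(jexp L t :: complex^'n^'n) $ i $ j = cmat (mexp (t *\<^sub>R jmat (real_positions L))) $ i $ j * cis (t * Im (fst (L ! idx i)))" for i j
    by (simp add: jexp_entry[OF L] cmat_def mexp_jmat[OF L'] n e)
  \<comment> \<open>A nonzero entry joins two positions of one block, so the phases belonging to its
    row and its column agree.\<close>
  have same: "fst (L ! idx j) = fst (L ! idx i)" if "(jexp L t :: complex^'n^'n) $ i $ j \<noteq> 0" for i j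
  proof -
    have "idx i \<le> idx j \<and> idx j - idx i \<le> snd (L ! idx i)" using that by (auto simp: jexp_entry[OF L] split: if_splits)
    then show ?thesis using position_chain_iter[OF L(1), of "idx i" "idx j - idx i"] L(2) by simp
  qed
  show "(jexp L t :: complex^'n^'n) = udiag L t ** cmat (mexp (t *\<^sub>R jmat (real_positions L)))"
    by (simp add: Finite_Cartesian_Product.vec_eq_iff udiag_mult_entry entry mult.commute)
  show "(jexp L t :: complex^'n^'n) = cmat (mexp (t *\<^sub>R jmat (real_positions L))) ** udiag L t"
    unfolding Finite_Cartesian_Product.vec_eq_iff udiag_mult_entry
  proof (intro allI)
    fix i j
    show "(jexp L t :: complex^'n^'n) $ i $ j = cmat (mexp (t *\<^sub>R jmat (real_positions L))) $ i $ j * cis (t * Im (fst (L ! idx j)))"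
    proof (cases "(jexp L t :: complex^'n^'n) $ i $ j = 0")
      case True
      then have "cmat (mexp (t *\<^sub>R jmat (real_positions L))) $ i $ j = 0" unfolding entry by simp
      with True show ?thesis by simp
    next
      case False
      then show ?thesis using entry[of i j] same[of i j] by simp
    qed
  qed
qed

definition entries_bounded :: "(real \<Rightarrow> complex^'n^'n) \<Rightarrow> bool" where
  "entries_bounded X \<longleftrightarrow> (\<exists>C. \<forall>t i j. norm (X t $ i $ j) \<le> C)"

lemma entries_bounded_const: "entries_bounded (\<lambda>t. X)"
proof -
  have "norm (X $ i $ j) \<le> (\<Sum>i\<in>UNIV. \<Sum>j\<in>UNIV. norm (X $ i $ j))" for i j
  proof -
    have "norm (X $ i $ j) \<le> (\<Sum>j\<in>UNIV. norm (X $ i $ j))" by (rule member_le_sum) auto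
    also have "\<dots> \<le> (\<Sum>i\<in>UNIV. \<Sum>j\<in>UNIV. norm (X $ i $ j))" by (rule member_le_sum) (auto intro: sum_nonneg)
    finally show ?thesis .
  qed
  then show ?thesis unfolding entries_bounded_def by blast
qed

lemma entries_bounded_mult:
  fixes X Y :: "real \<Rightarrow> complex^'n^'n"
  assumes "entries_bounded X" "entries_bounded Y"
  shows "entries_bounded (\<lambda>t. X t ** Y t)"
proof -
  obtain C where C: "\<And>t i j. norm (X t $ i $ j) \<le> C" using assms unfolding entries_bounded_def by blast
  obtain C' where C': "\<And>t i j. norm (Y t $ i $ j) \<le> C'" using assms unfolding entries_bounded_def by blast
  have "norm ((X t ** Y t) $ i $ j) \<le> (\<Sum>k\<in>(UNIV::'n set). C * C')" for t i j
    unfolding matrix_matrix_mult_def vec_lambda_beta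
    by (intro order_trans[OF norm_sum] sum_mono)
       (simp add: norm_mult mult_mono C C' order_trans[OF norm_ge_zero C])
  then show ?thesis unfolding entries_bounded_def by blast
qed

lemma entries_bounded_udiag: "entries_bounded (\<lambda>t. udiag L (k * t))"
  unfolding entries_bounded_def by (rule exI[of _ 1]) (simp add: udiag_def)

lemma det_cmat: "det (cmat X) = complex_of_real (det X)"
  by (simp add: Determinants.det_def cmat_def)

text \<open>The determinant of \<open>X + z Y\<close> is a polynomial in \<open>z\<close> that does
  not vanish at the imaginary unit. It has finitely many roots, and some real \<open>z\<close>
  avoids them.\<close>

lemma exists_real_combination_invertible:
  fixes X Y :: "real^'n^'n"
  assumes "det (\<chi> i j. Complex (X $ i $ j) (Y $ i $ j)) \<noteq> 0"
  shows "\<exists>r::real. det (X + r *\<^sub>R Y) \<noteq> 0"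
proof -
  define Z :: "complex poly^'n^'n" where
    "Z = (\<chi> i j. [:complex_of_real (X $ i $ j), complex_of_real (Y $ i $ j):])"
  have pz: "poly (det Z) z = det (\<chi> i j. complex_of_real (X $ i $ j) + z * complex_of_real (Y $ i $ j))" for z
    by (simp add: Determinants.det_def Z_def poly_sum poly_prod)
  have "(\<chi> i j. complex_of_real (X $ i $ j) + \<i> * complex_of_real (Y $ i $ j)) = (\<chi> i j. Complex (X $ i $ j) (Y $ i $ j))"
    by (simp add: Finite_Cartesian_Product.vec_eq_iff complex_eq_iff)
  then have "poly (det Z) \<i> \<noteq> 0" using assms by (simp add: pz)
  then have "det Z \<noteq> 0" by auto
  then have "finite {z. poly (det Z) z = 0}" by (rule poly_roots_finite)
  then have "finite (of_real -` {z. poly (det Z) z = 0} :: real set)"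
    by (rule finite_vimageI) (simp add: inj_on_def)
  then obtain r :: real where r: "poly (det Z) (of_real r) \<noteq> 0"
    using ex_new_if_finite[OF infinite_UNIV_char_0] by fastforce
  have "(\<chi> i j. complex_of_real (X $ i $ j) + complex_of_real r * complex_of_real (Y $ i $ j)) = cmat (X + r *\<^sub>R Y)"
    by (simp add: cmat_def Finite_Cartesian_Product.vec_eq_iff)
  then have "complex_of_real (det (X + r *\<^sub>R Y)) \<noteq> 0" using r by (simp add: pz det_cmat)
  then show ?thesis by auto
qed

text \<open>The complex conjugation of the two one-parameter groups is bounded because only the unitary
  parts of the Jordan matrices differ. Its real and imaginary parts are bounded as well, and some
  real combination of them is invertible.\<close>

lemma bounded_real_conjugation:
  fixes A B :: "real^'n^'n"
  assumes "real_part_jordan_form A = real_part_jordan_form B"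
  obtains F :: "real^'n^'n" and C where "det F \<noteq> 0"
    "\<And>t i j. \<bar>(matrix_exp ((- t) *\<^sub>R B) ** F ** matrix_exp (t *\<^sub>R A)) $ i $ j\<bar> \<le> C"
proof -
  obtain W V :: "real^'n^'n" where WV: "W ** V = mat 1" "V ** W = mat 1"
    and R: "jmat (real_positions (jpos A)) = W ** jmat (real_positions (jpos B)) ** V"
    using real_part_jordan_form_similar[OF assms] unfolding jordan_positions_real_blocks by metis
  let ?RA = "jmat (real_positions (jpos A)) :: real^'n^'n" and ?RB = "jmat (real_positions (jpos B)) :: real^'n^'n"
  have RA: "mexp (t *\<^sub>R ?RA) = W ** mexp (t *\<^sub>R ?RB) ** V" for t
  proof -
    have "t *\<^sub>R ?RA = W ** (t *\<^sub>R ?RB) ** V"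
      unfolding R by (simp add: Finite_Cartesian_Product.vec_eq_iff matrix_mult3_entry scaleR_sum_right sum_distrib_left mult_ac)
    then show ?thesis by (simp add: mexp_conj[OF WV(2,1)])
  qed
  obtain P P' :: "complex^'n^'n" where P: "P ** P' = mat 1" "P' ** P = mat 1"
    and MA: "\<And>t. cmat (matrix_exp (t *\<^sub>R A)) = P ** jexp (jpos A) t ** P'"
    by (rule matrix_exp_jordan[of A], rule that)
  obtain Q Q' :: "complex^'n^'n" where Q: "Q ** Q' = mat 1" "Q' ** Q = mat 1"
    and MB: "\<And>t. cmat (matrix_exp (t *\<^sub>R B)) = Q ** jexp (jpos B) t ** Q'"
    by (rule matrix_exp_jordan[of B], rule that)
  \<comment> \<open>In Jordan coordinates this is the real similarity \<open>V\<close> between the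
    two real part matrices.\<close>
  define H where "H = Q ** cmat V ** P'"
  have cWV: "cmat V ** cmat W = mat 1" "cmat W ** cmat V = mat 1" using WV by (simp_all flip: cmat_mult)
  have conj: "cmat (matrix_exp ((- t) *\<^sub>R B)) ** H ** cmat (matrix_exp (t *\<^sub>R A)) =
      Q ** udiag (jpos B) ((- 1) * t) ** cmat V ** udiag (jpos A) (1 * t) ** P'" for t
  proof -
    let ?E = "\<lambda>t. cmat (mexp (t *\<^sub>R ?RB))"
    have EE: "?E (- t) ** ?E t = mat 1"
    proof -
      have "mexp ((- t) *\<^sub>R ?RB) ** mexp (t *\<^sub>R ?RB) = mat 1"
        using mexp_scaleR_add[of "- t" t ?RB, symmetric] by (simp only: add.left_inverse scaleR_zero_left mexp_0)
      then show ?thesis unfolding cmat_mult[symmetric] by simp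
    qed
    \<comment> \<open>The factorisation is used in one order for \<open>B\<close> and in the other
      for \<open>A\<close>: the phases go to the outside, and the real exponentials meet in the
      middle.\<close>
    have "cmat (matrix_exp ((- t) *\<^sub>R B)) ** H ** cmat (matrix_exp (t *\<^sub>R A)) =
      (Q ** (udiag (jpos B) (- t) ** ?E (- t)) ** Q') ** (Q ** cmat V ** P') ** (P ** ((cmat W ** ?E t ** cmat V) ** udiag (jpos A) t) ** P')"
      unfolding MA MB H_def jexp_factor(2)[OF jpos_chain, of B "- t"] jexp_factor(1)[OF jpos_chain, of A t] RA cmat_mult ..
    also have "\<dots> = Q ** udiag (jpos B) (- t) ** ?E (- t) ** (Q' ** Q) ** cmat V ** (P' ** P) ** cmat W ** ?E t ** cmat V ** udiag (jpos A) t ** P'"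
      by (simp only: matrix_mul_assoc)
    also have "\<dots> = Q ** udiag (jpos B) (- t) ** ?E (- t) ** (cmat V ** cmat W) ** ?E t ** cmat V ** udiag (jpos A) t ** P'"
      by (simp only: P Q matrix_mul_rid matrix_mul_assoc)
    also have "\<dots> = Q ** udiag (jpos B) (- t) ** (?E (- t) ** ?E t) ** cmat V ** udiag (jpos A) t ** P'"
      by (simp only: cWV matrix_mul_rid matrix_mul_assoc)
    also have "\<dots> = Q ** udiag (jpos B) (- t) ** cmat V ** udiag (jpos A) t ** P'"
      by (simp only: EE matrix_mul_rid)
    finally show ?thesis by simp
  qed
  have "entries_bounded (\<lambda>t. cmat (matrix_exp ((- t) *\<^sub>R B)) ** H ** cmat (matrix_exp (t *\<^sub>R A)))"
    unfolding conj by (intro entries_bounded_mult entries_bounded_const entries_bounded_udiag)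
  then obtain C where C: "\<And>t i j. norm ((cmat (matrix_exp ((- t) *\<^sub>R B)) ** H ** cmat (matrix_exp (t *\<^sub>R A))) $ i $ j) \<le> C"
    unfolding entries_bounded_def by blast
  define X Y :: "real^'n^'n" where "X = (\<chi> i j. Re (H $ i $ j))" and "Y = (\<chi> i j. Im (H $ i $ j))"
  have H: "H = (\<chi> i j. Complex (X $ i $ j) (Y $ i $ j))"
    by (simp add: X_def Y_def Finite_Cartesian_Product.vec_eq_iff)
  have ReIm: "Re ((cmat S ** H ** cmat T) $ i $ j) = (S ** X ** T) $ i $ j"
    "Im ((cmat S ** H ** cmat T) $ i $ j) = (S ** Y ** T) $ i $ j" for S T :: "real^'n^'n" and i j
    by (simp_all add: matrix_mult3_entry X_def Y_def cmat_def)
  have bX: "\<bar>(matrix_exp ((- t) *\<^sub>R B) ** X ** matrix_exp (t *\<^sub>R A)) $ i $ j\<bar> \<le> C"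
    and bY: "\<bar>(matrix_exp ((- t) *\<^sub>R B) ** Y ** matrix_exp (t *\<^sub>R A)) $ i $ j\<bar> \<le> C" for t i j
    unfolding ReIm[symmetric] by (rule order_trans[OF abs_Re_le_cmod C] order_trans[OF abs_Im_le_cmod C])+
  have "det H * det (P ** cmat W ** Q') = 1"
  proof -
    have "H ** (P ** cmat W ** Q') = Q ** cmat V ** (P' ** P) ** cmat W ** Q'" by (simp only: H_def matrix_mul_assoc)
    also have "\<dots> = Q ** (cmat V ** cmat W) ** Q'" by (simp only: P matrix_mul_rid matrix_mul_assoc)
    also have "\<dots> = mat 1" by (simp only: cWV matrix_mul_rid Q)
    finally show ?thesis by (metis det_mul det_I)
  qed
  then have "det H \<noteq> 0" by auto
  then obtain r where r: "det (X + r *\<^sub>R Y) \<noteq> 0"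
    using exists_real_combination_invertible[of X Y] unfolding H by blast
  have "\<bar>(matrix_exp ((- t) *\<^sub>R B) ** (X + r *\<^sub>R Y) ** matrix_exp (t *\<^sub>R A)) $ i $ j\<bar> \<le> C + \<bar>r\<bar> * C" for t i j
  proof -
    have "(matrix_exp ((- t) *\<^sub>R B) ** (X + r *\<^sub>R Y) ** matrix_exp (t *\<^sub>R A)) $ i $ j =
      (matrix_exp ((- t) *\<^sub>R B) ** X ** matrix_exp (t *\<^sub>R A)) $ i $ j + r * (matrix_exp ((- t) *\<^sub>R B) ** Y ** matrix_exp (t *\<^sub>R A)) $ i $ j"
      by (simp add: matrix_mult3_entry sum.distrib sum_distrib_left algebra_simps)
    also have "\<bar>\<dots>\<bar> \<le> C + \<bar>r\<bar> * C"
      by (intro order_trans[OF abs_triangle_ineq] add_mono bX) (simp only: abs_mult, rule mult_left_mono[OF bY abs_ge_zero])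
    finally show ?thesis .
  qed
  with r that show ?thesis by blast
qed

text \<open>The determinant of the conjugate is \<open>exp ((a - b) * t) * det F\<close>.
  Boundedness for all real \<open>t\<close>, of both signs, forces \<open>a = b\<close>; the
  determinant is then constant, and Cramer's rule turns the upper bound on the entries into a lower
  bound on vectors.\<close>

lemma bounded_conjugation_bilipschitz:
  fixes A B F :: "real^'n^'n"
  assumes detA: "\<And>t. det (matrix_exp (t *\<^sub>R A)) = exp (a * t)" and detB: "\<And>t. det (matrix_exp (t *\<^sub>R B)) = exp (b * t)"
    and F: "det F \<noteq> 0" and C: "\<And>t i j. \<bar>(matrix_exp ((- t) *\<^sub>R B) ** F ** matrix_exp (t *\<^sub>R A)) $ i $ j\<bar> \<le> C"
  obtains k k' where "k > 0" "k' > 0"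
    "\<And>t x. k * norm x \<le> norm ((matrix_exp ((- t) *\<^sub>R B) ** F ** matrix_exp (t *\<^sub>R A)) *v x)"
    "\<And>t x. norm ((matrix_exp ((- t) *\<^sub>R B) ** F ** matrix_exp (t *\<^sub>R A)) *v x) \<le> k' * norm x"
proof -
  let ?G = "\<lambda>t. matrix_exp ((- t) *\<^sub>R B) ** F ** matrix_exp (t *\<^sub>R A)"
  define C' where "C' = max C 1"
  have C': "C' > 0" "\<And>t i j. \<bar>?G t $ i $ j\<bar> \<le> C'" using C by (auto simp: C'_def intro: le_max_iff_disj[THEN iffD2])
  have detG: "det (?G t) = exp ((a - b) * t) * det F" for t
    using detA[of t] detB[of "- t"] by (simp add: det_mul left_diff_distrib exp_diff exp_minus field_simps)
  have db: "\<bar>det (?G t)\<bar> \<le> fact CARD('n) * (C' * C' ^ (CARD('n) - 1))" for t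
    by (rule abs_det_le) (rule C')+
  have "a = b"
  proof (rule ccontr)
    assume "a \<noteq> b"
    define K where "K = fact CARD('n) * (C' * C' ^ (CARD('n) - 1)) / \<bar>det F\<bar>"
    have K: "exp ((a - b) * t) \<le> K" for t
    proof -
      have "exp ((a - b) * t) * \<bar>det F\<bar> \<le> fact CARD('n) * (C' * C' ^ (CARD('n) - 1))"
        using db[of t] unfolding detG abs_mult by simp
      then show ?thesis using F by (simp add: K_def pos_le_divide_eq)
    qed
    \<comment> \<open>The time is chosen to make the exponent equal to \<open>K\<close>, since
      \<open>exp K \<le> K\<close> is impossible.\<close>
    have "(a - b) * (K / (a - b)) = K" using \<open>a \<noteq> b\<close> by simp
    then have "exp K \<le> K" using K[of "K / (a - b)"] by simp
    then show False using exp_ge_add_one_self[of K] by simp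
  qed
  obtain K where K: "K > 0" "\<And>(X::real^'n^'n) x. \<forall>i j. \<bar>X $ i $ j\<bar> \<le> C' \<Longrightarrow> \<bar>det X\<bar> * norm x \<le> K * norm (X *v x)"
    by (rule det_vec_bound[OF C'(1)], rule that)
  show ?thesis
  proof (rule that)
    show "\<bar>det F\<bar> / K > 0" using F K by simp
    show "real CARD('n) * real CARD('n) * C' > 0" using C' by simp
    show "\<bar>det F\<bar> / K * norm x \<le> norm (?G t *v x)" for t x
    proof -
      have "\<bar>det (?G t)\<bar> * norm x \<le> K * norm (?G t *v x)" using K(2) C'(2) by blast
      moreover have "det (?G t) = det F" unfolding detG \<open>a = b\<close> by simp
      ultimately show ?thesis using K(1) by (simp add: field_simps)
    qed
    show "norm (?G t *v x) \<le> real CARD('n) * real CARD('n) * C' * norm x" for t x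
      by (rule norm_matrix_vector_le) (rule C')
  qed
qed

lemma homeomorphism_power_gauge:
  assumes "K > 0" "s > 0"
  shows "homeomorphism {0..} {0..} (\<lambda>r::real. K * r powr s) (\<lambda>r. (r / K) powr (1 / s))"
  unfolding homeomorphism_def
proof (intro conjI ballI)
  show c1: "continuous_on {0..} (\<lambda>r::real. K * r powr s)" "continuous_on {0..} (\<lambda>r. (r / K) powr (1 / s))"
    using assms by (intro continuous_intros continuous_on_powr'; auto)+
  have inv: "(K * r powr s / K) powr (1 / s) = r" "K * ((r / K) powr (1 / s)) powr s = r" if "r \<in> {0..}" for r
    using assms that by (auto simp: powr_powr)
  then show "(K * r powr s / K) powr (1 / s) = r" "K * ((r / K) powr (1 / s)) powr s = r" if "r \<in> {0..}" for r
    using that by auto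
  show "(\<lambda>r. K * r powr s) ` {0..} = {0..}"
  proof (intro equalityI subsetI)
    fix r :: real assume "r \<in> {0..}"
    then show "r \<in> (\<lambda>r. K * r powr s) ` {0..}" using inv(2)[of r] by (intro image_eqI[of _ _ "(r / K) powr (1 / s)"]) auto
  qed (use assms in auto)
  show "(\<lambda>r. (r / K) powr (1 / s)) ` {0..} = {0..}"
  proof (intro equalityI subsetI)
    fix r :: real assume "r \<in> {0..}"
    then show "r \<in> (\<lambda>r. (r / K) powr (1 / s)) ` {0..}" using inv(1)[of r] assms by (intro image_eqI[of _ _ "K * r powr s"]) auto
  qed (use assms in auto)
qed

text \<open>The linear map \<open>F\<close> makes \<open>D'\<close> comparable to
  \<open>D powr s\<close>: at scale \<open>s * ln (D x y)\<close> the image of \<open>x - y\<close>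
  has norm of order one. A multiple of \<open>r powr s\<close> then serves as control
  function.\<close>

lemma quasisymmetric_of_equal_forms:
  fixes A B :: "real^'n^'n"
  assumes "dilation (\<lambda>t. matrix_exp (t *\<^sub>R A)) D a" and "dilation (\<lambda>t. matrix_exp (t *\<^sub>R B)) D' b"
    and s: "s > 0" and form: "real_part_jordan_form A = real_part_jordan_form (s *\<^sub>R B)"
  shows "\<exists>F. quasisymmetric D D' F"
proof -
  interpret A: dilation "\<lambda>t. matrix_exp (t *\<^sub>R A)" D a by fact
  interpret B: dilation "\<lambda>t. matrix_exp (t *\<^sub>R B)" D' b by fact
  obtain F :: "real^'n^'n" and C where F: "det F \<noteq> 0"
    and C: "\<And>t i j. \<bar>(matrix_exp ((- t) *\<^sub>R (s *\<^sub>R B)) ** F ** matrix_exp (t *\<^sub>R A)) $ i $ j\<bar> \<le> C"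
    using bounded_real_conjugation[OF form] by metis
  have detB: "det (matrix_exp (t *\<^sub>R (s *\<^sub>R B))) = exp ((b * s) * t)" for t
    using B.M_det[of "t * s"] by (simp add: mult_ac)
  obtain k k' where k: "k > 0" "k' > 0"
    "\<And>t x. k * norm x \<le> norm ((matrix_exp ((- t) *\<^sub>R (s *\<^sub>R B)) ** F ** matrix_exp (t *\<^sub>R A)) *v x)"
    "\<And>t x. norm ((matrix_exp ((- t) *\<^sub>R (s *\<^sub>R B)) ** F ** matrix_exp (t *\<^sub>R A)) *v x) \<le> k' * norm x"
    by (rule bounded_conjugation_bilipschitz[OF A.M_det detB F C], rule that)
  obtain c c' where c: "c > 0" "c' > 0" "\<And>x y. x \<noteq> y \<Longrightarrow> c \<le> norm (matrix_exp ((- ln (D x y)) *\<^sub>R A) *v (x - y))"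
    "\<And>x y. x \<noteq> y \<Longrightarrow> norm (matrix_exp ((- ln (D x y)) *\<^sub>R A) *v (x - y)) \<le> c'"
    using A.D_scale by metis
  have bij: "bij (\<lambda>x. F *v x)"
    using F by (metis invertible_det_nz invertible_eq_bij)
  have level: "k * c \<le> norm (matrix_exp ((- (s * ln (D x y))) *\<^sub>R B) *v (F *v x - F *v y)) \<and>
      norm (matrix_exp ((- (s * ln (D x y))) *\<^sub>R B) *v (F *v x - F *v y)) \<le> k' * c'" if xy: "x \<noteq> y" for x y
  proof -
    let ?T = "ln (D x y)" let ?v = "matrix_exp ((- ?T) *\<^sub>R A) *v (x - y)"
    have sc: "(- ?T) *\<^sub>R (s *\<^sub>R B) = (- (s * ?T)) *\<^sub>R B" by (simp add: mult.commute)
    have inv: "matrix_exp (?T *\<^sub>R A) *v ?v = x - y" by (rule A.M_neg(2))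
    have eq: "matrix_exp ((- (s * ?T)) *\<^sub>R B) *v (F *v x - F *v y) =
        (matrix_exp ((- ?T) *\<^sub>R (s *\<^sub>R B)) ** F ** matrix_exp (?T *\<^sub>R A)) *v ?v"
      unfolding sc matrix_vector_mul_assoc[symmetric] inv by (simp only: matrix_vector_mult_diff_distrib)
    have "k * c \<le> k * norm ?v" using c(3)[OF xy] k(1) by (intro mult_left_mono) auto
    moreover have "k' * norm ?v \<le> k' * c'" using c(4)[OF xy] k(2) by (intro mult_left_mono) auto
    ultimately show ?thesis unfolding eq using k(3)[of ?v ?T] k(4)[of ?T ?v] by linarith
  qed
  obtain \<kappa> where \<kappa>: "\<kappa> > 0" "\<And>x y t. norm (matrix_exp ((- t) *\<^sub>R B) *v (x - y)) \<le> \<kappa> \<Longrightarrow> D' x y \<le> exp t"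
    by (rule B.D_le_of_norm_le, rule that)
  obtain K where K: "K > 0" "\<And>x y t. D' x y \<le> exp t \<Longrightarrow> norm (matrix_exp ((- t) *\<^sub>R B) *v (x - y)) \<le> K"
    by (rule B.norm_le_of_D_le, rule that)
  have kc: "k * c / 2 > 0" using k c by simp
  \<comment> \<open>Shifting the scale by \<open>T0\<close> or \<open>T1\<close> brings bounded
    vectors below the thresholds of the two comparisons; half of \<open>k * c\<close> makes the
    second contradiction strict.\<close>
  obtain T0 where T0: "\<And>x. norm x \<le> k' * c' \<Longrightarrow> norm (matrix_exp ((- T0) *\<^sub>R B) *v x) \<le> \<kappa>"
    using B.M_shrink[OF \<kappa>(1), of "k' * c'"] by metis
  obtain T1 where T1: "\<And>x. norm x \<le> K \<Longrightarrow> norm (matrix_exp ((- T1) *\<^sub>R B) *v x) \<le> k * c / 2"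
    using B.M_shrink[OF kc, of K] by metis
  have upper: "D' (F *v x) (F *v y) \<le> exp T0 * D x y powr s" and lower: "D x y powr s \<le> exp T1 * D' (F *v x) (F *v y)"
    if xy: "x \<noteq> y" for x y
  proof -
    let ?S = "s * ln (D x y)" let ?w = "F *v x - F *v y"
    have pw: "D x y powr s = exp ?S" using A.D_pos[OF xy] by (simp add: powr_def mult.commute)
    have "D' (F *v x) (F *v y) \<le> exp (T0 + ?S)"
    proof (rule \<kappa>)
      have "norm (matrix_exp ((- (T0 + ?S)) *\<^sub>R B) *v ?w) = norm (matrix_exp ((- T0) *\<^sub>R B) *v (matrix_exp ((- ?S) *\<^sub>R B) *v ?w))"
        unfolding B.M_mult_vec by simp
      also have "\<dots> \<le> \<kappa>" using level[OF xy] by (intro T0) simp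
      finally show "norm (matrix_exp ((- (T0 + ?S)) *\<^sub>R B) *v ?w) \<le> \<kappa>" .
    qed
    then show "D' (F *v x) (F *v y) \<le> exp T0 * D x y powr s" by (simp add: pw exp_add)
    have "\<not> D' (F *v x) (F *v y) \<le> exp (?S - T1)"
    proof
      assume "D' (F *v x) (F *v y) \<le> exp (?S - T1)"
      then have n: "norm (matrix_exp ((- (?S - T1)) *\<^sub>R B) *v ?w) \<le> K" by (rule K)
      have "k * c \<le> norm (matrix_exp ((- ?S) *\<^sub>R B) *v ?w)" using level[OF xy] by simp
      also have "\<dots> = norm (matrix_exp ((- T1) *\<^sub>R B) *v (matrix_exp ((- (?S - T1)) *\<^sub>R B) *v ?w))"
        unfolding B.M_mult_vec by simp
      also have "\<dots> \<le> k * c / 2" by (rule T1[OF n])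
      finally show False using kc by linarith
    qed
    then show "D x y powr s \<le> exp T1 * D' (F *v x) (F *v y)"
      by (simp add: pw exp_diff field_simps)
  qed
  let ?K = "exp T0 * exp T1"
  have "eta_quasisymmetric (\<lambda>r. ?K * r powr s) D D' (\<lambda>x. F *v x)"
    unfolding eta_quasisymmetric_def
  proof (intro conjI allI impI bij)
    fix x y z :: "real^'n" assume "x \<noteq> y \<and> y \<noteq> z \<and> x \<noteq> z"
    then have xy: "x \<noteq> y" and xz: "x \<noteq> z" by auto
    have pos: "D x y powr s > 0" "D x z powr s > 0" using A.D_pos[OF xy] A.D_pos[OF xz] by auto
    have "F *v x \<noteq> F *v z" using bij xz by (metis bij_pointE)
    then have p': "D' (F *v x) (F *v z) > 0" by (rule B.D_pos)
    have "D' (F *v x) (F *v y) / D' (F *v x) (F *v z) \<le> (exp T0 * D x y powr s) / (D x z powr s / exp T1)"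
      using upper[OF xy] lower[OF xz] pos p' by (intro frac_le) (auto simp: field_simps)
    also have "\<dots> = ?K * (D x y / D x z) powr s"
      using A.D_pos[OF xy] A.D_pos[OF xz] by (simp add: powr_divide field_simps)
    finally show "D' (F *v x) (F *v y) / D' (F *v x) (F *v z) \<le> ?K * (D x y / D x z) powr s" .
  qed
  then show ?thesis unfolding quasisymmetric_def using homeomorphism_power_gauge[of ?K s] s by auto
qed

subsection \<open>Quasisymmetric maps preserve the form\<close>

text \<open>If the value 0 were taken at an interior point, strict monotonicity of a continuous
  injection would give a negative value on one side of it.\<close>

lemma homeomorphism_half_line_at_zero:
  fixes \<eta> \<theta> :: "real \<Rightarrow> real"
  assumes "homeomorphism {0..} {0..} \<eta> \<theta>"
  shows "\<eta> 0 = 0"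
proof (rule ccontr)
  assume "\<eta> 0 \<noteq> 0"
  have cont: "continuous_on {0..} \<eta>" and img: "\<eta> ` {0..} = {0..}" and inv: "\<And>x. x \<ge> 0 \<Longrightarrow> \<theta> (\<eta> x) = x"
    using assms by (auto simp: homeomorphism_def)
  have "0 \<in> \<eta> ` {0..}" using img by simp
  then obtain u where u: "u \<ge> 0" "\<eta> u = 0" by auto
  then have "u > 0" using \<open>\<eta> 0 \<noteq> 0\<close> by (cases "u = 0") auto
  have nn: "\<eta> x \<ge> 0" if "x \<ge> 0" for x using img that by auto
  have "(\<eta> 0 < \<eta> u \<and> \<eta> u < \<eta> (u + 1)) \<or> (\<eta> (u + 1) < \<eta> u \<and> \<eta> u < \<eta> 0)"
  proof (rule continuous_inj_imp_mono[where f = \<eta> and a = 0 and x = u and b = "u + 1"])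
    show "continuous_on {0..u + 1} \<eta>" using cont by (rule continuous_on_subset) auto
    show "inj_on \<eta> {0..u + 1}" by (rule inj_onI) (metis atLeastAtMost_iff inv)
  qed (use \<open>u > 0\<close> in auto)
  then show False using nn[of 0] nn[of "u + 1"] u by auto
qed

text \<open>Smallness of \<open>\<eta>\<close> near 0 controls the inverse of \<open>F\<close> and
  yields \<open>\<Lambda>\<close>; boundedness of \<open>\<eta>\<close> on the unit interval
  controls \<open>F\<close> and yields \<open>\<Lambda>'\<close>.\<close>

lemma quasisymmetric_imp_weak_qs:
  fixes M M' :: "real \<Rightarrow> real^'n^'n"
  assumes "dilation M D a" and "dilation M' D' b" and "quasisymmetric D D' F"
  obtains G \<Lambda> \<Lambda>' where "weak_qs M D a M' D' b F G \<Lambda>" "weak_qs M' D' b M D a G F \<Lambda>'"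
proof -
  interpret A: dilation M D a by fact
  interpret B: dilation M' D' b by fact
  obtain \<eta> \<theta> where hom: "homeomorphism {0..} {0..} \<eta> \<theta>" and qs: "eta_quasisymmetric \<eta> D D' F"
    using assms(3) unfolding quasisymmetric_def by blast
  have bij: "bij F" and qs: "\<And>x y z. x \<noteq> y \<Longrightarrow> y \<noteq> z \<Longrightarrow> x \<noteq> z \<Longrightarrow> D' (F x) (F y) / D' (F x) (F z) \<le> \<eta> (D x y / D x z)"
    using qs unfolding eta_quasisymmetric_def by blast+
  have cont: "continuous_on {0..} \<eta>" using hom by (simp add: homeomorphism_def)
  have \<eta>0: "\<eta> 0 = 0" using hom by (rule homeomorphism_half_line_at_zero)
  have inj: "F x \<noteq> F y" if "x \<noteq> y" for x y using bij that by (metis bij_pointE)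
  have \<eta>small: "\<exists>\<tau>>0. \<forall>r. 0 \<le> r \<and> r \<le> \<tau> \<longrightarrow> \<eta> r \<le> \<epsilon>" if "\<epsilon> > 0" for \<epsilon>
  proof -
    have "\<exists>d>0. \<forall>r\<in>{0..}. dist r 0 < d \<longrightarrow> dist (\<eta> r) (\<eta> 0) < \<epsilon>"
      using cont[unfolded continuous_on_iff, rule_format, of 0 \<epsilon>] that by simp
    then obtain d where d: "d > 0" "\<And>r. r \<in> {0..} \<Longrightarrow> dist r 0 < d \<Longrightarrow> dist (\<eta> r) (\<eta> 0) < \<epsilon>"
      by blast
    have "\<eta> r \<le> \<epsilon>" if "0 \<le> r" "r \<le> d / 2" for r
      using d(2)[of r] d(1) that \<eta>0 by (auto simp: dist_real_def)
    then show ?thesis using d(1) by (intro exI[of _ "d / 2"]) auto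
  qed
  have contF: "continuous_on UNIV F"
    unfolding continuous_on_iff
  proof (intro ballI allI impI)
    fix x :: "real^'n" and e :: real assume e: "e > 0"
    \<comment> \<open>The quasisymmetry inequality compares with a third point; any fixed point
      other than \<open>x\<close> will do.\<close>
    define z where "z = x + axis undefined 1"
    have xz: "x \<noteq> z" by (simp add: z_def axis_eq_0_iff)
    obtain \<delta>1 where \<delta>1: "\<delta>1 > 0" "\<And>x y. D' x y \<le> \<delta>1 \<Longrightarrow> norm (x - y) \<le> e / 2"
      using B.norm_small[of "e / 2"] e by (metis half_gt_zero)
    have p': "D' (F x) (F z) > 0" by (rule B.D_pos[OF inj[OF xz]])
    have p: "D x z > 0" by (rule A.D_pos[OF xz])
    obtain \<tau> where \<tau>: "\<tau> > 0" "\<And>r. 0 \<le> r \<Longrightarrow> r \<le> \<tau> \<Longrightarrow> \<eta> r \<le> \<delta>1 / D' (F x) (F z)"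
      using \<eta>small[of "\<delta>1 / D' (F x) (F z)"] \<delta>1(1) p' by auto
    have "\<tau> * D x z > 0" using \<tau> p by simp
    then obtain \<delta>2 where \<delta>2: "\<delta>2 > 0" "\<And>x' y. norm (x' - y) \<le> \<delta>2 \<Longrightarrow> D x' y \<le> \<tau> * D x z"
      using A.D_small by metis
    \<comment> \<open>The second bound keeps \<open>y\<close> away from \<open>z\<close>, so that
      the three points are distinct.\<close>
    define d where "d = min \<delta>2 (norm (x - z))"
    have "d > 0" using \<delta>2 xz by (simp add: d_def)
    moreover have "dist (F y) (F x) < e" if y: "dist y x < d" for y
    proof (cases "y = x")
      case False
      have "y \<noteq> z" using y by (auto simp: d_def dist_norm norm_minus_commute)
      have "D x y \<le> \<tau> * D x z" using y by (intro \<delta>2) (auto simp: d_def dist_norm norm_minus_commute)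
      then have "D x y / D x z \<le> \<tau>" using p by (simp add: field_simps)
      then have "\<eta> (D x y / D x z) \<le> \<delta>1 / D' (F x) (F z)" using A.D_nonneg p by (intro \<tau>) auto
      then have "D' (F x) (F y) / D' (F x) (F z) \<le> \<delta>1 / D' (F x) (F z)"
        using qs[of x y z] False \<open>y \<noteq> z\<close> xz by auto
      then have "D' (F x) (F y) \<le> \<delta>1" using p' by (simp add: divide_le_cancel)
      then have "norm (F x - F y) \<le> e / 2" by (rule \<delta>1)
      then show ?thesis using e by (simp add: dist_norm norm_minus_commute)
    qed (use e in simp)
    ultimately show "\<exists>d>0. \<forall>y\<in>UNIV. dist y x < d \<longrightarrow> dist (F y) (F x) < e" by blast
  qed
  define G where "G = inv_into UNIV F"
  have GF: "G (F x) = x" for x unfolding G_def using bij by (simp add: bij_is_inj)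
  have FG: "F (G y) = y" for y unfolding G_def using bij by (simp add: bij_is_surj surj_f_inv_f)
  \<comment> \<open>Continuity of the inverse comes from invariance of domain.\<close>
  have contG: "continuous_on UNIV G"
  proof -
    obtain g where g: "homeomorphism UNIV (F ` UNIV) F g"
      using invariance_of_domain_homeomorphism[OF open_UNIV contF _ bij_is_inj[OF bij]] by auto
    then have "g y = G y" for y using FG unfolding homeomorphism_def by (metis UNIV_I)
    then have "g = G" by (rule ext)
    moreover have "continuous_on UNIV g" using g bij_is_surj[OF bij] by (simp add: homeomorphism_def)
    ultimately show ?thesis by simp
  qed
  obtain \<tau> where \<tau>: "\<tau> > 0" "\<And>r. 0 \<le> r \<Longrightarrow> r \<le> \<tau> \<Longrightarrow> \<eta> r \<le> 1 / 2"
    using \<eta>small[of "1 / 2"] by auto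
  \<comment> \<open>If \<open>D x y\<close> exceeded \<open>\<Lambda> * D x z\<close>, the ratio
    \<open>D x z / D x y\<close> would be at most \<open>\<tau>\<close>, and the
    \<open>D'\<close>-distance of \<open>F x\<close> and \<open>F z\<close> at most half that of
    \<open>F x\<close> and \<open>F y\<close>.\<close>
  define \<Lambda> where "\<Lambda> = max 1 (1 / \<tau>)"
  have \<Lambda>: "\<Lambda> \<ge> 1" "1 / \<Lambda> \<le> \<tau>" using \<tau>(1) unfolding \<Lambda>_def by (auto simp: max_def field_simps)
  have weak: "D x y \<le> \<Lambda> * D x z" if le: "D' (F x) (F y) \<le> D' (F x) (F z)" for x y z
  proof (cases "x = y \<or> x = z \<or> y = z")
    case True
    then consider "x = y" | "x = z" "x \<noteq> y" | "y = z" by blast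
    then show ?thesis
    proof cases
      case 1 then show ?thesis using \<Lambda> A.D_nonneg[of x z] by (simp add: A.D_diag)
    next
      case 2 then show ?thesis using le B.D_pos[OF inj[of x y]] by (simp add: B.D_diag)
    next
      case 3 then show ?thesis using \<Lambda> A.D_nonneg[of x z] mult_right_mono[of 1 \<Lambda> "D x z"] by simp
    qed
  next
    case False
    then have p: "D x y > 0" "D' (F x) (F y) > 0" using A.D_pos B.D_pos inj by auto
    show ?thesis
    proof (rule ccontr)
      assume "\<not> ?thesis"
      then have "D x z / D x y \<le> 1 / \<Lambda>" using p \<Lambda> by (simp add: field_simps)
      then have \<eta>: "\<eta> (D x z / D x y) \<le> 1 / 2" using \<Lambda> p A.D_nonneg by (intro \<tau>) auto
      have "D' (F x) (F z) / D' (F x) (F y) \<le> \<eta> (D x z / D x y)" by (rule qs) (use False in auto)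
      from this \<eta> have "D' (F x) (F z) / D' (F x) (F y) \<le> 1 / 2" by (rule order_trans)
      then have "D' (F x) (F z) \<le> D' (F x) (F y) / 2" using p by (simp add: field_simps)
      then show False using le p by simp
    qed
  qed
  have "compact (\<eta> ` {0..1})"
    by (intro compact_continuous_image continuous_on_subset[OF cont]) auto
  then obtain K where K: "\<And>r. 0 \<le> r \<Longrightarrow> r \<le> 1 \<Longrightarrow> \<eta> r \<le> K"
    using compact_imp_bounded[THEN bounded_imp_bdd_above] by (force simp: bdd_above_def)
  define \<Lambda>' where "\<Lambda>' = max 1 K"
  have \<Lambda>': "\<Lambda>' \<ge> 1" by (simp add: \<Lambda>'_def)
  have weak': "D' (F x) (F y) \<le> \<Lambda>' * D' (F x) (F z)" if le: "D x y \<le> D x z" for x y z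
  proof (cases "x = y \<or> x = z \<or> y = z")
    case True
    then consider "x = y" | "x = z" "x \<noteq> y" | "y = z" by blast
    then show ?thesis
    proof cases
      case 1 then show ?thesis using \<Lambda>' B.D_nonneg[of "F x" "F z"] by (simp add: B.D_diag)
    next
      case 2 then show ?thesis using le A.D_pos[of x y] by (simp add: A.D_diag)
    next
      case 3 then show ?thesis using \<Lambda>' B.D_nonneg[of "F x" "F z"] mult_right_mono[of 1 \<Lambda>' "D' (F x) (F z)"] by simp
    qed
  next
    case False
    then have p: "D x z > 0" "D' (F x) (F z) > 0" using A.D_pos B.D_pos inj by auto
    have \<eta>: "\<eta> (D x y / D x z) \<le> \<Lambda>'" using p le A.D_nonneg K[of "D x y / D x z"] by (auto simp: \<Lambda>'_def)
    have "D' (F x) (F y) / D' (F x) (F z) \<le> \<eta> (D x y / D x z)" by (rule qs) (use False in auto)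
    from this \<eta> have "D' (F x) (F y) / D' (F x) (F z) \<le> \<Lambda>'" by (rule order_trans)
    then show ?thesis using p by (simp add: field_simps)
  qed
  have "weak_qs M D a M' D' b F G \<Lambda>"
    by unfold_locales (use contF contG GF FG weak \<Lambda> in auto)
  moreover have "weak_qs M' D' b M D a G F \<Lambda>'"
  proof unfold_locales
    fix x y z assume "D (G x) (G y) \<le> D (G x) (G z)"
    from weak'[OF this] show "D' x y \<le> \<Lambda>' * D' x z" by (simp add: FG)
  qed (use contF contG GF FG \<Lambda>' in auto)
  ultimately show ?thesis using that by blast
qed

text \<open>Passing from volume \<open>s\<close> down to \<open>s * exp (- d)\<close> multiplies the
  logarithmic factor by at most \<open>(1 + d) ^ m\<close>, which
  \<open>exp (- (\<alpha> * d))\<close> absorbs. The condition \<open>\<alpha> \<le> 1\<close> makes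
  \<open>\<psi> r / r\<close> decreasing, and the cut-off at 0 keeps the factor positive for large
  volumes.\<close>

lemma gauge_fun_power_log:
  assumes \<alpha>: "0 < \<alpha>" "\<alpha> \<le> 1"
  shows "gauge_fun (\<lambda>r. r powr \<alpha> * (1 + max 0 (- ln r)) ^ m)"
proof -
  obtain C where C: "C > 0" "\<And>d. d \<ge> 0 \<Longrightarrow> (1 + 1 * d) ^ m * exp (- (\<alpha> * d)) \<le> C"
    using poly_exp_decay_bound[of \<alpha> 1 m] \<alpha> by auto
  let ?x = "\<lambda>r. max 0 (- ln r)" and ?\<psi> = "\<lambda>r. r powr \<alpha> * (1 + max 0 (- ln r)) ^ m"
  define C' where "C' = max C 1"
  have "?\<psi> r \<le> C' * ?\<psi> s \<and> ?\<psi> s / s \<le> C' * (?\<psi> r / r)" if rs: "0 < r" "r \<le> s" for r s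
  proof
    have s: "s > 0" using rs by simp
    define d where "d = ln s - ln r"
    have d: "d \<ge> 0" using rs by (simp add: d_def)
    have pos: "?\<psi> s > 0" "?\<psi> r > 0" using rs s by (auto intro!: mult_pos_pos zero_less_power add_pos_nonneg)
    have "1 + ?x r \<le> (1 + ?x s) * (1 + d)"
    proof -
      have "1 + ?x r \<le> 1 + ?x s + d" using d by (auto simp: d_def max_def)
      also have "\<dots> \<le> (1 + ?x s) * (1 + d)" using d by (simp add: algebra_simps)
      finally show ?thesis .
    qed
    then have "(1 + ?x r) ^ m \<le> ((1 + ?x s) * (1 + d)) ^ m" by (intro power_mono) auto
    moreover have "r powr \<alpha> = s powr \<alpha> * exp (- (\<alpha> * d))"
      using rs s by (simp add: powr_def d_def right_diff_distrib flip: exp_add)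
    ultimately have "?\<psi> r \<le> s powr \<alpha> * exp (- (\<alpha> * d)) * ((1 + ?x s) * (1 + d)) ^ m"
      by (simp add: mult_left_mono)
    also have "\<dots> = ?\<psi> s * ((1 + 1 * d) ^ m * exp (- (\<alpha> * d)))" by (simp add: power_mult_distrib mult_ac)
    also have "\<dots> \<le> ?\<psi> s * C'" using C(2)[OF d] pos by (intro mult_left_mono) (auto simp: C'_def)
    finally show "?\<psi> r \<le> C' * ?\<psi> s" by (simp add: mult.commute)
    have e: "u powr \<alpha> / u = u powr (\<alpha> - 1)" if "u > 0" for u using that by (simp add: powr_diff)
    have "?\<psi> s / s = s powr (\<alpha> - 1) * (1 + ?x s) ^ m" unfolding e[OF s, symmetric] by simp
    also have "\<dots> \<le> r powr (\<alpha> - 1) * (1 + ?x r) ^ m"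
    proof (intro mult_mono power_mono)
      show "s powr (\<alpha> - 1) \<le> r powr (\<alpha> - 1)" using \<alpha> rs by (intro powr_mono2') auto
      show "1 + ?x s \<le> 1 + ?x r" using rs by (auto simp: max_def)
    qed auto
    also have "\<dots> = ?\<psi> r / r" unfolding e[OF rs(1), symmetric] by simp
    also have "\<dots> \<le> C' * (?\<psi> r / r)" using pos rs mult_right_mono[of 1 C' "?\<psi> r / r"] by (simp add: C'_def)
    finally show "?\<psi> s / s \<le> C' * (?\<psi> r / r)" .
  qed
  moreover have "C' > 0" by (simp add: C'_def)
  moreover have "?\<psi> r > 0" if "r > 0" for r using that by (auto intro!: mult_pos_pos zero_less_power add_pos_nonneg)
  ultimately show ?thesis unfolding gauge_fun_def by blast
qed

lemma positive_real_parts_scaleR: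
  fixes B :: "real^'n^'n"
  assumes B: "positive_real_parts B" and s: "s > 0"
  shows "positive_real_parts (s *\<^sub>R B)"
  unfolding positive_real_parts_def
proof (intro allI impI)
  fix \<mu> assume "eigenvalue (complex_mat (s *\<^sub>R B)) \<mu>"
  then obtain v where v: "v \<in> carrier_vec CARD('n)" "v \<noteq> 0\<^sub>v CARD('n)" "complex_mat (s *\<^sub>R B) *\<^sub>v v = \<mu> \<cdot>\<^sub>v v"
    by (auto simp: eigenvalue_def eigenvector_def complex_mat_def)
  have eq: "complex_mat (s *\<^sub>R B) = complex_of_real s \<cdot>\<^sub>m complex_mat B"
    by (rule eq_matI) (auto simp: complex_mat_def)
  have "complex_mat B *\<^sub>v v = (\<mu> / s) \<cdot>\<^sub>v v"
  proof (rule eq_vecI)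
    show "dim_vec (complex_mat B *\<^sub>v v) = dim_vec ((\<mu> / s) \<cdot>\<^sub>v v)" using v(1) by (simp add: complex_mat_def)
    fix i assume "i < dim_vec ((\<mu> / s) \<cdot>\<^sub>v v)"
    then have i: "i < CARD('n)" using v(1) by simp
    have d: "dim_row (complex_mat B) = CARD('n)" "dim_col (complex_mat B) = CARD('n)" by (simp_all add: complex_mat_def)
    have "vec_index (complex_mat (s *\<^sub>R B) *\<^sub>v v) i = complex_of_real s * vec_index (complex_mat B *\<^sub>v v) i"
      unfolding eq using i v(1) d by (simp add: scalar_prod_def sum_distrib_left mult_ac)
    moreover have "vec_index (complex_mat (s *\<^sub>R B) *\<^sub>v v) i = \<mu> * vec_index v i" unfolding v(3) using i v(1) by simp
    ultimately show "vec_index (complex_mat B *\<^sub>v v) i = vec_index ((\<mu> / s) \<cdot>\<^sub>v v) i" using i v(1) s by (simp add: field_simps)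
  qed
  then have "eigenvalue (complex_mat B) (\<mu> / s)"
    using v unfolding eigenvalue_def eigenvector_def by (auto simp: complex_mat_def)
  then have "Re (\<mu> / s) > 0" using B unfolding positive_real_parts_def by blast
  then show "Re \<mu> > 0" using s by (simp add: zero_less_divide_iff)
qed

text \<open>A position with larger real part would give a nonzero covector that decays faster than
  the determinant. By \<open>det_vec_bound\<close>, matrices with bounded entries shrink no vector
  by more than the order of their determinant.\<close>

lemma jpos_le_rate:
  fixes A :: "real^'n^'n"
  assumes A: "positive_real_parts A" and det: "\<And>t. det (matrix_exp (t *\<^sub>R A)) = exp (a * t)" and p: "p < CARD('n)"
  shows "Re (fst (jpos A ! p)) \<le> a"
proof (rule ccontr)
  define \<rho> where "\<rho> = Re (fst (jpos A ! p))"
  define m where "m = snd (jpos A ! p)"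
  assume "\<not> Re (fst (jpos A ! p)) \<le> a"
  then have \<rho>: "\<rho> > a" by (simp add: \<rho>_def)
  have "p \<in> slow_positions (jpos A) \<rho> m" using p jpos_chain(2)[of A] by (simp add: slow_positions_def \<rho>_def m_def)
  moreover have "finite (slow_positions (jpos A) \<rho> m)" by (simp add: slow_positions_def)
  ultimately have "card (slow_positions (jpos A) \<rho> m) > 0" by (metis card_gt_0_iff empty_iff)
  then have "dim (decay_vectors (\<lambda>t. matrix_exp (t *\<^sub>R A)) \<rho> 1 m) > 0"
    using dim_decay_vectors[of 1 A \<rho> m] by simp
  then have "dim (decay_vectors (\<lambda>t. matrix_exp (t *\<^sub>R A)) \<rho> 1 m) \<noteq> 0" by linarith
  then obtain \<xi> where \<xi>: "\<xi> \<noteq> 0" "\<xi> \<in> decay_vectors (\<lambda>t. matrix_exp (t *\<^sub>R A)) \<rho> 1 m"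
    unfolding dim_eq_0 by blast
  from \<xi>(2) obtain C where C: "\<And>t. t \<ge> 0 \<Longrightarrow> norm (transpose (matrix_exp ((- t) *\<^sub>R A)) *v \<xi>) \<le> C * (exp (- (\<rho> * t)) * (1 + 1 * t) ^ m)"
    unfolding decay_vectors_def mem_Collect_eq by blast
  obtain C0 e where C0: "C0 > 0" "e > 0" "\<And>t i j. t \<ge> 0 \<Longrightarrow> \<bar>matrix_exp ((- t) *\<^sub>R A) $ i $ j\<bar> \<le> C0 * exp (- (e * t))"
    by (rule matrix_exp_contracting[OF A], rule that)
  obtain K where K: "K > 0" "\<And>(X::real^'n^'n) x. \<forall>i j. \<bar>X $ i $ j\<bar> \<le> C0 \<Longrightarrow> \<bar>det X\<bar> * norm x \<le> K * norm (X *v x)"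
    by (rule det_vec_bound[OF C0(1)], rule that)
  \<comment> \<open>One half of the gap absorbs the polynomial factor, and the other half tends to
    0.\<close>
  define \<delta> where "\<delta> = (\<rho> - a) / 2"
  have \<delta>: "\<delta> > 0" using \<rho> by (simp add: \<delta>_def)
  obtain C1 where C1: "C1 > 0" "\<And>t. t \<ge> 0 \<Longrightarrow> (1 + 1 * t) ^ m * exp (- (\<delta> * t)) \<le> C1"
    using poly_exp_decay_bound[of \<delta> 1 m] \<delta> by auto
  have "norm \<xi> \<le> K * \<bar>C\<bar> * C1 * exp (- (\<delta> * t))" if t: "t \<ge> 0" for t
  proof -
    let ?X = "transpose (matrix_exp ((- t) *\<^sub>R A))"
    have "\<bar>?X $ i $ j\<bar> \<le> C0" for i j
    proof -
      have "exp (- (e * t)) \<le> 1" using C0 t by simp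
      then have "C0 * exp (- (e * t)) \<le> C0 * 1" using C0 by (intro mult_left_mono) auto
      then show ?thesis using C0(3)[OF t, of j i] by (simp add: Finite_Cartesian_Product.transpose_def)
    qed
    with K(2)[of ?X \<xi>] have "\<bar>det ?X\<bar> * norm \<xi> \<le> K * norm (?X *v \<xi>)" by blast
    then have "exp (a * (- t)) * norm \<xi> \<le> K * norm (?X *v \<xi>)"
      using det[of "- t"] by (simp add: Determinants.det_transpose del: transpose_matrix_vector)
    also have "\<dots> \<le> K * (\<bar>C\<bar> * (exp (- (\<rho> * t)) * (1 + 1 * t) ^ m))"
    proof (intro mult_left_mono)
      show "norm (?X *v \<xi>) \<le> \<bar>C\<bar> * (exp (- (\<rho> * t)) * (1 + 1 * t) ^ m)"
        by (rule order_trans[OF C[OF t]], rule mult_right_mono) (use t in auto)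
    qed (use K in auto)
    finally have f1: "exp (a * t) * (exp (a * (- t)) * norm \<xi>) \<le> exp (a * t) * (K * (\<bar>C\<bar> * (exp (- (\<rho> * t)) * (1 + 1 * t) ^ m)))"
      by (intro mult_left_mono) auto
    have f2: "exp (a * t) * (exp (a * (- t)) * norm \<xi>) = norm \<xi>" by (simp add: exp_minus)
    have e2: "exp (a * t) * exp (- (\<rho> * t)) = exp (- (\<delta> * t)) * exp (- (\<delta> * t))"
      by (simp add: \<delta>_def field_simps flip: exp_add)
    have "exp (a * t) * (K * (\<bar>C\<bar> * (exp (- (\<rho> * t)) * (1 + 1 * t) ^ m))) = K * \<bar>C\<bar> * ((1 + 1 * t) ^ m * (exp (a * t) * exp (- (\<rho> * t))))"
      by (simp only: mult_ac)
    also have "\<dots> = K * \<bar>C\<bar> * ((1 + 1 * t) ^ m * exp (- (\<delta> * t))) * exp (- (\<delta> * t))"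
      unfolding e2 by (simp only: mult_ac)
    also have "\<dots> \<le> K * \<bar>C\<bar> * C1 * exp (- (\<delta> * t))"
      using C1(2)[OF t] K by (intro mult_right_mono mult_left_mono) auto
    finally have "exp (a * t) * (K * (\<bar>C\<bar> * (exp (- (\<rho> * t)) * (1 + 1 * t) ^ m))) \<le> K * \<bar>C\<bar> * C1 * exp (- (\<delta> * t))" .
    with f1 f2 show ?thesis by linarith
  qed
  then have "\<forall>\<^sub>F t in at_top. norm \<xi> \<le> K * \<bar>C\<bar> * C1 * exp (- (\<delta> * t))"
    using eventually_ge_at_top[of 0] by (rule eventually_mono[rotated])
  moreover have "((\<lambda>t. exp (- (\<delta> * t))) \<longlongrightarrow> 0) at_top" using \<delta> by real_asymp
  then have "((\<lambda>t. K * \<bar>C\<bar> * C1 * exp (- (\<delta> * t))) \<longlongrightarrow> K * \<bar>C\<bar> * C1 * 0) at_top"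
    by (intro tendsto_mult tendsto_const)
  ultimately have "norm \<xi> \<le> K * \<bar>C\<bar> * C1 * 0" by (intro tendsto_lowerbound[of _ _ at_top]) auto
  with \<xi>(1) show False by simp
qed

text \<open>\<open>a'\<close> is a normalising rate common to both groups, whereas \<open>a\<close>
  belongs to the group at hand; their quotient becomes the change of time scale.\<close>

lemma (in dilation) decay_space_power_log:
  "decay_space (\<lambda>r. r powr (\<rho> / a') * (1 + max 0 (- ln r)) ^ m) =
    {\<xi>. \<exists>C. \<forall>t\<ge>0. norm (transpose (M (- t)) *v \<xi>) \<le> C * (exp (- (\<rho> * (a / a') * t)) * (1 + a * t) ^ m)}"
proof -
  have "exp (- (a * t)) powr (\<rho> / a') * (1 + max 0 (- ln (exp (- (a * t))))) ^ m = exp (- (\<rho> * (a / a') * t)) * (1 + a * t) ^ m"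
    if "t \<ge> 0" for t
    using a_pos that by (simp add: powr_def mult_ac)
  then show ?thesis unfolding decay_space_def by simp
qed

lemma equal_forms_of_quasisymmetric:
  fixes A B :: "real^'n^'n"
  assumes A: "positive_real_parts A" and B: "positive_real_parts B"
    and dA: "dilation (\<lambda>t. matrix_exp (t *\<^sub>R A)) D a" and dB: "dilation (\<lambda>t. matrix_exp (t *\<^sub>R B)) D' b"
    and qs: "quasisymmetric D D' F"
  shows "real_part_jordan_form A = real_part_jordan_form ((a / b) *\<^sub>R B)"
proof -
  interpret A: dilation "\<lambda>t. matrix_exp (t *\<^sub>R A)" D a by fact
  interpret B: dilation "\<lambda>t. matrix_exp (t *\<^sub>R B)" D' b by fact
  obtain G \<Lambda> \<Lambda>' where "weak_qs (\<lambda>t. matrix_exp (t *\<^sub>R A)) D a (\<lambda>t. matrix_exp (t *\<^sub>R B)) D' b F G \<Lambda>"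
    and "weak_qs (\<lambda>t. matrix_exp (t *\<^sub>R B)) D' b (\<lambda>t. matrix_exp (t *\<^sub>R A)) D a G F \<Lambda>'"
    by (rule quasisymmetric_imp_weak_qs[OF dA dB qs], rule that)
  then interpret AB: weak_qs "\<lambda>t. matrix_exp (t *\<^sub>R A)" D a "\<lambda>t. matrix_exp (t *\<^sub>R B)" D' b F G \<Lambda>
    + BA: weak_qs "\<lambda>t. matrix_exp (t *\<^sub>R B)" D' b "\<lambda>t. matrix_exp (t *\<^sub>R A)" D a G F \<Lambda>' .
  \<comment> \<open>Makes both determinants grow at the same rate \<open>a\<close>.\<close>
  define s where "s = a / b"
  have s: "s > 0" using A.a_pos B.a_pos by (simp add: s_def)
  let ?B = "s *\<^sub>R B"
  have B': "positive_real_parts ?B" using B s by (rule positive_real_parts_scaleR)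
  have detB': "det (matrix_exp (t *\<^sub>R ?B)) = exp (a * t)" for t
    using B.M_det[of "t * s"] B.a_pos by (simp add: s_def mult_ac)
  have "card (slow_positions (jpos A) \<rho> m) = card (slow_positions (jpos ?B) \<rho> m)" for \<rho> m
  proof -
    have len: "length (jpos A) = CARD('n)" "length (jpos ?B) = CARD('n)" by (rule jpos_chain)+
    \<comment> \<open>Outside the interval from 0 to \<open>a\<close> all positions count or none
      does. Inside it \<open>\<rho> / a\<close> is an admissible exponent for a gauge.\<close>
    consider "\<rho> \<le> 0" | "\<rho> > a" | "0 < \<rho>" "\<rho> \<le> a" by linarith
    then show ?thesis
    proof cases
      case 1
      have "slow_positions (jpos X) \<rho> m = {p. p < CARD('n)}" if X: "positive_real_parts X" "length (jpos X) = CARD('n)" for X :: "real^'n^'n"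
        unfolding slow_positions_def X(2) using jpos_positive[OF X(1)] 1 by (auto intro: le_less_trans)
      then show ?thesis using A B' len by simp
    next
      case 2
      have "slow_positions (jpos X) \<rho> m = {}"
        if X: "positive_real_parts X" "\<And>t. det (matrix_exp (t *\<^sub>R X)) = exp (a * t)" "length (jpos X) = CARD('n)" for X :: "real^'n^'n"
        unfolding slow_positions_def X(3) using jpos_le_rate[OF X(1,2)] 2 by fastforce
      then show ?thesis using A B' len A.M_det detB' by simp
    next
      case 3
      define \<psi> where "\<psi> = (\<lambda>r. r powr (\<rho> / a) * (1 + max 0 (- ln r)) ^ m)"
      have g: "gauge_fun \<psi>" unfolding \<psi>_def using 3 A.a_pos by (intro gauge_fun_power_log) auto
      have "dim (A.decay_space \<psi>) = dim (B.decay_space \<psi>)"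
        using AB.dim_decay_space_le[OF g] BA.dim_decay_space_le[OF g] by (rule antisym[rotated])
      moreover have "A.decay_space \<psi> = decay_vectors (\<lambda>t. matrix_exp (t *\<^sub>R A)) \<rho> a m"
        unfolding \<psi>_def A.decay_space_power_log decay_vectors_def using A.a_pos by simp
      \<comment> \<open>Replacing \<open>B\<close> by its multiple rescales time by
        \<open>s\<close>, which does not change the set of covectors satisfying the bound.\<close>
      moreover have "B.decay_space \<psi> = decay_vectors (\<lambda>t. matrix_exp (t *\<^sub>R ?B)) \<rho> a m"
      proof -
        have "(\<forall>t\<ge>0. norm (transpose (matrix_exp ((- t) *\<^sub>R B)) *v \<xi>) \<le> C * (exp (- (\<rho> * (b / a) * t)) * (1 + b * t) ^ m)) \<longleftrightarrow>
          (\<forall>t\<ge>0. norm (transpose (matrix_exp ((- t) *\<^sub>R ?B)) *v \<xi>) \<le> C * (exp (- (\<rho> * t)) * (1 + a * t) ^ m))" (is "?l \<longleftrightarrow> ?r") for \<xi> C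
        proof
          assume ?l
          show ?r
          proof (intro allI impI)
            fix t :: real assume t: "t \<ge> 0"
            have "(- (s * t)) *\<^sub>R B = (- t) *\<^sub>R ?B" "\<rho> * (b / a) * (s * t) = \<rho> * t" "b * (s * t) = a * t"
              using A.a_pos B.a_pos by (simp_all add: s_def mult.commute)
            moreover have "s * t \<ge> 0" using s t by simp
            ultimately show "norm (transpose (matrix_exp ((- t) *\<^sub>R ?B)) *v \<xi>) \<le> C * (exp (- (\<rho> * t)) * (1 + a * t) ^ m)"
              using \<open>?l\<close> by metis
          qed
        next
          assume ?r
          show ?l
          proof (intro allI impI)
            fix t :: real assume t: "t \<ge> 0"
            have "(- (t / s)) *\<^sub>R ?B = (- t) *\<^sub>R B" "\<rho> * (t / s) = \<rho> * (b / a) * t" "a * (t / s) = b * t"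
              using A.a_pos B.a_pos by (simp_all add: s_def)
            moreover have "t / s \<ge> 0" using s t by simp
            ultimately show "norm (transpose (matrix_exp ((- t) *\<^sub>R B)) *v \<xi>) \<le> C * (exp (- (\<rho> * (b / a) * t)) * (1 + b * t) ^ m)"
              using \<open>?r\<close> by metis
          qed
        qed
        then show ?thesis unfolding \<psi>_def B.decay_space_power_log decay_vectors_def by simp
      qed
      ultimately show ?thesis using dim_decay_vectors[OF A.a_pos] by metis
    qed
  qed
  then show ?thesis unfolding s_def by (rule real_part_jordan_form_eqI)
qed

theorem theorem1p1:
  fixes A B :: "real^'n^'n"
    and mA mB :: "(real^'n) \<times> real \<Rightarrow> (real^'n) \<times> real \<Rightarrow> (real^'n) \<times> real \<Rightarrow> real"
  assumes "positive_real_parts A" and "positive_real_parts B"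
    and "admissible_metric A mA" and "admissible_metric B mB"
  shows "(\<exists>F. quasisymmetric (parabolic_visual A mA) (parabolic_visual B mB) F) \<longleftrightarrow>
         (\<exists>s>0. real_part_jordan_form A = real_part_jordan_form (s *\<^sub>R B))"
proof -
  obtain a where a: "dilation (\<lambda>t. matrix_exp (t *\<^sub>R A)) (parabolic_visual A mA) a"
    by (rule admissible_dilation[OF assms(1,3)])
  obtain b where b: "dilation (\<lambda>t. matrix_exp (t *\<^sub>R B)) (parabolic_visual B mB) b"
    by (rule admissible_dilation[OF assms(2,4)])
  have "a / b > 0" using dilation.a_pos[OF a] dilation.a_pos[OF b] by simp
  then show ?thesis
    using equal_forms_of_quasisymmetric[OF assms(1,2) a b] quasisymmetric_of_equal_forms[OF a b] by blast
qed

end
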